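(* Let $n\ge 1$. The restriction of the product of the monoid $M_{\mu_n}$ to a partial product on $P_{\mu_n}$ (the product of $a,b\in P_{\mu_n}$ being defined exactly when the product $ab$ taken in $M_{\mu_n}$ lies in $P_{\mu_n}$) is a pre-Garside structure on $P_{\mu_n}$, and $P_{\mu_n}$ has a least common (right) multiple $\delta$ of all its elements.
   Context: **Braids.** $X_n$ is the space of subsets of $\mathbf{C}$ of cardinality $n$ with its natural topology, $\mu_n\in X_n$ is the set of $n$-th roots of unity. In fundamental groups, the product $\gamma\gamma'$ means $\gamma$ followed by $\gamma'$. For $x\in X_n$ let $B_x=\pi_1(X_n,x)$. A pair $\{z,z'\}\subset x$ ($z\ne z'$) is non obstructing if the closed segment $[z,z']$ meets $x$ only at $z$ and $z'$. For such a pair, $\delta_{\{z,z'\}}\in B_x$ is the class of the loop whose strings are: $\gamma_{z''}(t)=z''$ for $z''\in x\setminus\{z,z'\}$, $\gamma_z=f(z,z',\epsilon)$, $\gamma_{z'}=f(z',z,\epsilon)$, where $f(z,z',\epsilon)(t)=\frac{z+z'}2+\frac{z-z'}2\cos(\pi t)+i\epsilon\frac{z-z'}2\sin(\pi t)$, $t\in[0,1]$, and $\epsilon>0$ is small enough (depending on $x$). $M_x$ is the submonoid of $B_x$ generated by all the $\delta_{\{z,z'\}}$. **Non obstructing partitions.** A finite non-empty subset of $\mathbf{C}$ is convex if it is a single point, a pair of points, or the set of vertices (three or more) of a non-degenerate convex polygon (no three vertices collinear). A set partition $\lambda$ of $x$ is non obstructing if all its parts are convex and the convex hulls of distinct parts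 are disjoint. If $\nu$ is a part of a non obstructing partition and $z_1,\dots,z_k$ are its elements numbered in clockwise order, $\delta_\nu=\delta_{\{z_1,z_2\}}\delta_{\{z_2,z_3\}}\cdots\delta_{\{z_{k-1},z_k\}}$ (independent of the choice of $z_1$; trivial if $k=1$). For a non obstructing partition $\lambda$, $\delta_\lambda=\prod_{\nu\in\lambda}\delta_\nu$ (the factors commute). $P_x$ is the set of all $\delta_\lambda$, $\lambda$ a non obstructing partition of $x$. **Pre-Garside structures.** An atomic partial product on a set $P$ is a partial map $P\times P\to P$, $(a,b)\mapsto ab$, such that: (i) there is $1\in P$ such that for all $a$, $1a$ and $a1$ are defined and equal to $a$; and for $a,b,c\in P$, $ab$ and $(ab)c$ are defined if and only if $bc$ and $a(bc)$ are defined, and then $(ab)c=a(bc)$; (ii) with $P^*=P\setminus\{1\}$, products (when defined) of elements of $P^*$ lie in $P^*$, and the set $S$ of elements of $P^*$ which are not products of two elements of $P^*$ (the atoms) is finite; (iii) there is $l:P\to\mathbf{N}$ with $l(p)>0$ for $p\in P^*$ and $l(ab)=l(a)+l(b)$ whenever $ab$ is defined. The associated monoid $M(P)$ is the monoid with generators $P$ and relations $ab=c$ whenever $ab$ is defined in $P$ and equal to $c$ (the element $1\in P$ being the unit). $c$ is a right (resp. left) multiple of $a$ if $c=ab$ (resp. $c=ba$) for some $b$; least common multiples are with respect to the corresponding divisibility. "$ab\in P$" means that $ab$ is defined in $P$. A pre-Garside structure on $P$ is an atomic partial product, with set of atoms $S$, satisfying moreover: (iv) if two elements $s,t$ of $S$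 have a common right multiple in $P$, they have a least common right multiple in $P$, denoted $\Delta_{s,t}$; (iv') if two elements of $S$ have a common left multiple in $P$, they have a least common left multiple in $P$; (v) if $s,t\in S$ have a common right multiple in $P$ and $a\in P$ is such that $as\in P$ and $at\in P$, then $a\Delta_{s,t}\in P$; (vi) for all $m\in M(P)$ and $a,b\in P$, if $am=bm$ or $ma=mb$ then $a=b$. *)

theory Defs
  imports "HOL-Analysis.Analysis" "HOL-Algebra.Group" "HOL-Library.Disjoint_Sets"
begin

section \<open>Fundamental groups\<close>

text \<open>A loop is a function on all of \<open>real\<close> of which only the values on \<open>{0..1}\<close> matter: two loops
  that agree on \<open>{0..1}\<close> are homotopic.\<close>

definition loops_at :: "'a topology \<Rightarrow> 'a \<Rightarrow> (real \<Rightarrow> 'a) set" where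
  "loops_at X x = {p. pathin X p \<and> p 0 = x \<and> p 1 = x}"

definition loop_homotopy :: "'a topology \<Rightarrow> 'a \<Rightarrow> ((real \<Rightarrow> 'a) \<times> (real \<Rightarrow> 'a)) set" where
  "loop_homotopy X x =
     {(p, q). homotopic_with (\<lambda>r. r 0 = x \<and> r 1 = x) (top_of_set {0..1}) X p q}"

definition loop_class :: "'a topology \<Rightarrow> 'a \<Rightarrow> (real \<Rightarrow> 'a) \<Rightarrow> (real \<Rightarrow> 'a) set" where
  "loop_class X x p = loop_homotopy X x `` {p}"

text \<open>First \<open>p\<close>, then \<open>q\<close>. The library operation \<open>joinpaths\<close> is the same function, but it is
  restricted to the type class of topological spaces, to which \<open>complex set\<close> does not belong.\<close>

definition join_loops :: "(real \<Rightarrow> 'a) \<Rightarrow> (real \<Rightarrow> 'a) \<Rightarrow> real \<Rightarrow> 'a" where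
  "join_loops p q = (\<lambda>t. if t \<le> 1/2 then p (2 * t) else q (2 * t - 1))"

definition fundamental_group :: "'a topology \<Rightarrow> 'a \<Rightarrow> (real \<Rightarrow> 'a) set monoid" where
  "fundamental_group X x =
     \<lparr>carrier = loops_at X x // loop_homotopy X x,
      mult = (\<lambda>A B. \<Union>p\<in>A. \<Union>q\<in>B. loop_class X x (join_loops p q)),
      one = loop_class X x (\<lambda>_. x)\<rparr>"


section \<open>The space of \<open>n\<close>-element subsets of the plane\<close>

definition quotient_topology :: "'a topology \<Rightarrow> ('a \<Rightarrow> 'b) \<Rightarrow> 'b topology" where
  "quotient_topology X f =
     topology (\<lambda>U. U \<subseteq> f ` topspace X \<and> openin X {z \<in> topspace X. f z \<in> U})"

lemma openin_quotient_topology: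
  "openin (quotient_topology X f) U \<longleftrightarrow>
     U \<subseteq> f ` topspace X \<and> openin X {z \<in> topspace X. f z \<in> U}"
proof -
  have "istopology (\<lambda>U. U \<subseteq> f ` topspace X \<and> openin X {z \<in> topspace X. f z \<in> U})"
    unfolding istopology_def
  proof (rule conjI; intro allI impI)
    fix U V
    assume U: "U \<subseteq> f ` topspace X \<and> openin X {z \<in> topspace X. f z \<in> U}"
      and V: "V \<subseteq> f ` topspace X \<and> openin X {z \<in> topspace X. f z \<in> V}"
    have eq: "{z \<in> topspace X. f z \<in> U \<inter> V} =
        {z \<in> topspace X. f z \<in> U} \<inter> {z \<in> topspace X. f z \<in> V}"
      by blast
    show "U \<inter> V \<subseteq> f ` topspace X \<and> openin X {z \<in> topspace X. f z \<in> U \<inter> V}"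
      unfolding eq using U V by (blast intro: openin_Int)
  next
    fix K
    assume K: "\<forall>U\<in>K. U \<subseteq> f ` topspace X \<and> openin X {z \<in> topspace X. f z \<in> U}"
    have eq: "{z \<in> topspace X. f z \<in> \<Union>K} = (\<Union>U\<in>K. {z \<in> topspace X. f z \<in> U})"
      by blast
    have "openin X (\<Union>U\<in>K. {z \<in> topspace X. f z \<in> U})"
      using K by (intro openin_Union) blast
    moreover have "\<Union>K \<subseteq> f ` topspace X"
      using K by blast
    ultimately show "\<Union>K \<subseteq> f ` topspace X \<and> openin X {z \<in> topspace X. f z \<in> \<Union>K}"
      unfolding eq by (rule conjI [rotated])
  qed
  then show ?thesis
    by (simp add: quotient_topology_def topology_inverse')
qed

lemma topspace_quotient_topology [simp]:
  "topspace (quotient_topology X f) = f ` topspace X"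
proof (rule subset_antisym)
  show "topspace (quotient_topology X f) \<subseteq> f ` topspace X"
    by (rule conjunct1 [OF iffD1 [OF openin_quotient_topology openin_topspace]])
  have "{z \<in> topspace X. f z \<in> f ` topspace X} = topspace X"
    by blast
  then have "openin (quotient_topology X f) (f ` topspace X)"
    unfolding openin_quotient_topology by (metis openin_topspace subset_refl)
  then show "f ` topspace X \<subseteq> topspace (quotient_topology X f)"
    by (rule openin_subset)
qed

lemma quotient_map_quotient_topology: "quotient_map X (quotient_topology X f) f"
  unfolding quotient_map_def by (simp add: openin_quotient_topology)

definition ordered_configuration_space :: "nat \<Rightarrow> (nat \<Rightarrow> complex) topology" where
  "ordered_configuration_space n =
     subtopology (product_topology (\<lambda>_. euclidean) {..<n}) {z. inj_on z {..<n}}"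

text \<open>The natural topology on the set of \<open>n\<close>-element subsets is the quotient topology for the
  action of the symmetric group on ordered configurations.\<close>

definition configuration_space :: "nat \<Rightarrow> complex set topology" where
  "configuration_space n = quotient_topology (ordered_configuration_space n) (\<lambda>z. z ` {..<n})"

lemma topspace_configuration_space:
  "topspace (configuration_space n) = {x. finite x \<and> card x = n}"
proof -
  have top: "topspace (ordered_configuration_space n) =
      (\<Pi>\<^sub>E i\<in>{..<n}. UNIV) \<inter> {z. inj_on z {..<n}}"
    unfolding ordered_configuration_space_def topspace_subtopology topspace_product_topology
    by (simp only: o_def topspace_euclidean)
  show ?thesis
    unfolding configuration_space_def topspace_quotient_topology top
  proof (intro equalityI subsetI)
    fix x
    assume "x \<in> (\<lambda>z. z ` {..<n}) ` ((\<Pi>\<^sub>E i\<in>{..<n}. UNIV :: complex set) \<inter> {z. inj_on z {..<n}})"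
    then obtain z :: "nat \<Rightarrow> complex" where "inj_on z {..<n}" "x = z ` {..<n}"
      by blast
    then show "x \<in> {x. finite x \<and> card x = n}"
      by (simp add: card_image)
  next
    fix x :: "complex set"
    assume "x \<in> {x. finite x \<and> card x = n}"
    then obtain h where "bij_betw h {0..<n} x"
      using ex_bij_betw_nat_finite [of x] by blast
    then have h: "inj_on h {..<n}" "h ` {..<n} = x"
      unfolding bij_betw_def atLeast0LessThan by blast+
    show "x \<in> (\<lambda>z. z ` {..<n}) ` ((\<Pi>\<^sub>E i\<in>{..<n}. UNIV) \<inter> {z. inj_on z {..<n}})"
    proof (rule image_eqI [where x = "restrict h {..<n}"])
      show "x = restrict h {..<n} ` {..<n}"
        using h(2) by simp
      show "restrict h {..<n} \<in> (\<Pi>\<^sub>E i\<in>{..<n}. UNIV) \<inter> {z. inj_on z {..<n}}"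
        using h(1) by (simp add: inj_on_def)
    qed
  qed
qed

definition roots_of_unity :: "nat \<Rightarrow> complex set" where
  "roots_of_unity n = {z. z ^ n = 1}"


section \<open>Braids\<close>

definition braid_group :: "complex set \<Rightarrow> (real \<Rightarrow> complex set) set monoid" where
  "braid_group x = fundamental_group (configuration_space (card x)) x"

definition nonobstructing_pair :: "complex set \<Rightarrow> complex \<Rightarrow> complex \<Rightarrow> bool" where
  "nonobstructing_pair x z z' \<longleftrightarrow>
     z \<in> x \<and> z' \<in> x \<and> z \<noteq> z' \<and> closed_segment z z' \<inter> x = {z, z'}"

definition half_ellipse :: "complex \<Rightarrow> complex \<Rightarrow> real \<Rightarrow> real \<Rightarrow> complex" where
  "half_ellipse z z' e t =
     (z + z') / 2 + (z - z') / 2 * of_real (cos (pi * t))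
       + \<i> * of_real e * ((z - z') / 2) * of_real (sin (pi * t))"

definition half_twist :: "complex set \<Rightarrow> complex \<Rightarrow> complex \<Rightarrow> real \<Rightarrow> real \<Rightarrow> complex set" where
  "half_twist x z z' e = (\<lambda>t. (x - {z, z'}) \<union> {half_ellipse z z' e t, half_ellipse z' z e t})"

text \<open>The common class of the loops \<open>half_twist x z z' e\<close> for all sufficiently small \<open>e > 0\<close>.
  It is symmetric in \<open>z\<close> and \<open>z'\<close>.\<close>

definition pair_braid :: "complex set \<Rightarrow> complex \<Rightarrow> complex \<Rightarrow> (real \<Rightarrow> complex set) set" where
  "pair_braid x z z' =
     (THE c. \<forall>\<^sub>F e in at_right 0.
        loop_class (configuration_space (card x)) x (half_twist x z z' e) = c)"

definition generated_submonoid :: "('a, 'b) monoid_scheme \<Rightarrow> 'a set \<Rightarrow> 'a set" where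
  "generated_submonoid G A = \<Inter>{H. submonoid H G \<and> A \<subseteq> H}"

definition braid_monoid :: "complex set \<Rightarrow> (real \<Rightarrow> complex set) set monoid" where
  "braid_monoid x =
     (braid_group x)\<lparr>carrier := generated_submonoid (braid_group x)
        {pair_braid x z z' | z z'. nonobstructing_pair x z z'}\<rparr>"


section \<open>Non obstructing partitions\<close>

text \<open>The vertices of a polygon are its extreme points, so no three of them are collinear; a
  two-dimensional polytope has at least three.\<close>

definition convex_subset :: "complex set \<Rightarrow> bool" where
  "convex_subset A \<longleftrightarrow>
     card A = 1 \<or> card A = 2 \<or>
     (\<exists>Q. polytope Q \<and> aff_dim Q = 2 \<and> A = {v. v extreme_point_of Q})"

definition nonobstructing_partition :: "complex set \<Rightarrow> complex set set \<Rightarrow> bool" where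
  "nonobstructing_partition x L \<longleftrightarrow>
     partition_on x L \<and> (\<forall>A\<in>L. convex_subset A) \<and>
     (\<forall>A\<in>L. \<forall>B\<in>L. A \<noteq> B \<longrightarrow> convex hull A \<inter> convex hull B = {})"

text \<open>\<open>zs\<close> lists the elements of \<open>A\<close> in clockwise order: any three of them, in the order in which
  they are listed, form a negatively oriented triangle.\<close>

definition clockwise_numbering :: "complex set \<Rightarrow> complex list \<Rightarrow> bool" where
  "clockwise_numbering A zs \<longleftrightarrow>
     distinct zs \<and> set zs = A \<and>
     (\<forall>i j k. i < j \<and> j < k \<and> k < length zs \<longrightarrow>
        Im (cnj (zs ! j - zs ! i) * (zs ! k - zs ! i)) < 0)"

definition list_product :: "('a, 'b) monoid_scheme \<Rightarrow> 'a list \<Rightarrow> 'a" where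
  "list_product G gs = foldr (\<lambda>g h. g \<otimes>\<^bsub>G\<^esub> h) gs \<one>\<^bsub>G\<^esub>"

text \<open>In the next two definitions the product does not depend on the choice of the list.\<close>

definition part_braid :: "complex set \<Rightarrow> complex set \<Rightarrow> (real \<Rightarrow> complex set) set" where
  "part_braid x A =
     (let zs = (SOME zs. clockwise_numbering A zs)
      in list_product (braid_group x) (map2 (pair_braid x) zs (tl zs)))"

definition partition_braid :: "complex set \<Rightarrow> complex set set \<Rightarrow> (real \<Rightarrow> complex set) set" where
  "partition_braid x L =
     (let As = (SOME As. distinct As \<and> set As = L)
      in list_product (braid_group x) (map (part_braid x) As))"

definition partition_braids :: "complex set \<Rightarrow> (real \<Rightarrow> complex set) set set" where
  "partition_braids x = {partition_braid x L | L. nonobstructing_partition x L}"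


section \<open>Pre-Garside structures\<close>

text \<open>A partial product on a set \<open>P\<close> is a function \<open>m\<close> for which \<open>m a b = Some c\<close> means that
  \<open>ab\<close> is defined and equal to \<open>c\<close>; its values outside \<open>P\<close> are irrelevant.\<close>

definition partial_unit :: "'a set \<Rightarrow> ('a \<Rightarrow> 'a \<Rightarrow> 'a option) \<Rightarrow> 'a" where
  "partial_unit P m = (THE e. e \<in> P \<and> (\<forall>a\<in>P. m e a = Some a \<and> m a e = Some a))"

definition nonunits :: "'a set \<Rightarrow> ('a \<Rightarrow> 'a \<Rightarrow> 'a option) \<Rightarrow> 'a set" where
  "nonunits P m = P - {partial_unit P m}"

definition atoms :: "'a set \<Rightarrow> ('a \<Rightarrow> 'a \<Rightarrow> 'a option) \<Rightarrow> 'a set" where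
  "atoms P m =
     {s \<in> nonunits P m. \<not> (\<exists>a\<in>nonunits P m. \<exists>b\<in>nonunits P m. m a b = Some s)}"

text \<open>In \<open>assoc\<close>, the two sides are the (possibly undefined) values of \<open>(ab)c\<close> and \<open>a(bc)\<close>.\<close>

locale atomic_partial_product =
  fixes P :: "'a set" and m :: "'a \<Rightarrow> 'a \<Rightarrow> 'a option"
  assumes closed: "\<lbrakk>a \<in> P; b \<in> P; m a b = Some c\<rbrakk> \<Longrightarrow> c \<in> P"
    and unit: "\<exists>e\<in>P. \<forall>a\<in>P. m e a = Some a \<and> m a e = Some a"
    and assoc: "\<lbrakk>a \<in> P; b \<in> P; c \<in> P\<rbrakk> \<Longrightarrow>
      Option.bind (m a b) (\<lambda>ab. m ab c) = Option.bind (m b c) (\<lambda>bc. m a bc)"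
    and nonunits_closed:
      "\<lbrakk>a \<in> nonunits P m; b \<in> nonunits P m; m a b = Some c\<rbrakk> \<Longrightarrow> c \<in> nonunits P m"
    and finite_atoms: "finite (atoms P m)"
    and length: "\<exists>l :: 'a \<Rightarrow> nat. (\<forall>p\<in>nonunits P m. l p > 0) \<and>
      (\<forall>a\<in>P. \<forall>b\<in>P. \<forall>c. m a b = Some c \<longrightarrow> l c = l a + l b)"

text \<open>The associated monoid \<open>M(P)\<close>: words over \<open>P\<close> modulo the congruence generated by the
  relations \<open>ab = c\<close> and by the identification of the unit of \<open>P\<close> with the empty word.\<close>

inductive_set word_cong :: "'a set \<Rightarrow> ('a \<Rightarrow> 'a \<Rightarrow> 'a option) \<Rightarrow> ('a list \<times> 'a list) set"
  for P :: "'a set" and m :: "'a \<Rightarrow> 'a \<Rightarrow> 'a option" where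
  refl: "u \<in> lists P \<Longrightarrow> (u, u) \<in> word_cong P m"
| sym: "(u, v) \<in> word_cong P m \<Longrightarrow> (v, u) \<in> word_cong P m"
| trans: "\<lbrakk>(u, v) \<in> word_cong P m; (v, w) \<in> word_cong P m\<rbrakk> \<Longrightarrow> (u, w) \<in> word_cong P m"
| prod: "\<lbrakk>u \<in> lists P; v \<in> lists P; a \<in> P; b \<in> P; c \<in> P; m a b = Some c\<rbrakk> \<Longrightarrow>
    (u @ [a, b] @ v, u @ [c] @ v) \<in> word_cong P m"
| unit: "\<lbrakk>u \<in> lists P; v \<in> lists P; partial_unit P m \<in> P\<rbrakk> \<Longrightarrow>
    (u @ [partial_unit P m] @ v, u @ v) \<in> word_cong P m"

definition associated_monoid ::
  "'a set \<Rightarrow> ('a \<Rightarrow> 'a \<Rightarrow> 'a option) \<Rightarrow> 'a list set monoid" where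
  "associated_monoid P m =
     \<lparr>carrier = lists P // word_cong P m,
      mult = (\<lambda>A B. \<Union>u\<in>A. \<Union>v\<in>B. word_cong P m `` {u @ v}),
      one = word_cong P m `` {[]}\<rparr>"

definition associated_gen :: "'a set \<Rightarrow> ('a \<Rightarrow> 'a \<Rightarrow> 'a option) \<Rightarrow> 'a \<Rightarrow> 'a list set" where
  "associated_gen P m a = word_cong P m `` {[a]}"

definition right_multiple :: "'a set \<Rightarrow> ('a \<Rightarrow> 'a \<Rightarrow> 'a option) \<Rightarrow> 'a \<Rightarrow> 'a \<Rightarrow> bool" where
  "right_multiple P m a c \<longleftrightarrow> (\<exists>b\<in>P. m a b = Some c)"

definition left_multiple :: "'a set \<Rightarrow> ('a \<Rightarrow> 'a \<Rightarrow> 'a option) \<Rightarrow> 'a \<Rightarrow> 'a \<Rightarrow> bool" where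
  "left_multiple P m a c \<longleftrightarrow> (\<exists>b\<in>P. m b a = Some c)"

definition common_multiple ::
  "'a set \<Rightarrow> ('a \<Rightarrow> 'a \<Rightarrow> bool) \<Rightarrow> 'a set \<Rightarrow> 'a \<Rightarrow> bool" where
  "common_multiple P R A c \<longleftrightarrow> c \<in> P \<and> (\<forall>a\<in>A. R a c)"

definition least_common_multiple ::
  "'a set \<Rightarrow> ('a \<Rightarrow> 'a \<Rightarrow> bool) \<Rightarrow> 'a set \<Rightarrow> 'a \<Rightarrow> bool" where
  "least_common_multiple P R A d \<longleftrightarrow>
     common_multiple P R A d \<and> (\<forall>c. common_multiple P R A c \<longrightarrow> R d c)"

text \<open>In \<open>lcm_mult\<close>, \<open>D\<close> is the least common right multiple of \<open>s\<close> and \<open>t\<close>, which is unique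
  because of the length function and exists by \<open>right_lcm\<close> as soon as there is a common right
  multiple.\<close>

locale pre_garside = atomic_partial_product +
  assumes right_lcm: "\<lbrakk>s \<in> atoms P m; t \<in> atoms P m;
      \<exists>c. common_multiple P (right_multiple P m) {s, t} c\<rbrakk> \<Longrightarrow>
      \<exists>d. least_common_multiple P (right_multiple P m) {s, t} d"
    and left_lcm: "\<lbrakk>s \<in> atoms P m; t \<in> atoms P m;
      \<exists>c. common_multiple P (left_multiple P m) {s, t} c\<rbrakk> \<Longrightarrow>
      \<exists>d. least_common_multiple P (left_multiple P m) {s, t} d"
    and lcm_mult: "\<lbrakk>s \<in> atoms P m; t \<in> atoms P m; a \<in> P;
      least_common_multiple P (right_multiple P m) {s, t} D;
      m a s \<noteq> None; m a t \<noteq> None\<rbrakk> \<Longrightarrow> m a D \<noteq> None"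
    and cancel: "\<lbrakk>w \<in> carrier (associated_monoid P m); a \<in> P; b \<in> P;
      associated_gen P m a \<otimes>\<^bsub>associated_monoid P m\<^esub> w =
        associated_gen P m b \<otimes>\<^bsub>associated_monoid P m\<^esub> w \<or>
      w \<otimes>\<^bsub>associated_monoid P m\<^esub> associated_gen P m a =
        w \<otimes>\<^bsub>associated_monoid P m\<^esub> associated_gen P m b\<rbrakk> \<Longrightarrow> a = b"

definition restricted_product ::
  "('a, 'b) monoid_scheme \<Rightarrow> 'a set \<Rightarrow> 'a \<Rightarrow> 'a \<Rightarrow> 'a option" where
  "restricted_product G P a b =
     (if a \<in> P \<and> b \<in> P \<and> a \<otimes>\<^bsub>G\<^esub> b \<in> P then Some (a \<otimes>\<^bsub>G\<^esub> b) else None)"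

end

(*
  Numbering the n-th roots of unity clockwise, let d_ij be the braid of the pair {i, j}. Three
  topological facts suffice. The d_ij satisfy the relations d_ij d_jk = d_jk d_ki for i, j, k in
  clockwise order (both sides are the rotation of the triangle) and d_ij d_kl = d_kl d_ij for
  noncrossing pairs; taking end points of strings maps d_ij to the transposition (i j); and the
  winding number of the discriminant is a length homomorphism that maps every d_ij to 1.

  The rest is algebra in the group generated by the d_ij. Let delta be the braid of the partition
  with one part. A product of n - m transpositions whose orbits number m only uses transpositions
  inside its orbits. Hence delta_L left divides delta_M only if L refines M, and a word of d_ij that
  is a factor of delta is some delta_L, because each letter must merge two blocks without creating
  a crossing. Conversely, refinement implies divisibility by merging neighbouring blocks. So P is
  the set of factors of delta, divisibility is refinement, and common refinements are greatest
  common divisors, from which the axioms of a pre-Garside structure follow. Cancellation holds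
  because P lies in a group.
*)

theory Submission
  imports Defs
begin

section \<open>Pre-Garside structures inside a group\<close>

text \<open>Complements and gcds are treated on the left only; in a finite \<open>P\<close> the
  bijection \<open>a \<mapsto> inv a \<otimes> \<delta>\<close> carries the results over to right
  divisors. Right lcms are obtained as common multiples of minimal length, so that only
  intersections of blocks have to be described, not joins of noncrossing partitions. A letter
  \<open>d i j\<close> can be appended to the product of a partition only if \<open>i\<close> and
  \<open>j\<close> are the correct elements of their blocks. This is the condition
  \<open>same_sides\<close>; its half-open intervals encode on which side of an end point the chord
  leaves. On the topological side, \<open>pair_braid\<close> is a definite description over all
  small ellipses. These conditions survive convex combinations, so any two choices are homotopic
  along straight lines, and the relations can be checked with polynomial strings. Permutations come
  from lifting to pointed configurations; the length is defined on unordered sets because the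
  discriminant runs over ordered pairs.\<close>

lemma list_product_Nil [simp]: "list_product G [] = \<one>\<^bsub>G\<^esub>"
  by (simp add: list_product_def)

lemma list_product_Cons [simp]: "list_product G (g # gs) = g \<otimes>\<^bsub>G\<^esub> list_product G gs"
  by (simp add: list_product_def)

context group
begin

lemma list_product_closed [simp]: "set gs \<subseteq> carrier G \<Longrightarrow> list_product G gs \<in> carrier G"
  by (induction gs) auto

lemma list_product_append:
  "\<lbrakk>set gs \<subseteq> carrier G; set hs \<subseteq> carrier G\<rbrakk> \<Longrightarrow>
     list_product G (gs @ hs) = list_product G gs \<otimes> list_product G hs"
  by (induction gs) (auto simp: m_assoc)

lemma inv_mult_cancel_left [simp]:
  "\<lbrakk>x \<in> carrier G; y \<in> carrier G\<rbrakk> \<Longrightarrow> inv x \<otimes> (x \<otimes> y) = y"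
  by (simp add: m_assoc [symmetric])

lemma mult_inv_cancel_left [simp]:
  "\<lbrakk>x \<in> carrier G; y \<in> carrier G\<rbrakk> \<Longrightarrow> x \<otimes> (inv x \<otimes> y) = y"
  by (simp add: m_assoc [symmetric])

end

text \<open>Complements and gcds are required on the left only; finiteness makes
  \<open>a \<mapsto> inv a \<otimes> \<delta>\<close> a permutation of \<open>P\<close>, which
  transfers them to the right. The two \<open>factor\<close> conditions make definedness
  associative: both bracketings of \<open>abc\<close> exist as soon as the triple product lies in
  \<open>P\<close>.\<close>

locale garside_factors = group G for G (structure) +
  fixes P :: "'a set" and \<delta> :: 'a and len :: "'a \<Rightarrow> int"
  assumes finite_P: "finite P" and P_subset: "P \<subseteq> carrier G"
    and one_in_P: "\<one> \<in> P" and delta_in_P: "\<delta> \<in> P"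
    and len_mult: "\<lbrakk>x \<in> carrier G; y \<in> carrier G\<rbrakk> \<Longrightarrow> len (x \<otimes> y) = len x + len y"
    and len_pos: "\<lbrakk>a \<in> P; a \<noteq> \<one>\<rbrakk> \<Longrightarrow> len a > 0"
    and complement: "a \<in> P \<Longrightarrow> inv a \<otimes> \<delta> \<in> P"
    and factor_right: "\<lbrakk>a \<in> P; b \<in> P; c \<in> P; a \<otimes> b \<otimes> c \<in> P\<rbrakk> \<Longrightarrow> b \<otimes> c \<in> P"
    and factor_left: "\<lbrakk>a \<in> P; b \<in> P; c \<in> P; a \<otimes> b \<otimes> c \<in> P\<rbrakk> \<Longrightarrow> a \<otimes> b \<in> P"
    and gcd_exists: "\<lbrakk>a \<in> P; b \<in> P\<rbrakk> \<Longrightarrow> \<exists>g\<in>P. inv g \<otimes> a \<in> P \<and> inv g \<otimes> b \<in> P \<and>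
      (\<forall>h\<in>P. inv h \<otimes> a \<in> P \<and> inv h \<otimes> b \<in> P \<longrightarrow> inv h \<otimes> g \<in> P)"
begin

abbreviation m where "m \<equiv> restricted_product G P"

lemma P_carrier [simp]: "a \<in> P \<Longrightarrow> a \<in> carrier G"
  using P_subset by blast

lemma len_one: "len \<one> = 0"
  using len_mult [of \<one> \<one>] by simp

lemma left_complement:
  assumes "a \<in> P"
  obtains b where "b \<in> P" "b \<otimes> a = \<delta>" "a = inv b \<otimes> \<delta>"
proof -
  have "inj_on (\<lambda>a. inv a \<otimes> \<delta>) P"
    by (rule inj_onI) (metis P_carrier delta_in_P inv_closed inv_inv right_cancel)
  moreover have "(\<lambda>a. inv a \<otimes> \<delta>) ` P \<subseteq> P"
    using complement by blast
  ultimately have "(\<lambda>a. inv a \<otimes> \<delta>) ` P = P"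
    using finite_P by (simp add: endo_inj_surj)
  then obtain b where "b \<in> P" "a = inv b \<otimes> \<delta>"
    using assms by blast
  then show thesis
    using that delta_in_P by simp
qed

lemma right_multiple_iff:
  assumes "a \<in> P" "c \<in> P"
  shows "right_multiple P m a c \<longleftrightarrow> inv a \<otimes> c \<in> P"
proof
  assume "right_multiple P m a c"
  then show "inv a \<otimes> c \<in> P"
    using assms by (auto simp: right_multiple_def restricted_product_def split: if_splits)
next
  assume "inv a \<otimes> c \<in> P"
  then show "right_multiple P m a c"
    unfolding right_multiple_def using assms
    by (intro bexI [of _ "inv a \<otimes> c"]) (auto simp: restricted_product_def)
qed

lemma left_multiple_iff:
  assumes "a \<in> P" "c \<in> P"
  shows "left_multiple P m a c \<longleftrightarrow> c \<otimes> inv a \<in> P"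
proof
  assume "left_multiple P m a c"
  then show "c \<otimes> inv a \<in> P"
    using assms by (auto simp: left_multiple_def restricted_product_def m_assoc split: if_splits)
next
  assume "c \<otimes> inv a \<in> P"
  then show "left_multiple P m a c"
    unfolding left_multiple_def using assms
    by (intro bexI [of _ "c \<otimes> inv a"]) (auto simp: restricted_product_def m_assoc)
qed

text \<open>A common multiple \<open>D\<close> of minimal length is least: its gcd \<open>g\<close>
  with another common multiple \<open>c\<close> is again a multiple of \<open>s\<close> and
  \<open>t\<close>, so \<open>len D \<le> len g\<close>. This forces \<open>g = D\<close>, and
  \<open>D\<close> divides \<open>c\<close>. The element \<open>\<delta>\<close> shows that common
  multiples exist.\<close>

lemma lcm_exists:
  assumes st: "s \<in> P" "t \<in> P"
  obtains D where "D \<in> P" "inv s \<otimes> D \<in> P" "inv t \<otimes> D \<in> P"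
    "\<And>c. \<lbrakk>c \<in> P; inv s \<otimes> c \<in> P; inv t \<otimes> c \<in> P\<rbrakk> \<Longrightarrow> inv D \<otimes> c \<in> P"
proof -
  define U where "U = {u \<in> P. inv s \<otimes> u \<in> P \<and> inv t \<otimes> u \<in> P}"
  have "finite U" "U \<noteq> {}"
    using finite_P delta_in_P complement st by (auto simp: U_def)
  then obtain D where D: "D \<in> U" "\<And>u. u \<in> U \<Longrightarrow> len D \<le> len u"
    using ex_min_if_finite [of "len ` U"] by (metis (no_types, lifting) finite_imageI image_iff image_is_empty not_le)
  have "inv D \<otimes> c \<in> P" if c: "c \<in> U" for c
  proof -
    have DP: "D \<in> P" "c \<in> P"
      using D c by (auto simp: U_def)
    obtain g where g: "g \<in> P" "inv g \<otimes> D \<in> P" "inv g \<otimes> c \<in> P"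
      "\<And>h. \<lbrakk>h \<in> P; inv h \<otimes> D \<in> P; inv h \<otimes> c \<in> P\<rbrakk> \<Longrightarrow> inv h \<otimes> g \<in> P"
      using gcd_exists [OF DP] by blast
    then have "g \<in> U"
      using D(1) c st by (auto simp: U_def)
    then have "len D \<le> len g"
      using D by blast
    moreover have "len D = len g + len (inv g \<otimes> D)"
      using len_mult [of g "inv g \<otimes> D"] g DP by simp
    ultimately have "inv g \<otimes> D = \<one>"
      using len_pos g(2) by fastforce
    then have "D = g"
      using g(1) DP by (metis P_carrier inv_closed inv_equality inv_inv)
    then show ?thesis
      using g by simp
  qed
  then show thesis
    using that D(1) by (auto simp: U_def)
qed

text \<open>The map \<open>a \<mapsto> a\<^sup>-\<^sup>1\<delta>\<close> is an anti-isomorphism from left divisibility to right divisibility,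
  so least common left multiples come from greatest common left divisors.\<close>

lemma left_lcm_exists:
  assumes "s \<in> P" "t \<in> P"
  obtains D where "D \<in> P" "D \<otimes> inv s \<in> P" "D \<otimes> inv t \<in> P"
    "\<And>c. \<lbrakk>c \<in> P; c \<otimes> inv s \<in> P; c \<otimes> inv t \<in> P\<rbrakk> \<Longrightarrow> c \<otimes> inv D \<in> P"
proof -
  obtain b e where b: "b \<in> P" "s = inv b \<otimes> \<delta>" and e: "e \<in> P" "t = inv e \<otimes> \<delta>"
    using left_complement assms by metis
  obtain g where g: "g \<in> P" "inv g \<otimes> b \<in> P" "inv g \<otimes> e \<in> P"
      "\<And>h. \<lbrakk>h \<in> P; inv h \<otimes> b \<in> P; inv h \<otimes> e \<in> P\<rbrakk> \<Longrightarrow> inv h \<otimes> g \<in> P"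
    using gcd_exists [OF b(1) e(1)] by blast
  show thesis
  proof (rule that)
    show "inv g \<otimes> \<delta> \<in> P" "inv g \<otimes> \<delta> \<otimes> inv s \<in> P" "inv g \<otimes> \<delta> \<otimes> inv t \<in> P"
      using g b e delta_in_P complement by (auto simp: inv_mult_group m_assoc)
    fix c assume c: "c \<in> P" "c \<otimes> inv s \<in> P" "c \<otimes> inv t \<in> P"
    obtain y where y: "y \<in> P" "c = inv y \<otimes> \<delta>"
      using left_complement [OF c(1)] by metis
    have "inv y \<otimes> b \<in> P" "inv y \<otimes> e \<in> P"
      using c y b e delta_in_P by (auto simp: inv_mult_group m_assoc)
    then have "inv y \<otimes> g \<in> P"
      using g y by blast
    then show "c \<otimes> inv (inv g \<otimes> \<delta>) \<in> P"
      using y g delta_in_P by (auto simp: inv_mult_group m_assoc)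
  qed
qed

lemma partial_unit_eq: "partial_unit P m = \<one>"
  unfolding partial_unit_def
proof (rule the_equality)
  show "\<one> \<in> P \<and> (\<forall>a\<in>P. m \<one> a = Some a \<and> m a \<one> = Some a)"
    using one_in_P by (auto simp: restricted_product_def)
  fix e assume "e \<in> P \<and> (\<forall>a\<in>P. m e a = Some a \<and> m a e = Some a)"
  then have "e \<in> P" "m e \<one> = Some \<one>"
    using one_in_P by auto
  then show "e = \<one>"
    by (auto simp: restricted_product_def split: if_splits)
qed

lemma words_in_carrier: "u \<in> lists P \<Longrightarrow> set u \<subseteq> carrier G"
  by (auto dest: P_carrier)

text \<open>Evaluation of words in the group is all that cancellation in \<open>M(P)\<close> needs, because \<open>P\<close> is a
  subset of the group.\<close>

lemma word_cong_eval:
  "(u, v) \<in> word_cong P m \<Longrightarrow>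
     u \<in> lists P \<and> v \<in> lists P \<and> list_product G u = list_product G v"
proof (induction rule: word_cong.induct)
  case (prod u v a b c)
  then have "a \<otimes> (b \<otimes> list_product G v) = c \<otimes> list_product G v"
    using words_in_carrier [of v]
    by (auto simp: restricted_product_def m_assoc split: if_splits)
  then show ?case
    using prod words_in_carrier [of u] words_in_carrier [of v]
    by (simp add: list_product_append)
next
  case (unit u v)
  then show ?case
    using words_in_carrier [of u] words_in_carrier [of v]
    by (simp add: partial_unit_eq list_product_append)
qed auto

lemma associated_mult_cancel:
  assumes w: "w \<in> carrier (associated_monoid P m)" and ab: "a \<in> P" "b \<in> P"
    and eq: "associated_gen P m a \<otimes>\<^bsub>associated_monoid P m\<^esub> w =
        associated_gen P m b \<otimes>\<^bsub>associated_monoid P m\<^esub> w \<or>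
      w \<otimes>\<^bsub>associated_monoid P m\<^esub> associated_gen P m a =
        w \<otimes>\<^bsub>associated_monoid P m\<^esub> associated_gen P m b"
  shows "a = b"
proof -
  obtain u where u: "u \<in> lists P" "w = word_cong P m `` {u}"
    using w by (auto simp: associated_monoid_def quotient_def)
  have w_eval: "list_product G v = list_product G u" "v \<in> lists P" if "v \<in> w" for v
    using that u word_cong_eval [of u v] by auto
  have gen_eval: "list_product G v = c" "v \<in> lists P" if "v \<in> associated_gen P m c" "c \<in> P" for v c
    using that word_cong_eval [of "[c]" v] by (auto simp: associated_gen_def)
  have uw: "u \<in> w" and aw: "\<And>c. c \<in> P \<Longrightarrow> [c] \<in> associated_gen P m c"
    using u by (auto simp: associated_gen_def intro: word_cong.refl)
  have left: "list_product G x = c \<otimes> list_product G u"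
    if "x \<in> associated_gen P m c \<otimes>\<^bsub>associated_monoid P m\<^esub> w" "c \<in> P" for x c
    using that
    by (auto simp: associated_monoid_def dest!: word_cong_eval)
       (metis gen_eval list_product_append w_eval words_in_carrier)
  have right: "list_product G x = list_product G u \<otimes> c"
    if "x \<in> w \<otimes>\<^bsub>associated_monoid P m\<^esub> associated_gen P m c" "c \<in> P" for x c
    using that
    by (auto simp: associated_monoid_def dest!: word_cong_eval)
       (metis gen_eval list_product_append w_eval words_in_carrier)
  \<comment> \<open>If the two products are equal, the word \<open>[a] @ u\<close> lies in both;
    evaluating it as a member of each gives \<open>au = bu\<close> in the group. The word
    \<open>u @ [a]\<close> does the same on the other side.\<close>
  have l: "[a] @ u \<in> associated_gen P m a \<otimes>\<^bsub>associated_monoid P m\<^esub> w"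
    using uw aw [OF ab(1)] u(1) ab
    by (auto simp: associated_monoid_def intro!: bexI [of _ u, OF _ uw] bexI [of _ "[a]", OF _ aw] word_cong.refl)
  have r: "u @ [a] \<in> w \<otimes>\<^bsub>associated_monoid P m\<^esub> associated_gen P m a"
    using uw aw [OF ab(1)] u(1) ab
    by (auto simp: associated_monoid_def intro!: bexI [of _ u, OF _ uw] bexI [of _ "[a]", OF _ aw] word_cong.refl)
  from eq show ?thesis
  proof
    assume "associated_gen P m a \<otimes>\<^bsub>associated_monoid P m\<^esub> w =
      associated_gen P m b \<otimes>\<^bsub>associated_monoid P m\<^esub> w"
    with l left ab have "a \<otimes> list_product G u = b \<otimes> list_product G u" by metis
    then show ?thesis using ab u words_in_carrier [of u] by simp
  next
    assume "w \<otimes>\<^bsub>associated_monoid P m\<^esub> associated_gen P m a =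
      w \<otimes>\<^bsub>associated_monoid P m\<^esub> associated_gen P m b"
    with r right ab have "list_product G u \<otimes> a = list_product G u \<otimes> b" by metis
    then show ?thesis using ab u words_in_carrier [of u] by simp
  qed
qed

lemma atoms_in_P: "s \<in> atoms P m \<Longrightarrow> s \<in> P"
  by (simp add: atoms_def nonunits_def)

lemma nonunits_eq: "nonunits P m = P - {\<one>}"
  by (simp add: nonunits_def partial_unit_eq)

theorem pre_garside_restricted_product: "pre_garside P m"
proof (unfold_locales, goal_cases)
  case (1 a b c)
  then show ?case
    by (auto simp: restricted_product_def split: if_splits)
next
  case 2
  then show ?case
    using one_in_P by (auto simp: restricted_product_def)
next
  case (3 a b c)
  then show ?case
    using factor_right [of a b c] factor_left [of a b c]
    by (auto simp: restricted_product_def m_assoc)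
next
  case (4 a b c)
  then have "a \<in> P" "b \<in> P" "len a > 0" "len b > 0" "c = a \<otimes> b" "c \<in> P"
    using len_pos by (auto simp: nonunits_eq restricted_product_def split: if_splits)
  then have "len c > 0"
    by (simp add: len_mult)
  then show ?case
    using len_one \<open>c \<in> P\<close> by (auto simp: nonunits_eq)
next
  case 5
  then show ?case
    using finite_P by (simp add: atoms_def nonunits_def)
next
  case 6
  have "len a \<ge> 0" if "a \<in> P" for a
    using len_pos [OF that] len_one by fastforce
  then show ?case
    using len_pos
    by (intro exI [of _ "nat \<circ> len"])
      (auto simp: nonunits_eq restricted_product_def len_mult nat_add_distrib split: if_splits)
next
  case (7 s t)
  then obtain D where D: "D \<in> P" "inv s \<otimes> D \<in> P" "inv t \<otimes> D \<in> P"
    "\<And>c. \<lbrakk>c \<in> P; inv s \<otimes> c \<in> P; inv t \<otimes> c \<in> P\<rbrakk> \<Longrightarrow> inv D \<otimes> c \<in> P"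
    using lcm_exists atoms_in_P by metis
  then show ?case
    using 7 atoms_in_P
    by (intro exI [of _ D]) (auto simp: least_common_multiple_def common_multiple_def right_multiple_iff)
next
  case (8 s t)
  then obtain D where D: "D \<in> P" "D \<otimes> inv s \<in> P" "D \<otimes> inv t \<in> P"
    "\<And>c. \<lbrakk>c \<in> P; c \<otimes> inv s \<in> P; c \<otimes> inv t \<in> P\<rbrakk> \<Longrightarrow> c \<otimes> inv D \<in> P"
    using left_lcm_exists atoms_in_P by metis
  then show ?case
    using 8 atoms_in_P
    by (intro exI [of _ D]) (auto simp: least_common_multiple_def common_multiple_def left_multiple_iff)
next
  case (9 s t a D)
  have st: "s \<in> P" "t \<in> P"
    using 9 atoms_in_P by auto
  have D: "D \<in> P" "\<And>c. \<lbrakk>c \<in> P; inv s \<otimes> c \<in> P; inv t \<otimes> c \<in> P\<rbrakk> \<Longrightarrow> inv D \<otimes> c \<in> P"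
    using 9(4) st by (auto simp: least_common_multiple_def common_multiple_def right_multiple_iff)
  \<comment> \<open>As \<open>as\<close> and \<open>at\<close> divide \<open>\<delta>\<close>, both
    \<open>s\<close> and \<open>t\<close> divide \<open>inv a \<otimes> \<delta>\<close>. Hence so
    does \<open>D\<close>, which makes \<open>aD\<close> an initial factor of
    \<open>\<delta>\<close>.\<close>
  have *: "inv r \<otimes> (inv a \<otimes> \<delta>) \<in> P" if "r \<in> P" "m a r \<noteq> None" for r
    using that 9(3) complement [of "a \<otimes> r"] delta_in_P
    by (auto simp: restricted_product_def inv_mult_group m_assoc split: if_splits)
  have "inv D \<otimes> (inv a \<otimes> \<delta>) \<in> P"
    using 9 st complement by (intro D(2) *) auto
  then have "a \<otimes> D \<in> P"
    using factor_left [of a D "inv D \<otimes> (inv a \<otimes> \<delta>)"] 9(3) D(1) delta_in_P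
    by (simp add: m_assoc)
  then show ?case
    using 9(3) D(1) by (simp add: restricted_product_def)
next
  case (10 w a b)
  then show ?case
    by (rule associated_mult_cancel)
qed

theorem least_common_multiple_delta: "least_common_multiple P (right_multiple P m) P \<delta>"
  using delta_in_P complement
  by (auto simp: least_common_multiple_def common_multiple_def right_multiple_iff)

end

section \<open>Words in transpositions\<close>

definition swap :: "nat \<Rightarrow> nat \<Rightarrow> nat \<Rightarrow> nat" where
  "swap i j v = (if v = i then j else if v = j then i else v)"

lemma swap_lt: "\<lbrakk>i < n; j < n; v < n\<rbrakk> \<Longrightarrow> swap i j v < n"
  by (simp add: swap_def)

lemma swap_swap [simp]: "swap i j (swap i j v) = v"
  by (simp add: swap_def)

text \<open>The leftmost letter acts first, in accordance with the composition of loops.\<close>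

definition word_perm :: "(nat \<times> nat) list \<Rightarrow> nat \<Rightarrow> nat" where
  "word_perm ws = fold (\<lambda>(i, j). swap i j) ws"

lemma word_perm_simps [simp]:
  "word_perm [] v = v"
  "word_perm ((i, j) # ws) v = word_perm ws (swap i j v)"
  "word_perm (us @ ws) v = word_perm ws (word_perm us v)"
  by (simp_all add: word_perm_def)

definition letters :: "nat \<Rightarrow> (nat \<times> nat) set" where
  "letters n = {(i, j). i < n \<and> j < n \<and> i \<noteq> j}"

lemma word_perm_fixes: "(\<And>i j. (i, j) \<in> set ws \<Longrightarrow> v \<noteq> i \<and> v \<noteq> j) \<Longrightarrow> word_perm ws v = v"
proof (induction ws)
  case (Cons a ws)
  obtain i j where "a = (i, j)" by (cases a)
  then show ?case using Cons by (auto simp: swap_def)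
qed simp

lemma word_perm_surj:
  assumes "set ws \<subseteq> letters n" "t < n"
  shows "\<exists>s<n. word_perm ws s = t"
  using assms
proof (induction ws arbitrary: t)
  case (Cons a ws)
  obtain i j where a: "a = (i, j)" by (cases a)
  obtain s where "s < n" "word_perm ws s = t" using Cons by auto
  then show ?case
    using Cons.prems a by (intro exI [of _ "swap i j s"]) (auto simp: letters_def swap_lt)
qed simp

lemma word_perm_conj:
  assumes "inj_on c {..<n}" "set ws \<subseteq> letters n" "s < n"
  shows "word_perm (map (map_prod c c) ws) (c s) = c (word_perm ws s)"
  using assms(2,3)
proof (induction ws arbitrary: s)
  case (Cons a ws)
  obtain i j where a: "a = (i, j)" by (cases a)
  have "swap (c i) (c j) (c s) = c (swap i j s)"
    using assms(1) Cons.prems a by (auto simp: swap_def letters_def inj_on_def)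
  then show ?case
    using Cons a by (auto simp: letters_def swap_lt)
qed simp

text \<open>\<open>f\<close> labels the connected components of the graph on \<open>{..<n}\<close>
  whose edges are the letters: each further edge identifies at most two labels, so at least
  \<open>n - length ws\<close> of them survive.\<close>

lemma word_labelling:
  assumes "set ws \<subseteq> letters n"
  shows "\<exists>f :: nat \<Rightarrow> nat. (\<forall>(i, j)\<in>set ws. f i = f j) \<and> n \<le> card (f ` {..<n}) + length ws"
  using assms
proof (induction ws)
  case Nil
  then show ?case by (intro exI [of _ id]) auto
next
  case (Cons a ws)
  obtain i j where a: "a = (i, j)" by (cases a)
  obtain f :: "nat \<Rightarrow> nat" where f: "\<forall>(i, j)\<in>set ws. f i = f j" "n \<le> card (f ` {..<n}) + length ws"
    using Cons by auto
  define f' where "f' = (\<lambda>v. if f v = f j then f i else f v)"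
  have "f ` {..<n} \<subseteq> insert (f j) (f' ` {..<n})"
    by (auto simp: f'_def)
  then have "card (f ` {..<n}) \<le> card (insert (f j) (f' ` {..<n}))"
    by (intro card_mono) auto
  also have "\<dots> \<le> Suc (card (f' ` {..<n}))"
    by (simp add: card_insert_if)
  finally have "n \<le> card (f' ` {..<n}) + length (a # ws)"
    using f(2) by simp
  moreover have "\<forall>(i, j)\<in>set (a # ws). f' i = f' j"
    using f(1) a by (auto simp: f'_def)
  ultimately show ?case by blast
qed

text \<open>A product of few transpositions has many orbits, namely at least the number of connected
  components of the graph that they span; if there are no more orbits than that, then every
  transposition stays inside an orbit.\<close>

lemma word_letters_in_orbits:
  assumes ws: "set ws \<subseteq> letters n" and card: "card (g ` {..<n}) + length ws \<le> n"
    and orbits: "\<And>(f :: nat \<Rightarrow> nat) v w. \<lbrakk>\<And>v. v < n \<Longrightarrow> f (word_perm ws v) = f v; v < n; w < n; g v = g w\<rbrakk>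
      \<Longrightarrow> f v = f w"
    and ij: "(i, j) \<in> set ws"
  shows "g i = g j"
proof -
  obtain f :: "nat \<Rightarrow> nat" where f: "\<forall>(i, j)\<in>set ws. f i = f j" "n \<le> card (f ` {..<n}) + length ws"
    using word_labelling [OF ws] by blast
  have "f (word_perm us v) = f v" if "set us \<subseteq> set ws" for us v
    using that
  proof (induction us arbitrary: v)
    case (Cons a us)
    then show ?case using f(1) by (cases a) (auto simp: swap_def)
  qed simp
  then have fg: "f v = f w" if "v < n" "w < n" "g v = g w" for v w
    using orbits that by blast
  \<comment> \<open>\<open>f\<close> factors through \<open>g\<close> as
    \<open>f = h \<circ> g\<close>. Since \<open>f\<close> has at least as many values as
    \<open>g\<close>, the map \<open>h\<close> is injective, and \<open>f i = f j\<close> implies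
    \<open>g i = g j\<close>.\<close>
  define h where "h = (\<lambda>y. f (SOME v. v < n \<and> g v = y))"
  have h: "h (g v) = f v" if "v < n" for v
  proof -
    have "(SOME w. w < n \<and> g w = g v) < n \<and> g (SOME w. w < n \<and> g w = g v) = g v"
      using someI [of "\<lambda>w. w < n \<and> g w = g v" v] that by blast
    then show ?thesis unfolding h_def using fg that by blast
  qed
  have "h ` (g ` {..<n}) = f ` {..<n}"
    using h by force
  moreover have "card (g ` {..<n}) \<le> card (f ` {..<n})"
    using f(2) card by linarith
  ultimately have "inj_on h (g ` {..<n})"
    by (metis card_image_le eq_card_imp_inj_on finite_imageI finite_lessThan le_antisym)
  moreover have "i < n" "j < n" "f i = f j"
    using ij ws f(1) by (auto simp: letters_def)
  ultimately show ?thesis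
    by (metis h imageI inj_onD lessThan_iff)
qed

text \<open>The permutation induced by \<open>\<delta>\<close>: subtraction of 1 modulo
  \<open>n\<close>.\<close>

definition rotation :: "nat \<Rightarrow> nat \<Rightarrow> nat" where
  "rotation n v = (if v = 0 then n - 1 else v - 1)"

text \<open>Moving the letters before \<open>(u, v)\<close> to the end of the word conjugates them by the rotation. The
  remaining letters then multiply to a permutation with the two orbits \<open>{u..<v}\<close> and its complement.\<close>

lemma rotation_word_chords:
  assumes ws: "set (w1 @ (u, v) # w2 @ (i, j) # w3) \<subseteq> letters n"
    and perm: "\<And>t. t < n \<Longrightarrow> word_perm (w1 @ (u, v) # w2 @ (i, j) # w3) t = rotation n t"
    and len: "length (w1 @ (u, v) # w2 @ (i, j) # w3) < n"
    and "u < v"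
  shows "u \<le> i \<and> i < v \<longleftrightarrow> u \<le> j \<and> j < v"
proof -
  have inj: "inj_on (rotation n) {..<n}"
    by (auto simp: inj_on_def rotation_def)
  define w1' where "w1' = map (map_prod (rotation n) (rotation n)) w1"
  have w1': "set w1' \<subseteq> letters n"
  proof -
    have "(rotation n i, rotation n j) \<in> letters n" if "(i, j) \<in> letters n" for i j
      using that inj_onD [OF inj, of i j] by (auto simp: letters_def rotation_def)
    then show ?thesis
      using ws by (fastforce simp: w1'_def)
  qed
  let ?V = "w2 @ (i, j) # w3 @ w1'"
  have V: "word_perm ?V (swap u v t) = rotation n t" if t: "t < n" for t
  proof -
    obtain s where s: "s < n" "word_perm w1 s = t"
      using word_perm_surj [of w1 n t] t ws by auto
    have "word_perm (w2 @ (i, j) # w3) (swap u v t) = rotation n s"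
      using perm [OF s(1)] s(2) by simp
    then have "word_perm ?V (swap u v t) = word_perm w1' (rotation n s)"
      by simp
    also have "\<dots> = rotation n t"
      unfolding w1'_def using word_perm_conj [OF inj _ s(1), of w1] ws s(2) by simp
    finally show ?thesis .
  qed
  have uv: "v < n"
    using ws by (auto simp: letters_def)
  show ?thesis
  proof (rule word_letters_in_orbits [of ?V n "\<lambda>t. u \<le> t \<and> t < v"])
    show "set ?V \<subseteq> letters n"
      using ws w1' by auto
    \<comment> \<open>The whole word has fewer than \<open>n\<close> letters. Without
      \<open>(u, v)\<close> at most \<open>n - 2\<close> remain, and the indicator of
      \<open>{u..<v}\<close> has at most two values.\<close>
    have "card ((\<lambda>t. u \<le> t \<and> t < v) ` {..<n}) \<le> card (UNIV :: bool set)"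
      by (intro card_mono) auto
    then show "card ((\<lambda>t. u \<le> t \<and> t < v) ` {..<n}) + length ?V \<le> n"
      using len by (simp add: w1'_def)
    show "(i, j) \<in> set ?V" by simp
    fix f :: "nat \<Rightarrow> nat" and a b
    assume f: "\<And>t. t < n \<Longrightarrow> f (word_perm ?V t) = f t"
      and ab: "a < n" "b < n" "(u \<le> a \<and> a < v) = (u \<le> b \<and> b < v)"
    \<comment> \<open>An invariant of the shortened word agrees at \<open>t\<close> and its
      predecessor except at \<open>t = u\<close> and \<open>t = v\<close>, where the swap closes two
      separate cycles. So it is constant on \<open>{u..<v}\<close> and on the complement.\<close>
    have f': "f (rotation n t) = f (swap u v t)" if "t < n" for t
      using f [of "swap u v t"] V [OF that] swap_lt [of u n v t] uv that \<open>u < v\<close> by simp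
    have step: "f (Suc t) = f t" if "Suc t < n" "Suc t \<noteq> u" "Suc t \<noteq> v" for t
      using f' [of "Suc t"] that by (simp add: rotation_def swap_def)
    have in1: "f (u + k) = f u" if "u + k < v" for k
      using that uv by (induction k) (auto simp: step)
    have out1: "f k = f 0" if "k < u" for k
      using that uv \<open>u < v\<close> by (induction k) (auto simp: step)
    have out2: "f (v + k) = f v" if "v + k < n" for k
      using that \<open>u < v\<close> by (induction k) (auto simp: step)
    have wrap: "f (n - 1) = f 0" if "0 < u"
      using f' [of 0] that uv \<open>u < v\<close> by (simp add: rotation_def swap_def)
    have inside: "f t = f u" if "u \<le> t" "t < v" for t
      using in1 [of "t - u"] that by simp
    have above: "f t = f v" if "v \<le> t" "t < n" for t
      using out2 [of "t - v"] that by simp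
    have outside: "f t = f v" if "t < u" for t
      using out1 [OF that] wrap above [of "n - 1"] that uv by simp
    show "f a = f b"
      using ab inside above outside by (metis not_le)
  qed
qed

section \<open>Cyclically ordered lists\<close>

definition cyc3 :: "nat \<Rightarrow> nat \<Rightarrow> nat \<Rightarrow> bool" where
  "cyc3 a b c \<longleftrightarrow> a < b \<and> b < c \<or> b < c \<and> c < a \<or> c < a \<and> a < b"

text \<open>Equivalently, all triples of entries, taken in list order, are in cyclic order; the
  recursion treats the triples that start with the head.\<close>

fun cyclic_list :: "nat list \<Rightarrow> bool" where
  "cyclic_list [] = True"
| "cyclic_list (x # xs) \<longleftrightarrow> sorted_wrt (cyc3 x) xs \<and> cyclic_list xs"

lemma cyclic_list_snoc:
  "cyclic_list (xs @ [x]) \<longleftrightarrow> sorted_wrt (\<lambda>a b. cyc3 a b x) xs \<and> cyclic_list xs"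
  by (induction xs) (auto simp: sorted_wrt_append)

lemma cyclic_list_rotate1: "cyclic_list (x # xs) \<longleftrightarrow> cyclic_list (xs @ [x])"
proof -
  have "cyc3 x = (\<lambda>a b. cyc3 a b x)"
    by (auto simp: cyc3_def fun_eq_iff)
  then show ?thesis by (simp add: cyclic_list_snoc)
qed

lemma cyclic_list_rotate: "cyclic_list (us @ vs) \<longleftrightarrow> cyclic_list (vs @ us)"
proof (induction us arbitrary: vs)
  case (Cons u us)
  have "cyclic_list ((u # us) @ vs) \<longleftrightarrow> cyclic_list (us @ (vs @ [u]))"
    using cyclic_list_rotate1 [of u "us @ vs"] by simp
  also have "\<dots> \<longleftrightarrow> cyclic_list ((vs @ [u]) @ us)"
    by (rule Cons.IH)
  finally show ?case by simp
qed simp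

lemma sorted_imp_cyclic: "sorted_wrt (<) xs \<Longrightarrow> cyclic_list xs"
proof (induction xs)
  case (Cons x xs)
  then have "sorted_wrt (cyc3 x) xs"
    by (auto simp: cyc3_def intro: sorted_wrt_mono_rel [of xs "(<)"])
  then show ?case using Cons by simp
qed simp

text \<open>Rotate the minimum \<open>m\<close> to the front: for entries above \<open>m\<close>,
  the cyclic relation \<open>cyc3 m a b\<close> is just \<open>a < b\<close>.\<close>

lemma cyclic_list_sorted_rotation:
  assumes "cyclic_list zs" "distinct zs" "zs \<noteq> []"
  obtains us vs where "zs = us @ vs" "sorted_wrt (<) (vs @ us)"
proof -
  define m where "m = Min (set zs)"
  have "m \<in> set zs"
    using assms(3) by (simp add: m_def)
  then obtain us vs where zs: "zs = us @ m # vs"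
    by (meson split_list)
  have "cyclic_list (m # vs @ us)"
    using assms(1) zs cyclic_list_rotate [of us "m # vs"] by simp
  moreover have gt: "m < x" if "x \<in> set (vs @ us)" for x
  proof -
    have "x \<in> set zs" unfolding zs using that by auto
    then have "m \<le> x" unfolding m_def by (intro Min_le) auto
    moreover have "m \<noteq> x" using that zs assms(2) by auto
    ultimately show ?thesis by simp
  qed
  ultimately have "sorted_wrt (<) (vs @ us)"
    using sorted_wrt_mono_rel [of "vs @ us" "cyc3 m" "(<)"] by (simp add: cyc3_def) (metis not_less_iff_gr_or_eq)
  then have "sorted_wrt (<) ((m # vs) @ us)"
    using gt by simp
  then show thesis
    using that zs by blast
qed

lemma zip_tl_append:
  assumes "xs \<noteq> []" "ys \<noteq> []"
  shows "zip (xs @ ys) (tl (xs @ ys)) = zip xs (tl xs) @ (last xs, hd ys) # zip ys (tl ys)"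
  using assms(1)
proof (induction xs)
  case (Cons x xs)
  show ?case
  proof (cases "xs = []")
    case True
    then show ?thesis using assms(2) by (cases ys) auto
  next
    case False
    then have "zip (x # (xs @ ys)) (xs @ ys) = (x, hd xs) # zip (xs @ ys) (tl (xs @ ys))"
      by (cases xs) auto
    moreover have "zip (x # xs) xs = (x, hd xs) # zip xs (tl xs)"
      using False by (cases xs) auto
    ultimately show ?thesis using Cons.IH [OF False] False by simp
  qed
qed simp

lemma word_perm_zip_notin: "v \<notin> set xs \<Longrightarrow> word_perm (zip xs (tl xs)) v = v"
  by (rule word_perm_fixes) (metis list.sel(2) list.set_sel(2) set_zip_leftD set_zip_rightD)

text \<open>The word of a path is a cycle. As letters act from the left, the head is carried through
  all of them to the last entry, while any other entry is moved once, to its predecessor, which does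
  not occur again.\<close>

lemma word_perm_zip_hd: "distinct (x # xs) \<Longrightarrow> word_perm (zip (x # xs) xs) x = last (x # xs)"
proof (induction xs arbitrary: x)
  case (Cons y ys)
  then show ?case by (auto simp: swap_def)
qed simp

lemma word_perm_zip_nth:
  "\<lbrakk>distinct xs; Suc k < length xs\<rbrakk> \<Longrightarrow> word_perm (zip xs (tl xs)) (xs ! Suc k) = xs ! k"
proof (induction xs arbitrary: k)
  case (Cons x xs)
  then obtain y ys where xs: "xs = y # ys"
    by (cases xs) auto
  have *: "word_perm (zip (y # ys) ys) x = x"
    using word_perm_zip_notin [of x xs] Cons.prems xs by simp
  show ?case
  proof (cases k)
    case 0
    then show ?thesis using xs * Cons.prems by (simp add: swap_def)
  next
    case (Suc k')
    have "xs ! Suc k' \<noteq> x" "xs ! Suc k' \<noteq> y"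
      using Cons.prems Suc xs by (auto simp: nth_eq_iff_index_eq)
    then show ?thesis
      using Cons.IH [of k'] Cons.prems Suc xs by (simp add: swap_def)
  qed
qed simp

section \<open>Noncrossing partitions\<close>

text \<open>The elements of \<open>A\<close> all lie on the same side of every chord of \<open>B\<close>. Although this does not look
  symmetric, it is so for disjoint sets.\<close>

definition noncrossing :: "nat set \<Rightarrow> nat set \<Rightarrow> bool" where
  "noncrossing A B \<longleftrightarrow> (\<forall>c\<in>B. \<forall>c'\<in>B. \<forall>a\<in>A. \<forall>a'\<in>A. c < a \<and> a < c' \<longleftrightarrow> c < a' \<and> a' < c')"

text \<open>If \<open>b\<close> lies between \<open>a\<close> and \<open>a'\<close> but
  \<open>b'\<close> does not, then exactly one of \<open>a\<close>, \<open>a'\<close> lies between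
  \<open>b\<close> and \<open>b'\<close>, contrary to the assumption. Disjointness excludes
  coincidences of end points.\<close>

lemma noncrossing_sym:
  assumes nc: "noncrossing A B" and disj: "A \<inter> B = {}"
  shows "noncrossing B A"
proof -
  have imp: "a < b' \<and> b' < a'"
    if ab: "a \<in> A" "a' \<in> A" "b \<in> B" "b' \<in> B" "a < b" "b < a'" for a a' b b'
  proof (rule ccontr)
    assume "\<not> ?thesis"
    moreover have "b' \<noteq> a" "b' \<noteq> a'"
      using ab disj by auto
    ultimately consider "b' < a" | "a' < b'"
      by linarith
    then show False
    proof cases
      case 1
      then have "b' < a' \<and> a' < b"
        using nc ab unfolding noncrossing_def by blast
      then show False using ab by simp
    next
      case 2
      then have "b < a \<and> a < b'"
        using nc ab unfolding noncrossing_def by blast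
      then show False using ab by simp
    qed
  qed
  then show ?thesis
    unfolding noncrossing_def by blast
qed

lemma noncrossing_mono: "\<lbrakk>noncrossing A B; A' \<subseteq> A; B' \<subseteq> B\<rbrakk> \<Longrightarrow> noncrossing A' B'"
  unfolding noncrossing_def by blast

definition noncrossing_partition :: "nat \<Rightarrow> nat set set \<Rightarrow> bool" where
  "noncrossing_partition n L \<longleftrightarrow>
     partition_on {..<n} L \<and> (\<forall>A\<in>L. \<forall>B\<in>L. A \<noteq> B \<longrightarrow> noncrossing A B)"

lemma noncrossing_partitionD:
  assumes "noncrossing_partition n L"
  shows "A \<in> L \<Longrightarrow> A \<subseteq> {..<n}" "A \<in> L \<Longrightarrow> finite A" "A \<in> L \<Longrightarrow> A \<noteq> {}"
    "\<lbrakk>A \<in> L; B \<in> L; x \<in> A; x \<in> B\<rbrakk> \<Longrightarrow> A = B"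
    "\<lbrakk>A \<in> L; B \<in> L; A \<noteq> B\<rbrakk> \<Longrightarrow> noncrossing A B" "finite L" "x < n \<Longrightarrow> \<exists>A\<in>L. x \<in> A"
proof -
  have part: "partition_on {..<n} L"
    using assms by (simp add: noncrossing_partition_def)
  show "A \<in> L \<Longrightarrow> A \<subseteq> {..<n}" "A \<in> L \<Longrightarrow> A \<noteq> {}" "x < n \<Longrightarrow> \<exists>A\<in>L. x \<in> A"
    using partition_onD1 [OF part] partition_onD3 [OF part] by auto
  then show "A \<in> L \<Longrightarrow> finite A"
    using finite_subset by blast
  show "\<lbrakk>A \<in> L; B \<in> L; x \<in> A; x \<in> B\<rbrakk> \<Longrightarrow> A = B"
    using partition_onD2 [OF part] by (auto simp: disjoint_def)
  show "finite L"
    using finite_elements [OF _ part] by simp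
  show "\<lbrakk>A \<in> L; B \<in> L; A \<noteq> B\<rbrakk> \<Longrightarrow> noncrossing A B"
    using assms by (simp add: noncrossing_partition_def)
qed

section \<open>Refinement, common refinement and merging of blocks\<close>

definition refines :: "'a set set \<Rightarrow> 'a set set \<Rightarrow> bool" where
  "refines L M \<longleftrightarrow> (\<forall>A\<in>L. \<exists>B\<in>M. A \<subseteq> B)"

definition meet :: "'a set set \<Rightarrow> 'a set set \<Rightarrow> 'a set set" where
  "meet L M = {A \<inter> B |A B. A \<in> L \<and> B \<in> M} - {{}}"

lemma noncrossing_partition_meet:
  assumes L: "noncrossing_partition n L" and M: "noncrossing_partition n M"
  shows "noncrossing_partition n (meet L M)"
  unfolding noncrossing_partition_def
proof (intro conjI ballI impI)
  show "partition_on {..<n} (meet L M)"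
  proof (rule partition_onI)
    show "\<Union>(meet L M) = {..<n}"
    proof (intro equalityI subsetI)
      fix x assume "x \<in> \<Union>(meet L M)"
      then show "x \<in> {..<n}"
        using noncrossing_partitionD(1) [OF L] by (auto simp: meet_def)
    next
      fix x assume "x \<in> {..<n}"
      then have "x < n" by simp
      obtain A B where "A \<in> L" "x \<in> A" "B \<in> M" "x \<in> B"
        using noncrossing_partitionD(7) [OF L \<open>x < n\<close>] noncrossing_partitionD(7) [OF M \<open>x < n\<close>]
        by auto
      then show "x \<in> \<Union>(meet L M)"
        by (auto simp: meet_def)
    qed
    fix A B assume "A \<in> meet L M" "B \<in> meet L M" "A \<noteq> B"
    then obtain A1 A2 B1 B2 where *: "A1 \<in> L" "A2 \<in> M" "B1 \<in> L" "B2 \<in> M"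
        "A = A1 \<inter> A2" "B = B1 \<inter> B2" "A \<noteq> B"
      unfolding meet_def by blast
    show "disjnt A B"
    proof (rule ccontr)
      assume "\<not> disjnt A B"
      then obtain x where "x \<in> A" "x \<in> B" by (auto simp: disjnt_iff)
      then have "A1 = B1" "A2 = B2"
        using noncrossing_partitionD(4) [OF L *(1,3), of x] noncrossing_partitionD(4) [OF M *(2,4), of x] *
        by auto
      then show False using * by simp
    qed
  qed (auto simp: meet_def)
  fix A B assume "A \<in> meet L M" "B \<in> meet L M" "A \<noteq> B"
  then obtain A1 A2 B1 B2 where AB: "A1 \<in> L" "A2 \<in> M" "B1 \<in> L" "B2 \<in> M"
      "A = A1 \<inter> A2" "B = B1 \<inter> B2" "A1 \<noteq> B1 \<or> A2 \<noteq> B2"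
    by (auto simp: meet_def)
  then have "noncrossing A1 B1 \<or> noncrossing A2 B2"
    using noncrossing_partitionD(5) [OF L] noncrossing_partitionD(5) [OF M] by blast
  then show "noncrossing A B"
    using AB noncrossing_mono by blast
qed

lemma refines_meet: "refines (meet L M) L" "refines (meet L M) M"
  by (auto simp: refines_def meet_def)

lemma refines_meetI:
  assumes "noncrossing_partition n K" "refines K L" "refines K M"
  shows "refines K (meet L M)"
  unfolding refines_def
proof
  fix A assume A: "A \<in> K"
  then obtain B C where "B \<in> L" "C \<in> M" "A \<subseteq> B" "A \<subseteq> C"
    using assms unfolding refines_def by metis
  then show "\<exists>B\<in>meet L M. A \<subseteq> B"
    using noncrossing_partitionD(3) [OF assms(1) A]
    by (intro bexI [of _ "B \<inter> C"]) (auto simp: meet_def)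
qed

lemma noncrossing_partition_top: "n \<ge> 1 \<Longrightarrow> noncrossing_partition n {{..<n}}"
  using partition_on_space [of "{..<n}"] by (auto simp: noncrossing_partition_def lessThan_empty_iff)

lemma refines_top: "noncrossing_partition n L \<Longrightarrow> refines L {{..<n}}"
  using noncrossing_partitionD(1) by (auto simp: refines_def)

text \<open>For the blocks \<open>A\<close> of \<open>i\<close> and \<open>B\<close> of
  \<open>j\<close> this says that \<open>j\<close> lies in the gap of \<open>A\<close> that follows
  \<open>i\<close> cyclically, and \<open>i\<close> in the gap of \<open>B\<close> that follows
  \<open>j\<close>. For any other block, both lie in the same gap. In particular the chord that
  merges two given blocks is determined by them.\<close>

definition same_sides :: "nat set set \<Rightarrow> nat \<Rightarrow> nat \<Rightarrow> bool" where
  "same_sides L i j \<longleftrightarrow>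
     (\<forall>C\<in>L. \<forall>u\<in>C. \<forall>v\<in>C. u < v \<longrightarrow> (u \<le> i \<and> i < v \<longleftrightarrow> u \<le> j \<and> j < v))"

lemma same_sidesD:
  "\<lbrakk>same_sides L i j; C \<in> L; u \<in> C; v \<in> C; u < v\<rbrakk> \<Longrightarrow> u \<le> i \<and> i < v \<longleftrightarrow> u \<le> j \<and> j < v"
  by (simp add: same_sides_def)

definition merge :: "'a set set \<Rightarrow> 'a set \<Rightarrow> 'a set \<Rightarrow> 'a set set" where
  "merge L A B = insert (A \<union> B) (L - {A, B})"

text \<open>For a third block \<open>C\<close>, all of \<open>A\<close> lies in the gap of
  \<open>C\<close> that contains \<open>i\<close> and all of \<open>B\<close> in the gap that
  contains \<open>j\<close>; by \<open>same_sides\<close> these gaps agree. The converse direction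
  is the symmetry of \<open>noncrossing\<close>.\<close>

lemma noncrossing_partition_merge:
  assumes L: "noncrossing_partition n L" and AB: "A \<in> L" "B \<in> L" "i \<in> A" "j \<in> B"
    and same: "same_sides L i j"
  shows "noncrossing_partition n (merge L A B)"
  unfolding noncrossing_partition_def
proof (intro conjI ballI impI)
  note sep = same_sidesD [OF same]
  have part: "partition_on {..<n} L"
    using L by (simp add: noncrossing_partition_def)
  show "partition_on {..<n} (merge L A B)"
  proof (rule partition_onI)
    show "\<Union>(merge L A B) = {..<n}"
      using partition_onD1 [OF part] AB by (auto simp: merge_def)
    show "{} \<notin> merge L A B"
      using noncrossing_partitionD(3) [OF L] AB by (auto simp: merge_def)
    show "disjnt p q" if "p \<in> merge L A B" "q \<in> merge L A B" "p \<noteq> q" for p q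
      using that AB noncrossing_partitionD(4) [OF L] unfolding merge_def disjnt_iff by blast
  qed
  have *: "noncrossing (A \<union> B) C" if C: "C \<in> L" "C \<noteq> A" "C \<noteq> B" for C
  proof -
    have "noncrossing A C" "noncrossing B C"
      using C AB noncrossing_partitionD(5) [OF L] by blast+
    have "i \<notin> C" "j \<notin> C"
      using C AB noncrossing_partitionD(4) [OF L] by metis+
    then have ij: "c < i \<and> i < c' \<longleftrightarrow> c < j \<and> j < c'" if "c \<in> C" "c' \<in> C" for c c'
      using sep [OF C(1) that] that by (cases "c < c'") (auto simp: le_less)
    have inA: "c < a \<and> a < c' \<longleftrightarrow> c < i \<and> i < c'" if "c \<in> C" "c' \<in> C" "a \<in> A" for a c c'
      using \<open>noncrossing A C\<close> that AB(3) unfolding noncrossing_def by blast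
    have inB: "c < a \<and> a < c' \<longleftrightarrow> c < j \<and> j < c'" if "c \<in> C" "c' \<in> C" "a \<in> B" for a c c'
      using \<open>noncrossing B C\<close> that AB(4) unfolding noncrossing_def by blast
    have "c < a \<and> a < c' \<longleftrightarrow> c < i \<and> i < c'"
      if c: "c \<in> C" "c' \<in> C" "a \<in> A \<union> B" for a c c'
    proof (cases "a \<in> A")
      case True
      then show ?thesis using inA c by blast
    next
      case False
      then show ?thesis using inB [of c c' a] ij [of c c'] c by blast
    qed
    then show ?thesis
      unfolding noncrossing_def by simp
  qed
  have **: "noncrossing C (A \<union> B)" if C: "C \<in> L" "C \<noteq> A" "C \<noteq> B" for C
  proof (rule noncrossing_sym [OF * [OF C]])
    show "(A \<union> B) \<inter> C = {}"
      using noncrossing_partitionD(4) [OF L AB(1) C(1)] noncrossing_partitionD(4) [OF L AB(2) C(1)] C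
      by blast
  qed
  fix X Y assume XY: "X \<in> merge L A B" "Y \<in> merge L A B" "X \<noteq> Y"
  then have "X = A \<union> B \<or> X \<in> L \<and> X \<noteq> A \<and> X \<noteq> B" "Y = A \<union> B \<or> Y \<in> L \<and> Y \<noteq> A \<and> Y \<noteq> B"
    unfolding merge_def by blast+
  then show "noncrossing X Y"
    using * [of X] * [of Y] ** [of X] ** [of Y] noncrossing_partitionD(5) [OF L, of X Y] XY(3) by metis
qed

text \<open>Two consecutive elements \<open>x < y\<close> of a block of the coarser partition, chosen minimal such
  that \<open>y\<close> is not in the block of \<open>x\<close>, show which blocks of the finer partition can be merged.\<close>

lemma refines_step:
  assumes L: "noncrossing_partition n L" and M: "noncrossing_partition n M"
    and LM: "refines L M" "L \<noteq> M"
  obtains A B i j where "A \<in> L" "B \<in> L" "A \<noteq> B" "i \<in> A" "j \<in> B" "refines (merge L A B) M"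
    "same_sides L i j"
proof -
  note LD = noncrossing_partitionD [OF L] and MD = noncrossing_partitionD [OF M]
  have sub: "A \<subseteq> C" if "A \<in> L" "C \<in> M" "x \<in> A" "x \<in> C" for A C x
    using that LM(1) MD(4) unfolding refines_def by blast
  have "\<exists>C\<in>M. C \<notin> L"
  proof (rule ccontr)
    assume "\<not> (\<exists>C\<in>M. C \<notin> L)"
    moreover have "A \<in> M" if A: "A \<in> L" for A
    proof -
      obtain x where "x \<in> A" using LD(3) [OF A] by blast
      then obtain C where "C \<in> M" "x \<in> C" using MD(7) LD(1) [OF A] by blast
      then have "C \<in> L" "A = C"
        using calculation LD(4) \<open>x \<in> A\<close> A by blast+
      then show ?thesis using \<open>C \<in> M\<close> by simp
    qed
    ultimately show False using LM(2) by blast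
  qed
  then obtain C where C: "C \<in> M" "C \<notin> L" by blast
  have minC: "Min C \<in> C"
    using MD(2,3) [OF C(1)] by (rule Min_in)
  then obtain A where A: "A \<in> L" "Min C \<in> A"
    using LD(7) [of "Min C"] MD(1) [OF C(1)] by blast
  have AC: "A \<subseteq> C" "A \<noteq> C"
    using sub [OF A(1) C(1) A(2) minC] A(1) C(2) by auto
  define y where "y = Min (C - A)"
  have y: "y \<in> C" "y \<notin> A" and y_min: "\<And>c. c \<in> C \<Longrightarrow> c < y \<Longrightarrow> c \<in> A"
  proof -
    have *: "finite (C - A)" "C - A \<noteq> {}"
      using AC MD(2) [OF C(1)] by auto
    then show "y \<in> C" "y \<notin> A"
      unfolding y_def using Min_in by blast+
    show "c \<in> A" if "c \<in> C" "c < y" for c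
      using that Min_le [OF *(1), of c] unfolding y_def by fastforce
  qed
  have "Min C < y"
    using Min_le [OF MD(2) [OF C(1)] y(1)] A(2) y(2) by (metis nat_less_le)
  define x where "x = Max {c \<in> C. c < y}"
  have x: "x \<in> C" "x < y" and x_max: "\<And>c. c \<in> C \<Longrightarrow> c < y \<Longrightarrow> c \<le> x"
  proof -
    have *: "finite {c \<in> C. c < y}" "{c \<in> C. c < y} \<noteq> {}"
      using \<open>Min C < y\<close> MD(2) [OF C(1)] minC by auto
    then show "x \<in> C" "x < y"
      unfolding x_def using Max_in by blast+
    show "c \<le> x" if "c \<in> C" "c < y" for c
      using that Max_ge [OF *(1), of c] unfolding x_def by blast
  qed
  have xA: "x \<in> A" using x y_min by blast
  obtain B where B: "B \<in> L" "y \<in> B"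
    using LD(7) [of y] MD(1) [OF C(1)] y(1) by blast
  have BC: "B \<subseteq> C" and AB: "A \<noteq> B"
    using sub [OF B(1) C(1) B(2) y(1)] B(2) y(2) by auto
  \<comment> \<open>The chord must leave \<open>B\<close> at the element whose following gap
    contains \<open>x\<close>. As \<open>B\<close> lies above \<open>y\<close> and
    \<open>x < y\<close>, this is the largest element.\<close>
  define j where "j = Max B"
  have j: "j \<in> B" "\<And>b. b \<in> B \<Longrightarrow> b \<le> j"
    using LD(2,3) [OF B(1)] Max_in by (auto simp: j_def)
  have By: "y \<le> b" if "b \<in> B" for b
    using that y_min [of b] BC LD(4) [OF A(1) B(1)] AB by (meson not_le subsetD)
  have A_gap: "a \<le> x \<or> j < a" if a: "a \<in> A" for a
  proof (rule ccontr)
    assume "\<not> ?thesis"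
    then have "x < a" "a \<le> j" by auto
    moreover have "a \<noteq> y" "a \<noteq> j" using a y(2) j(1) AB LD(4) [OF A(1) B(1)] by auto
    ultimately have "y < a" "a < j"
      using x_max [of a] a AC(1) by auto (meson le_less_linear less_le_not_le nat_neq_iff subsetD)
    then have "y < x \<and> x < j"
      using noncrossing_partitionD(5) [OF L A(1) B(1) AB] a xA B(2) j(1)
      unfolding noncrossing_def by blast
    then show False using x(2) by simp
  qed
  have sep: "u \<le> x \<and> x < v \<longleftrightarrow> u \<le> j \<and> j < v"
    if K: "K \<in> L" "u \<in> K" "v \<in> K" "u < v" for K u v
  proof (cases "K = A \<or> K = B")
    case True
    then show ?thesis
    proof
      assume "K = A"
      then show ?thesis
        using A_gap [of u] A_gap [of v] K x(2) By [OF j(1)] by auto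
    next
      assume "K = B"
      then show ?thesis
        using By [of u] By [of v] j(2) [of v] K x(2) by force
    qed
  next
    case False
    then have ncK: "noncrossing B K" and nA: "noncrossing A K"
      using K(1) A B noncrossing_partitionD(5) [OF L] by metis+
    have notin: "x \<notin> K" "y \<notin> K" "j \<notin> K"
      using K(1) A(1) B xA j(1) False LD(4) by metis+
    have yj: "u < y \<and> y < v \<longleftrightarrow> u < j \<and> j < v"
      using ncK B(2) j(1) K unfolding noncrossing_def by blast
    \<comment> \<open>If \<open>K\<close> lies in \<open>C\<close>, then \<open>u\<close> and
      \<open>v\<close> are in \<open>C\<close>, which has no element strictly between
      \<open>x\<close> and \<open>y\<close>. Otherwise \<open>K\<close> lies in another block of
      \<open>M\<close>, which does not cross \<open>C\<close>.\<close>
    have xy: "u < x \<and> x < v \<longleftrightarrow> u < y \<and> y < v"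
    proof (cases "K \<subseteq> C")
      case True
      then have "u \<in> C" "v \<in> C" using K by auto
      then show ?thesis
        using x_max [of u] x_max [of v] notin K x(2)
        by (metis less_le_trans less_trans nat_less_le not_le)
    next
      case False
      obtain C' where C': "C' \<in> M" "K \<subseteq> C'"
        using LM(1) K(1) by (auto simp: refines_def)
      then have "noncrossing C C'"
        using False C(1) MD(5) by metis
      then show ?thesis
        using x(1) y(1) K C'(2) unfolding noncrossing_def by blast
    qed
    show ?thesis
      using xy yj notin K by (metis nat_less_le)
  qed
  have "refines (merge L A B) M"
    using LM(1) AC(1) BC C(1) by (auto simp: refines_def merge_def)
  then show thesis
    using that [OF A(1) B(1) AB xA j(1)] sep by (simp add: same_sides_def)
qed

section \<open>Products over noncrossing partitions\<close>

context group
begin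

lemma list_product_commute1:
  assumes "g \<in> carrier G" "set hs \<subseteq> carrier G" "\<And>h. h \<in> set hs \<Longrightarrow> g \<otimes> h = h \<otimes> g"
  shows "g \<otimes> list_product G hs = list_product G hs \<otimes> g"
  using assms(2,3)
proof (induction hs)
  case (Cons h hs)
  have h: "h \<in> carrier G" "list_product G hs \<in> carrier G"
    using Cons.prems(1) by auto
  have "g \<otimes> (h \<otimes> list_product G hs) = h \<otimes> g \<otimes> list_product G hs"
    using assms(1) h Cons.prems(2) [of h] by (simp add: m_assoc [symmetric])
  also have "\<dots> = h \<otimes> (list_product G hs \<otimes> g)"
    using assms(1) h Cons by (simp add: m_assoc)
  finally show ?case
    using assms(1) h by (simp add: m_assoc)
qed (use assms(1) in simp)

lemma list_product_commute:
  assumes "set gs \<subseteq> carrier G" "set hs \<subseteq> carrier G"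
    "\<And>g h. \<lbrakk>g \<in> set gs; h \<in> set hs\<rbrakk> \<Longrightarrow> g \<otimes> h = h \<otimes> g"
  shows "list_product G gs \<otimes> list_product G hs = list_product G hs \<otimes> list_product G gs"
proof -
  have "g \<otimes> list_product G hs = list_product G hs \<otimes> g" if "g \<in> set gs" for g
    using assms that by (intro list_product_commute1) auto
  then show ?thesis
    using list_product_commute1 [of "list_product G hs" gs] assms(1,2) by simp
qed

lemma list_product_rearrange:
  assumes "distinct xs" "distinct ys" "set xs = set ys" "f ` set xs \<subseteq> carrier G"
    and "\<And>x y. \<lbrakk>x \<in> set xs; y \<in> set xs; x \<noteq> y\<rbrakk> \<Longrightarrow> f x \<otimes> f y = f y \<otimes> f x"
  shows "list_product G (map f xs) = list_product G (map f ys)"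
  using assms
proof (induction xs arbitrary: ys)
  case (Cons x xs)
  obtain us vs where ys: "ys = us @ x # vs"
    using Cons.prems(3) by (metis list.set_intros(1) split_list)
  have "set us \<union> set vs = set ys - {x}" "set xs = set (x # xs) - {x}"
    using Cons.prems(1,2) ys by auto
  then have us_vs: "set us \<union> set vs = set xs"
    using Cons.prems(3) by metis
  have dist: "distinct (us @ vs)"
    using Cons.prems(2) ys by simp
  have c: "set (map f us) \<subseteq> carrier G" "set (map f vs) \<subseteq> carrier G" "f x \<in> carrier G"
    using Cons.prems(4) us_vs by auto
  have "f x \<otimes> list_product G (map f us) = list_product G (map f us) \<otimes> f x"
  proof (rule list_product_commute1)
    fix h assume "h \<in> set (map f us)"
    then obtain u where "u \<in> set us" "h = f u" by auto
    moreover from this have "u \<in> set (x # xs)" "x \<noteq> u"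
      using us_vs Cons.prems(1) by auto
    ultimately show "f x \<otimes> h = h \<otimes> f x"
      using Cons.prems(5) [of x u] by simp
  qed (use c in auto)
  moreover have "list_product G (map f xs) = list_product G (map f (us @ vs))"
  proof (rule Cons.IH)
    show "f y \<otimes> f z = f z \<otimes> f y" if "y \<in> set xs" "z \<in> set xs" "y \<noteq> z" for y z
      using Cons.prems(5) [of y z] that by simp
  qed (use Cons.prems(1,4) us_vs dist in auto)
  ultimately show ?case
    using c ys by (simp add: list_product_append) (simp add: m_assoc [symmetric])
qed simp

end

lemma noncrossing_pair_cong:
  "noncrossing A B \<Longrightarrow> i \<in> A \<Longrightarrow> j \<in> A \<Longrightarrow> k \<in> B \<Longrightarrow> l \<in> B \<Longrightarrow> noncrossing {i, j} {k, l}"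
  by (rule noncrossing_mono) auto

text \<open>The relations are those of Birman, Ko and Lee for the band generators of the braid
  group. The maps \<open>\<phi>\<close> and \<open>len\<close> are the invariants that tell elements
  apart; permutations act on the right, so \<open>\<phi> x\<close> comes first in
  \<open>\<phi> (x \<otimes> y)\<close>.\<close>

locale dual_braid = group G for G (structure) +
  fixes n :: nat and d :: "nat \<Rightarrow> nat \<Rightarrow> 'a" and \<phi> :: "'a \<Rightarrow> nat \<Rightarrow> nat" and len :: "'a \<Rightarrow> int"
  assumes n_pos: "n \<ge> 1"
    and d_closed: "\<lbrakk>i < n; j < n; i \<noteq> j\<rbrakk> \<Longrightarrow> d i j \<in> carrier G"
    and d_sym: "\<lbrakk>i < n; j < n\<rbrakk> \<Longrightarrow> d i j = d j i"
    and d_triangle: "\<lbrakk>i < n; j < n; k < n; cyc3 i j k\<rbrakk> \<Longrightarrow> d i j \<otimes> d j k = d j k \<otimes> d k i"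
    and d_commute: "\<lbrakk>i < n; j < n; k < n; l < n; i \<noteq> j; k \<noteq> l; {i, j} \<inter> {k, l} = {};
      noncrossing {i, j} {k, l}\<rbrakk> \<Longrightarrow> d i j \<otimes> d k l = d k l \<otimes> d i j"
    and \<phi>_mult: "\<lbrakk>x \<in> carrier G; y \<in> carrier G; v < n\<rbrakk> \<Longrightarrow> \<phi> (x \<otimes> y) v = \<phi> y (\<phi> x v)"
    and \<phi>_one: "v < n \<Longrightarrow> \<phi> \<one> v = v"
    and \<phi>_d: "\<lbrakk>i < n; j < n; i \<noteq> j; v < n\<rbrakk> \<Longrightarrow> \<phi> (d i j) v = swap i j v"
    and len_mult: "\<lbrakk>x \<in> carrier G; y \<in> carrier G\<rbrakk> \<Longrightarrow> len (x \<otimes> y) = len x + len y"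
    and len_d: "\<lbrakk>i < n; j < n; i \<noteq> j\<rbrakk> \<Longrightarrow> len (d i j) = 1"
begin

definition word_prod :: "(nat \<times> nat) list \<Rightarrow> 'a" where
  "word_prod ws = list_product G (map (\<lambda>(i, j). d i j) ws)"

lemma letters_carrier: "set ws \<subseteq> letters n \<Longrightarrow> set (map (\<lambda>(i, j). d i j) ws) \<subseteq> carrier G"
  using d_closed by (auto simp: letters_def)

lemma word_prod_Nil [simp]: "word_prod [] = \<one>"
  by (simp add: word_prod_def)

lemma word_prod_Cons [simp]: "word_prod ((i, j) # ws) = d i j \<otimes> word_prod ws"
  by (simp add: word_prod_def)

lemma word_prod_closed [simp]: "set ws \<subseteq> letters n \<Longrightarrow> word_prod ws \<in> carrier G"
  unfolding word_prod_def by (intro list_product_closed letters_carrier)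

lemma word_prod_append:
  "\<lbrakk>set us \<subseteq> letters n; set ws \<subseteq> letters n\<rbrakk> \<Longrightarrow> word_prod (us @ ws) = word_prod us \<otimes> word_prod ws"
  unfolding word_prod_def map_append by (intro list_product_append letters_carrier)

lemma \<phi>_word: "\<lbrakk>set ws \<subseteq> letters n; v < n\<rbrakk> \<Longrightarrow> \<phi> (word_prod ws) v = word_perm ws v"
proof (induction ws arbitrary: v)
  case (Cons w ws)
  obtain i j where w: "w = (i, j)" by (cases w)
  have ij: "i < n" "j < n" "i \<noteq> j" and ws: "set ws \<subseteq> letters n"
    using Cons.prems w by (auto simp: letters_def)
  have "\<phi> (d i j \<otimes> word_prod ws) v = \<phi> (word_prod ws) (\<phi> (d i j) v)"
    using ij ws Cons.prems(2) by (intro \<phi>_mult d_closed word_prod_closed)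
  then show ?case
    using Cons.IH ws ij Cons.prems(2) w \<phi>_d swap_lt by simp
qed (simp add: \<phi>_one)

lemma len_word: "set ws \<subseteq> letters n \<Longrightarrow> len (word_prod ws) = int (length ws)"
proof (induction ws)
  case Nil
  then show ?case using len_mult [of \<one> \<one>] by simp
next
  case (Cons w ws)
  then show ?case
    by (cases w) (auto simp: letters_def len_mult len_d d_closed)
qed

section \<open>Products along clockwise lists of indices\<close>

definition path_prod :: "nat list \<Rightarrow> 'a" where
  "path_prod xs = word_prod (zip xs (tl xs))"

lemma path_letters: "\<lbrakk>distinct xs; set xs \<subseteq> {..<n}\<rbrakk> \<Longrightarrow> set (zip xs (tl xs)) \<subseteq> letters n"
proof
  fix p assume xs: "distinct xs" "set xs \<subseteq> {..<n}" and p: "p \<in> set (zip xs (tl xs))"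
  obtain k where "xs ! k = fst p" "tl xs ! k = snd p" "k < length (tl xs)"
    using p by (auto simp: in_set_zip)
  then have k: "Suc k < length xs" "p = (xs ! k, xs ! Suc k)"
    by (auto simp: nth_tl prod_eq_iff)
  then show "p \<in> letters n"
    using xs subsetD [OF xs(2) nth_mem [of k]] subsetD [OF xs(2) nth_mem [of "Suc k"]]
    by (auto simp: letters_def nth_eq_iff_index_eq)
qed

lemma path_prod_closed [simp]: "\<lbrakk>distinct xs; set xs \<subseteq> {..<n}\<rbrakk> \<Longrightarrow> path_prod xs \<in> carrier G"
  unfolding path_prod_def by (intro word_prod_closed path_letters)

lemma path_prod_append:
  assumes "distinct (xs @ ys)" "set (xs @ ys) \<subseteq> {..<n}" "xs \<noteq> []" "ys \<noteq> []"
  shows "path_prod (xs @ ys) = path_prod xs \<otimes> d (last xs) (hd ys) \<otimes> path_prod ys"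
proof -
  have l: "set (zip xs (tl xs)) \<subseteq> letters n" "set (zip ys (tl ys)) \<subseteq> letters n"
    using assms by (auto intro!: path_letters del: subsetI)
  have "last xs \<in> set (xs @ ys)" "hd ys \<in> set (xs @ ys)"
    using assms(3,4) by auto
  then have "last xs \<in> {..<n}" "hd ys \<in> {..<n}"
    using assms(2) by blast+
  moreover have "last xs \<noteq> hd ys"
    using assms(1) last_in_set [OF assms(3)] hd_in_set [OF assms(4)] by (auto simp: disjoint_iff)
  ultimately have "(last xs, hd ys) \<in> letters n"
    by (simp add: letters_def)
  then show ?thesis
    unfolding path_prod_def zip_tl_append [OF assms(3,4)] using l
    by (simp add: word_prod_append m_assoc d_closed letters_def)
qed

text \<open>The triangle relation moves the first factor to the right: passing \<open>d y z\<close>,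
  the factor \<open>d x y\<close> becomes \<open>d x z\<close>, until at the end it joins
  \<open>x\<close> to the last entry. This is why the product over a block is independent of the
  starting point.\<close>

lemma path_prod_rotate1:
  assumes "cyclic_list (x # ys)" "distinct (x # ys)" "set (x # ys) \<subseteq> {..<n}"
  shows "path_prod (x # ys) = path_prod (ys @ [x])"
proof (cases ys)
  case (Cons y zs)
  have "d x y \<otimes> path_prod (y # zs) = path_prod (y # zs) \<otimes> d (last (y # zs)) x"
    using assms unfolding Cons
  proof (induction zs arbitrary: y)
    case Nil
    then show ?case by (simp add: path_prod_def d_sym d_closed)
  next
    case (Cons z zs)
    have lt: "x < n" "y < n" "z < n" "x \<noteq> y" "x \<noteq> z" "y \<noteq> z" "cyc3 x y z"
      using Cons.prems by auto
    have l: "last (z # zs) < n" "last (z # zs) \<noteq> x"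
      using Cons.prems last_in_set [of "z # zs"] by auto
    have IH: "d x z \<otimes> path_prod (z # zs) = path_prod (z # zs) \<otimes> d (last (z # zs)) x"
      using Cons.prems by (intro Cons.IH) auto
    have c: "path_prod (z # zs) \<in> carrier G"
      using Cons.prems by (intro path_prod_closed) auto
    have s: "path_prod (y # z # zs) = d y z \<otimes> path_prod (z # zs)"
      by (simp add: path_prod_def)
    have "d x y \<otimes> path_prod (y # z # zs) = d x y \<otimes> d y z \<otimes> path_prod (z # zs)"
      using lt c by (simp add: s m_assoc d_closed)
    also have "\<dots> = d y z \<otimes> d x z \<otimes> path_prod (z # zs)"
      using d_triangle [of x y z] lt by (simp add: d_sym)
    also have "\<dots> = d y z \<otimes> (d x z \<otimes> path_prod (z # zs))"
      using lt c by (simp add: m_assoc d_closed)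
    also have "\<dots> = path_prod (y # z # zs) \<otimes> d (last (z # zs)) x"
      unfolding IH s using lt c l by (simp add: m_assoc d_closed)
    finally show ?case by simp
  qed
  moreover have "path_prod (x # y # zs) = d x y \<otimes> path_prod (y # zs)"
    by (simp add: path_prod_def)
  moreover have "path_prod ((y # zs) @ [x]) = path_prod (y # zs) \<otimes> d (last (y # zs)) x"
  proof -
    have "last (y # zs) < n" "last (y # zs) \<noteq> x"
      using assms Cons last_in_set [of "y # zs"] by auto
    then show ?thesis
      using assms Cons path_prod_append [of "y # zs" "[x]"]
      by (simp add: path_prod_def [of "[x]"] d_closed)
  qed
  ultimately show ?thesis
    using Cons by simp
qed simp

lemma path_prod_rotate:
  assumes "cyclic_list (us @ vs)" "distinct (us @ vs)" "set (us @ vs) \<subseteq> {..<n}"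
  shows "path_prod (us @ vs) = path_prod (vs @ us)"
  using assms
proof (induction us arbitrary: vs)
  case (Cons u us)
  have "path_prod ((u # us) @ vs) = path_prod (us @ (vs @ [u]))"
    using path_prod_rotate1 [of u "us @ vs"] Cons.prems by simp
  also have "\<dots> = path_prod ((vs @ [u]) @ us)"
    using Cons.prems cyclic_list_rotate1 [of u "us @ vs"] by (intro Cons.IH) auto
  finally show ?case by simp
qed simp

definition block_word :: "nat set \<Rightarrow> (nat \<times> nat) list" where
  "block_word A = zip (sorted_list_of_set A) (tl (sorted_list_of_set A))"

definition block_prod :: "nat set \<Rightarrow> 'a" where
  "block_prod A = path_prod (sorted_list_of_set A)"

lemma block_prod_word: "block_prod A = word_prod (block_word A)"
  by (simp add: block_prod_def path_prod_def block_word_def)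

lemma block_word_letters: "A \<subseteq> {..<n} \<Longrightarrow> set (block_word A) \<subseteq> letters n"
  unfolding block_word_def using finite_subset [of A "{..<n}"] by (intro path_letters) auto

lemma block_prod_closed [simp]: "A \<subseteq> {..<n} \<Longrightarrow> block_prod A \<in> carrier G"
  unfolding block_prod_word by (intro word_prod_closed block_word_letters)

lemma block_word_subset: "\<lbrakk>(i, j) \<in> set (block_word A); finite A\<rbrakk> \<Longrightarrow> i \<in> A \<and> j \<in> A"
  unfolding block_word_def
  by (metis list.sel(2) list.set_sel(2) set_sorted_list_of_set set_zip_leftD set_zip_rightD)

lemma path_prod_cyclic:
  assumes "cyclic_list zs" "distinct zs" "set zs \<subseteq> {..<n}"
  shows "path_prod zs = block_prod (set zs)"
proof (cases "zs = []")
  case False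
  obtain us vs where zs: "zs = us @ vs" "sorted_wrt (<) (vs @ us)"
    using cyclic_list_sorted_rotation [OF assms(1,2) False] .
  then have "sorted_list_of_set (set zs) = vs @ us"
    using sorted_list_of_set.idem_if_sorted_distinct [of "vs @ us"]
    by (simp add: strict_sorted_iff Un_commute)
  then show ?thesis
    using path_prod_rotate [of us vs] assms zs by (simp add: block_prod_def)
qed (simp add: block_prod_def)

lemma word_prods_commute:
  assumes "set us \<subseteq> letters n" "set ws \<subseteq> letters n"
    "\<And>i j k l. \<lbrakk>(i, j) \<in> set us; (k, l) \<in> set ws\<rbrakk> \<Longrightarrow> {i, j} \<inter> {k, l} = {} \<and> noncrossing {i, j} {k, l}"
  shows "word_prod us \<otimes> word_prod ws = word_prod ws \<otimes> word_prod us"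
  unfolding word_prod_def
proof (intro list_product_commute letters_carrier assms(1,2))
  fix g h assume "g \<in> set (map (\<lambda>(i, j). d i j) us)" "h \<in> set (map (\<lambda>(i, j). d i j) ws)"
  then obtain i j k l where "(i, j) \<in> set us" "(k, l) \<in> set ws" "g = d i j" "h = d k l"
    by auto
  moreover from this have "(i, j) \<in> letters n" "(k, l) \<in> letters n"
    using assms by auto
  ultimately show "g \<otimes> h = h \<otimes> g"
    using assms(3) [of i j k l] d_commute [of i j k l] by (simp add: letters_def)
qed

lemma block_prods_commute:
  assumes "A \<subseteq> {..<n}" "B \<subseteq> {..<n}" "A \<inter> B = {}" "noncrossing A B"
  shows "block_prod A \<otimes> block_prod B = block_prod B \<otimes> block_prod A"
  unfolding block_prod_word
proof (intro word_prods_commute block_word_letters assms(1,2))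
  fix i j k l assume "(i, j) \<in> set (block_word A)" "(k, l) \<in> set (block_word B)"
  then have "i \<in> A" "j \<in> A" "k \<in> B" "l \<in> B"
    using block_word_subset finite_subset [OF assms(1)] finite_subset [OF assms(2)] by blast+
  then show "{i, j} \<inter> {k, l} = {} \<and> noncrossing {i, j} {k, l}"
    using assms(3) noncrossing_pair_cong [OF assms(4)] by auto
qed

section \<open>Products over all blocks of a partition\<close>

definition partition_prod :: "nat set set \<Rightarrow> 'a" where
  "partition_prod L = list_product G (map block_prod (SOME As. distinct As \<and> set As = L))"

lemma partition_prod_eq:
  assumes L: "noncrossing_partition n L" and As: "distinct As" "set As = L"
  shows "partition_prod L = list_product G (map block_prod As)"
proof -
  define Bs where "Bs = (SOME As. distinct As \<and> set As = L)"
  have Bs: "distinct Bs \<and> set Bs = L"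
    unfolding Bs_def using As by (intro someI [where P = "\<lambda>As. distinct As \<and> set As = L"]) simp
  have "list_product G (map block_prod Bs) = list_product G (map block_prod As)"
  proof (rule list_product_rearrange)
    show "block_prod ` set Bs \<subseteq> carrier G"
      using Bs noncrossing_partitionD(1) [OF L] by auto
    show "block_prod A \<otimes> block_prod B = block_prod B \<otimes> block_prod A"
      if "A \<in> set Bs" "B \<in> set Bs" "A \<noteq> B" for A B
      using that Bs noncrossing_partitionD(1,5) [OF L] noncrossing_partitionD(4) [OF L, of A B]
      by (intro block_prods_commute) auto
  qed (use As Bs in auto)
  then show ?thesis
    by (simp add: partition_prod_def Bs_def)
qed

definition partition_word :: "nat set list \<Rightarrow> (nat \<times> nat) list" where
  "partition_word As = concat (map block_word As)"

lemma partition_word_letters: "\<Union>(set As) \<subseteq> {..<n} \<Longrightarrow> set (partition_word As) \<subseteq> letters n"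
  unfolding partition_word_def using block_word_letters by (simp add: UN_subset_iff Sup_le_iff)

lemma list_product_block_prod:
  "\<Union>(set As) \<subseteq> {..<n} \<Longrightarrow> list_product G (map block_prod As) = word_prod (partition_word As)"
proof (induction As)
  case (Cons A As)
  then show ?case
    using block_word_letters [of A] partition_word_letters [of As]
    by (simp add: block_prod_word word_prod_append partition_word_def)
qed (simp add: partition_word_def)

lemma partition_listing:
  assumes "noncrossing_partition n L"
  obtains As where "distinct As" "set As = L" "set (partition_word As) \<subseteq> letters n"
    "partition_prod L = word_prod (partition_word As)"
proof -
  obtain As where As: "distinct As" "set As = L"
    using finite_distinct_list [OF noncrossing_partitionD(6) [OF assms]] by blast
  moreover have "\<Union>(set As) \<subseteq> {..<n}"
    using As noncrossing_partitionD(1) [OF assms] by auto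
  ultimately show thesis
    using that partition_prod_eq [OF assms As] list_product_block_prod [of As] partition_word_letters [of As]
    by simp
qed

lemma partition_prod_closed [simp]: "noncrossing_partition n L \<Longrightarrow> partition_prod L \<in> carrier G"
  using partition_listing word_prod_closed by metis

subsection \<open>Merging two blocks\<close>

text \<open>List \<open>A \<union> B\<close> clockwise so that \<open>A\<close> comes first and ends
  in \<open>i\<close>. The product is then that of \<open>A\<close>, followed by
  \<open>d i (hd Bs)\<close> and the product of \<open>B\<close>. Rotating the cyclic list
  \<open>i # Bs\<close> moves the middle factor to the right, where it becomes \<open>d i j\<close>
  since \<open>j\<close> is the last element of \<open>B\<close>.\<close>

lemma block_prod_merge:
  assumes A: "A \<subseteq> {..<n}" "i \<in> A" and B: "B \<subseteq> {i<..j}" "j \<in> B" "j < n" and gap: "A \<inter> {i<..j} = {}"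
  shows "block_prod A \<otimes> block_prod B \<otimes> d i j = block_prod (A \<union> B)"
proof -
  have fin: "finite A" "finite B"
    using A B finite_subset by blast+
  define A1 where "A1 = sorted_list_of_set {a \<in> A. a \<le> i}"
  define A2 where "A2 = sorted_list_of_set {a \<in> A. j < a}"
  define Bs where "Bs = sorted_list_of_set B"
  have set: "set A1 = {a \<in> A. a \<le> i}" "set A2 = {a \<in> A. j < a}" "set Bs = B"
    using fin by (simp_all add: A1_def A2_def Bs_def)
  have dist: "distinct A1" "distinct A2" "distinct Bs"
    by (simp_all add: A1_def A2_def Bs_def)
  have ij: "i < j" using B by auto
  have s: "sorted_wrt (<) A1" "sorted_wrt (<) A2" "sorted_wrt (<) Bs"
    by (simp_all add: A1_def A2_def Bs_def)
  have sAB: "sorted_wrt (<) (A1 @ Bs @ A2)"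
    using s set B(1) ij by (fastforce simp: sorted_wrt_append)
  have sA: "sorted_wrt (<) (A1 @ A2)"
    using s set ij by (fastforce simp: sorted_wrt_append)
  have setA: "set (A1 @ A2) = A"
    using set gap by auto
  have ne: "A1 \<noteq> []" "Bs \<noteq> []"
    using set A(2) B(2) by force+
  have lastA: "last A1 = i"
  proof -
    have "last A1 \<in> set A1" "i \<in> set A1"
      using ne A(2) set by auto
    moreover have "x \<le> last A1" if "x \<in> set A1" for x
      using that s(1) ne(1) by (cases A1 rule: rev_cases) (auto simp: sorted_wrt_append less_imp_le)
    ultimately show ?thesis
      using set(1) by (metis (mono_tags, lifting) antisym mem_Collect_eq)
  qed
  have lastB: "last Bs = j"
  proof -
    have "last Bs \<in> set Bs" "j \<in> set Bs"
      using ne B(2) set by auto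
    moreover have "x \<le> last Bs" if "x \<in> set Bs" for x
      using that s(3) ne(2) by (cases Bs rule: rev_cases) (auto simp: sorted_wrt_append less_imp_le)
    ultimately show ?thesis
      using set(3) B(1) by (metis antisym greaterThanAtMost_iff subsetD)
  qed
  have sub: "set (A1 @ Bs @ A2) \<subseteq> {..<n}"
    using set A(1) B by fastforce
  have all: "set (A1 @ Bs @ A2) = A \<union> B"
    using setA set(3) by auto
  have d1: "distinct (A1 @ Bs @ A2)" "distinct (A1 @ A2)"
    using sAB sA strict_sorted_iff by blast+
  have B_cyc: "path_prod (i # Bs) = path_prod (Bs @ [i])"
    using set(3) B sub ne lastA s(3) dist(3) ij
    by (intro path_prod_rotate1 sorted_imp_cyclic) auto
  have hdB: "d i (hd Bs) \<otimes> path_prod Bs = path_prod Bs \<otimes> d i j"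
  proof -
    have "i < n" using A by auto
    have "path_prod (i # Bs) = d i (hd Bs) \<otimes> path_prod Bs"
      using ne(2) by (cases Bs) (auto simp: path_prod_def)
    moreover have "path_prod (Bs @ [i]) = path_prod Bs \<otimes> d j i"
      using path_prod_append [of Bs "[i]"] ne(2) dist(3) set(3) B \<open>i < n\<close> ij lastB
      by (force simp: path_prod_def [of "[i]"] d_closed)
    ultimately show ?thesis
      using B_cyc d_sym [of i j] \<open>i < n\<close> B(3) by simp
  qed
  have "block_prod (A \<union> B) = path_prod ((A1 @ Bs) @ A2)"
    using path_prod_cyclic [of "A1 @ Bs @ A2"] sorted_imp_cyclic [OF sAB] d1 sub all by simp
  also have "\<dots> = path_prod (A2 @ A1 @ Bs)"
    using path_prod_rotate [of "A1 @ Bs" A2] sorted_imp_cyclic [OF sAB] d1 sub by simp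
  also have "\<dots> = path_prod (A2 @ A1) \<otimes> d i (hd Bs) \<otimes> path_prod Bs"
  proof -
    have "distinct ((A2 @ A1) @ Bs)" "set ((A2 @ A1) @ Bs) \<subseteq> {..<n}"
      using d1(1) sub by auto
    then show ?thesis
      using path_prod_append [of "A2 @ A1" Bs] ne lastA by simp
  qed
  also have "path_prod (A2 @ A1) = path_prod (A1 @ A2)"
    using path_prod_rotate [of A1 A2] sorted_imp_cyclic [OF sA] d1 sub by simp
  also have "path_prod (A1 @ A2) = block_prod A"
    using path_prod_cyclic [of "A1 @ A2"] sorted_imp_cyclic [OF sA] d1 sub setA by simp
  finally have "block_prod (A \<union> B) = block_prod A \<otimes> d i (hd Bs) \<otimes> path_prod Bs" .
  moreover have "block_prod B = path_prod Bs"
    by (simp add: block_prod_def Bs_def)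
  moreover have "path_prod Bs \<in> carrier G" "d i (hd Bs) \<in> carrier G" "d i j \<in> carrier G"
    using set B sub dist(3) A ij hd_in_set [OF ne(2)] by (auto intro!: d_closed)
  ultimately show ?thesis
    using hdB A(1) by (simp add: m_assoc)
qed

text \<open>For \<open>i < j\<close>, applying \<open>same_sides\<close> to the pairs in
  \<open>B\<close> that contain \<open>j\<close> confines \<open>B\<close> to
  \<open>{i<..j}\<close>; applying it to the pairs in \<open>A\<close> that contain \<open>i\<close>
  keeps \<open>A\<close> out of this interval.\<close>

lemma block_prods_merge:
  assumes L: "noncrossing_partition n L" and AB: "A \<in> L" "B \<in> L" "A \<noteq> B" "i \<in> A" "j \<in> B" "i < j"
    and same: "same_sides L i j"
  shows "block_prod A \<otimes> block_prod B \<otimes> d i j = block_prod (A \<union> B)"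
proof (rule block_prod_merge)
  note LD = noncrossing_partitionD [OF L] and sep = same_sidesD [OF same]
  show "A \<subseteq> {..<n}" "i \<in> A" "j \<in> B" "j < n"
    using LD(1) AB by auto
  have "b \<in> {i<..j}" if b: "b \<in> B" for b
  proof -
    have "b \<noteq> i" using b AB LD(4) [OF AB(1,2)] by blast
    then show ?thesis
      using sep [OF AB(2) b AB(5)] sep [OF AB(2) AB(5) b] \<open>i < j\<close> by (cases b j rule: linorder_cases) auto
  qed
  then show "B \<subseteq> {i<..j}" by blast
  have "a \<notin> {i<..j}" if a: "a \<in> A" for a
  proof
    assume "a \<in> {i<..j}"
    moreover have "a \<noteq> j" using a AB LD(4) [OF AB(1,2)] by blast
    ultimately show False
      using sep [OF AB(1) AB(4) a] by auto
  qed
  then show "A \<inter> {i<..j} = {}" by blast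
qed

lemma partition_prod_merge:
  assumes L: "noncrossing_partition n L" and AB: "A \<in> L" "B \<in> L" "A \<noteq> B" "i \<in> A" "j \<in> B"
    and same: "same_sides L i j"
  shows "partition_prod L \<otimes> d i j = partition_prod (merge L A B)"
proof -
  note LD = noncrossing_partitionD [OF L]
  have ij: "i < n" "j < n" "i \<noteq> j"
    using LD(1) [OF AB(1)] LD(1) [OF AB(2)] LD(4) [OF AB(1,2)] AB(3,4,5) by auto
  have sub: "A \<subseteq> {..<n}" "B \<subseteq> {..<n}"
    using LD(1) AB by auto
  have comm: "block_prod A \<otimes> block_prod B = block_prod B \<otimes> block_prod A"
    using LD(5) AB(1-3) LD(4) [OF AB(1,2)] sub by (intro block_prods_commute) auto
  have m: "block_prod A \<otimes> block_prod B \<otimes> d i j = block_prod (A \<union> B)"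
  proof (cases "i < j")
    case True
    then show ?thesis
      using block_prods_merge [OF L AB _ same] by blast
  next
    case False
    then have "j < i" using ij by simp
    then have "block_prod B \<otimes> block_prod A \<otimes> d j i = block_prod (B \<union> A)"
      using block_prods_merge [OF L AB(2,1) _ AB(5,4)] same AB(3) by (auto simp: same_sides_def)
    then show ?thesis
      using comm d_sym ij by (simp add: Un_commute)
  qed
  obtain Cs where Cs: "distinct Cs" "set Cs = L - {A, B}"
    using finite_distinct_list [of "L - {A, B}"] LD(6) by auto
  have c: "set (map block_prod Cs) \<subseteq> carrier G"
    using Cs(2) by (auto intro!: block_prod_closed LD(1))
  have "partition_prod L = list_product G (map block_prod (Cs @ [A, B]))"
    using Cs AB by (intro partition_prod_eq [OF L]) auto
  then have 1: "partition_prod L = list_product G (map block_prod Cs) \<otimes> (block_prod A \<otimes> block_prod B)"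
    using c sub by (simp add: list_product_append)
  have new: "A \<union> B \<notin> L"
    using LD(4) [OF _ AB(1)] LD(4) [OF _ AB(2)] AB(3,4,5) by (metis UnI1 UnI2)
  have "partition_prod (merge L A B) = list_product G (map block_prod (Cs @ [A \<union> B]))"
    using Cs new
    by (intro partition_prod_eq noncrossing_partition_merge [OF L AB(1,2,4,5) same]) (auto simp: merge_def)
  then have 2: "partition_prod (merge L A B) = list_product G (map block_prod Cs) \<otimes> block_prod (A \<union> B)"
    using c sub by (simp add: list_product_append)
  show ?thesis
    unfolding 1 2 m [symmetric] using c sub ij by (simp add: m_assoc d_closed)
qed

subsection \<open>Divisibility\<close>

abbreviation \<delta> :: 'a where "\<delta> \<equiv> block_prod {..<n}"

lemma partition_prod_top: "partition_prod {{..<n}} = \<delta>"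
  using partition_prod_eq [OF noncrossing_partition_top [OF n_pos], of "[{..<n}]"] by simp

lemma refines_divides:
  assumes "noncrossing_partition n L" "noncrossing_partition n M" "refines L M"
  shows "\<exists>ws. set ws \<subseteq> letters n \<and> partition_prod L \<otimes> word_prod ws = partition_prod M"
  using assms
proof (induction "card L" arbitrary: L rule: less_induct)
  case less
  note LD = noncrossing_partitionD [OF less.prems(1)]
  show ?case
  proof (cases "L = M")
    case True
    then show ?thesis
      using less.prems by (intro exI [of _ "[]"]) simp
  next
    case False
    obtain A B i j where AB: "A \<in> L" "B \<in> L" "A \<noteq> B" "i \<in> A" "j \<in> B" "refines (merge L A B) M"
      and same: "same_sides L i j"
      by (rule refines_step [OF less.prems(1,2,3) False])
    have ij: "i < n" "j < n" "i \<noteq> j"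
      using LD(1) [OF AB(1)] LD(1) [OF AB(2)] LD(4) [OF AB(1,2)] AB(3,4,5) by auto
    have nc: "noncrossing_partition n (merge L A B)"
      by (rule noncrossing_partition_merge [OF less.prems(1) AB(1,2,4,5) same])
    have "card (merge L A B) \<le> Suc (card (L - {A, B}))"
      unfolding merge_def by (rule card_insert_le_m1) auto
    also have "\<dots> < card L"
    proof -
      have "card {A, B} \<le> card L"
        using AB LD(6) by (intro card_mono) auto
      moreover have "card {A, B} = 2"
        using AB by simp
      ultimately show ?thesis
        using card_Diff_subset [of "{A, B}" L] AB by simp
    qed
    finally obtain ws where ws: "set ws \<subseteq> letters n"
        "partition_prod (merge L A B) \<otimes> word_prod ws = partition_prod M"
      using less.hyps [OF _ nc less.prems(2) AB(6)] by blast
    have "partition_prod L \<otimes> word_prod ((i, j) # ws) = partition_prod L \<otimes> d i j \<otimes> word_prod ws"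
      using ws ij less.prems(1) by (simp add: m_assoc d_closed)
    also have "\<dots> = partition_prod M"
      using partition_prod_merge [OF less.prems(1) AB(1-5) same] ws by simp
    finally show ?thesis
      using ws ij by (intro exI [of _ "(i, j) # ws"]) (auto simp: letters_def)
  qed
qed

text \<open>A block with \<open>k\<close> elements contributes a path of \<open>k - 1\<close>
  letters.\<close>

lemma len_partition_prod:
  assumes L: "noncrossing_partition n L"
  shows "len (partition_prod L) = int n - int (card L)"
proof -
  note LD = noncrossing_partitionD [OF L]
  obtain As where As: "distinct As" "set As = L" "set (partition_word As) \<subseteq> letters n"
      "partition_prod L = word_prod (partition_word As)"
    using partition_listing [OF L] by blast
  have "length (partition_word As) + card L = (\<Sum>A\<in>L. card A)"
  proof -
    have "length (partition_word As) + card L = (\<Sum>A\<leftarrow>As. length (block_word A)) + (\<Sum>A\<leftarrow>As. 1)"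
      using As distinct_card [of As] by (simp add: partition_word_def length_concat o_def sum_list_triv)
    also have "\<dots> = (\<Sum>A\<leftarrow>As. length (block_word A) + 1)"
      by (induction As) simp_all
    also have "\<dots> = (\<Sum>A\<in>L. length (block_word A) + 1)"
      using As by (simp add: sum_list_distinct_conv_sum_set)
    also have "\<dots> = (\<Sum>A\<in>L. card A)"
    proof (rule sum.cong)
      fix A assume "A \<in> L"
      then have "card A > 0" using LD(2,3) by (simp add: card_gt_0_iff)
      then show "length (block_word A) + 1 = card A"
        by (simp add: block_word_def)
    qed simp
    finally show ?thesis .
  qed
  also have "(\<Sum>A\<in>L. card A) = card (\<Union>L)"
    using LD(2,4) by (intro card_Union_disjoint [symmetric]) (auto simp: pairwise_def disjnt_iff)
  also have "\<Union>L = {..<n}"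
    using L partition_onD1 by (auto simp: noncrossing_partition_def)
  finally show ?thesis
    using len_word [OF As(3)] As(4) by simp
qed

lemma partition_word_perm:
  assumes L: "noncrossing_partition n L" and As: "distinct As" "set As = L" and A: "A \<in> L"
    and v: "v \<in> A"
  shows "word_perm (partition_word As) v = word_perm (block_word A) v"
proof -
  note LD = noncrossing_partitionD [OF L]
  obtain us vs where uv: "As = us @ A # vs"
    using A As(2) by (metis split_list)
  have fixed: "word_perm (partition_word Bs) w = w"
    if Bs: "set Bs \<subseteq> L" "A \<notin> set Bs" "w \<in> A" for Bs w
  proof (rule word_perm_fixes)
    fix i j assume "(i, j) \<in> set (partition_word Bs)"
    then obtain B where B: "B \<in> set Bs" "(i, j) \<in> set (block_word B)"
      by (auto simp: partition_word_def)
    then have "i \<in> B" "j \<in> B" "B \<in> L" "B \<noteq> A"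
      using block_word_subset [of i j B] LD(2) [of B] Bs by auto
    then show "w \<noteq> i \<and> w \<noteq> j"
      using LD(4) [of B A] A Bs(3) by auto
  qed
  have "word_perm (block_word A) v \<in> A"
  proof -
    have "word_perm (block_word A) ` A \<subseteq> A"
    proof
      have "word_perm ws w \<in> A" if "set ws \<subseteq> A \<times> A" "w \<in> A" for ws w
        using that
      proof (induction ws arbitrary: w)
        case (Cons a ws)
        then show ?case by (cases a) (auto simp: swap_def)
      qed simp
      moreover have "set (block_word A) \<subseteq> A \<times> A"
        using block_word_subset [of _ _ A] LD(2) [OF A] by auto
      ultimately show "w \<in> A" if "w \<in> word_perm (block_word A) ` A" for w
        using that by auto
    qed
    then show ?thesis using v by blast
  qed
  moreover have "word_perm (partition_word As) v =
      word_perm (partition_word vs) (word_perm (block_word A) (word_perm (partition_word us) v))"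
    unfolding uv by (simp add: partition_word_def)
  moreover have "set us \<subseteq> L" "set vs \<subseteq> L" "A \<notin> set us" "A \<notin> set vs"
    using As uv by auto
  ultimately show ?thesis
    using fixed v by simp
qed

lemma divides_refines:
  assumes L: "noncrossing_partition n L" and M: "noncrossing_partition n M"
    and ws: "set ws \<subseteq> letters n" and eq: "partition_prod L \<otimes> word_prod ws = partition_prod M"
  shows "refines L M"
proof -
  note LD = noncrossing_partitionD [OF L] and MD = noncrossing_partitionD [OF M]
  obtain As where As: "distinct As" "set As = L" "set (partition_word As) \<subseteq> letters n"
      "partition_prod L = word_prod (partition_word As)"
    using partition_listing [OF L] by blast
  obtain Bs where Bs: "distinct Bs" "set Bs = M" "set (partition_word Bs) \<subseteq> letters n"
      "partition_prod M = word_prod (partition_word Bs)"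
    using partition_listing [OF M] by blast
  let ?W = "partition_word As @ ws"
  have W: "set ?W \<subseteq> letters n" "word_prod ?W = word_prod (partition_word Bs)"
    using As Bs ws eq by (auto simp: word_prod_append)
  have perm: "word_perm ?W v = word_perm (partition_word Bs) v" if "v < n" for v
    using \<phi>_word [OF W(1) that] \<phi>_word [OF Bs(3) that] W(2) by simp
  define g where "g = (\<lambda>v. THE B. B \<in> M \<and> v \<in> B)"
  have g: "g v = B" if "B \<in> M" "v \<in> B" for v B
    unfolding g_def by (rule the_equality) (use that MD(4) [of _ B v] in blast)+
  have gM: "g v \<in> M" "v \<in> g v" if "v < n" for v
    using MD(7) [OF that] g by auto
  have card: "card (g ` {..<n}) + length ?W \<le> n"
  proof -
    have "card (g ` {..<n}) \<le> card M"
      using gM MD(6) by (intro card_mono) auto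
    \<comment> \<open>The length homomorphism turns the equation in the group into a count of
      letters, and so supplies the bound for the orbit argument.\<close>
    moreover have "int (length ?W) = int n - int (card M)"
      using len_word [OF W(1)] W(2) Bs(4) len_partition_prod [OF M] by simp
    ultimately show ?thesis by linarith
  qed
  \<comment> \<open>The word of a block carries each element to its predecessor in the block, so
    every block of \<open>M\<close> is a single orbit.\<close>
  have orbits: "f v = f w"
    if f: "\<And>v. v < n \<Longrightarrow> f (word_perm ?W v) = f v" and vw: "v < n" "w < n" "g v = g w"
    for f :: "nat \<Rightarrow> nat" and v w
  proof -
    let ?B = "g v"
    let ?xs = "sorted_list_of_set ?B"
    have B: "?B \<in> M" "v \<in> ?B" "w \<in> ?B"
      using gM vw by auto
    have set: "set ?xs = ?B"
      using MD(2) [OF B(1)] by simp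
    have step: "f (?xs ! Suc k) = f (?xs ! k)" if k: "Suc k < length ?xs" for k
    proof -
      have x: "?xs ! Suc k \<in> ?B"
        using nth_mem [OF k] set by blast
      then have "?xs ! Suc k < n"
        using MD(1) [OF B(1)] by blast
      then have "f (?xs ! Suc k) = f (word_perm (partition_word Bs) (?xs ! Suc k))"
        using f perm by metis
      also have "\<dots> = f (word_perm (block_word ?B) (?xs ! Suc k))"
        using partition_word_perm [OF M Bs(1,2) B(1) x] by simp
      also have "\<dots> = f (?xs ! k)"
        using word_perm_zip_nth [of ?xs k] k by (simp add: block_word_def)
      finally show ?thesis .
    qed
    have const: "f (?xs ! k) = f (?xs ! 0)" if "k < length ?xs" for k
      using that by (induction k) (use step in auto)
    have "f x = f (?xs ! 0)" if "x \<in> ?B" for x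
      using that set const by (metis in_set_conv_nth)
    then show ?thesis using B by metis
  qed
  have letter: "g i = g j" if "(i, j) \<in> set ?W" for i j
    by (rule word_letters_in_orbits [OF W(1) card _ that]) (rule orbits)
  show ?thesis
    unfolding refines_def
  proof
    fix A assume A: "A \<in> L"
    let ?xs = "sorted_list_of_set A"
    have set: "set ?xs = A"
      using LD(2) [OF A] by simp
    have step: "g (?xs ! Suc k) = g (?xs ! k)" if k: "Suc k < length ?xs" for k
    proof -
      have "(?xs ! k, ?xs ! Suc k) \<in> set (block_word A)"
        using k unfolding block_word_def by (auto simp: in_set_zip nth_tl intro!: exI [of _ k])
      then have "(?xs ! k, ?xs ! Suc k) \<in> set ?W"
        using A As(2) by (auto simp: partition_word_def)
      then show ?thesis using letter by simp
    qed
    have const: "g (?xs ! k) = g (?xs ! 0)" if "k < length ?xs" for k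
      using that by (induction k) (use step in auto)
    have all: "g x = g (?xs ! 0)" if "x \<in> A" for x
      using that set const by (metis in_set_conv_nth)
    obtain a where a: "a \<in> A" using LD(3) [OF A] by blast
    have "x \<in> g a" if "x \<in> A" for x
      using that all [OF a] all [OF that] gM(2) [of x] LD(1) [OF A] by auto
    moreover have "g a \<in> M"
      using gM a LD(1) [OF A] by auto
    ultimately show "\<exists>B\<in>M. A \<subseteq> B" by blast
  qed
qed

lemma delta_perm: "t < n \<Longrightarrow> word_perm (block_word {..<n}) t = rotation n t"
proof -
  assume t: "t < n"
  have xs: "sorted_list_of_set {..<n} = [0..<n]"
    by (simp add: lessThan_atLeast0)
  show ?thesis
  proof (cases t)
    case 0
    have "[0..<n] = 0 # [1..<n]"
      using n_pos by (simp add: upt_conv_Cons)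
    then have "word_perm (zip [0..<n] (tl [0..<n])) 0 = last [0..<n]"
      using word_perm_zip_hd [of 0 "[1..<n]"] by (metis distinct_upt list.sel(3))
    then show ?thesis
      using 0 n_pos by (simp add: block_word_def xs rotation_def)
  next
    case (Suc k)
    then show ?thesis
      using word_perm_zip_nth [of "[0..<n]" k] t by (simp add: block_word_def xs rotation_def)
  qed
qed

text \<open>Reading the word of a factor letter by letter, every letter \<open>(i, j)\<close> merges two blocks: by
  \<open>rotation_word_chords\<close>, applied to each pair of neighbours in a block, \<open>i\<close> and \<open>j\<close> lie on the same
  side of every chord of the partition reached so far.\<close>

lemma delta_factor:
  assumes "set ys \<subseteq> letters n" "set ws \<subseteq> letters n" "set zs \<subseteq> letters n"
    "word_prod ys \<otimes> word_prod ws \<otimes> word_prod zs = \<delta>"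
  shows "\<exists>L. noncrossing_partition n L \<and> word_prod ws = partition_prod L"
  using assms(2,3,4)
proof (induction ws arbitrary: zs rule: rev_induct)
  case Nil
  \<comment> \<open>The empty word is the product over the partition into singletons, all of whose
    block words are empty.\<close>
  define L where "L = (\<lambda>v. {v}) ` {..<n}"
  have L: "noncrossing_partition n L"
    unfolding noncrossing_partition_def L_def
    using partition_on_singletons [of "{..<n}"] by (auto simp: noncrossing_def)
  obtain As where As: "distinct As" "set As = L" "partition_prod L = word_prod (partition_word As)"
    using partition_listing [OF L] by blast
  have "partition_word As = []"
    using As(2) by (auto simp: partition_word_def L_def block_word_def)
  then show ?case
    using L As by (intro exI [of _ L]) simp
next
  case (snoc w ws)
  obtain i j where w: "w = (i, j)" by (cases w)
  have ij: "i < n" "j < n" "i \<noteq> j" and ws: "set ws \<subseteq> letters n"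
    using snoc.prems w by (auto simp: letters_def)
  have zs: "set ((i, j) # zs) \<subseteq> letters n"
    using snoc.prems ij by (simp add: letters_def)
  \<comment> \<open>The last letter is handed over to the right cofactor, so that the induction
    hypothesis applies to \<open>ws\<close>.\<close>
  have "word_prod ys \<otimes> word_prod ws \<otimes> word_prod ((i, j) # zs) = \<delta>"
    using snoc.prems w ws ij assms(1) by (simp add: word_prod_append m_assoc d_closed)
  then obtain L where L: "noncrossing_partition n L" "word_prod ws = partition_prod L"
    using snoc.IH [OF ws zs] by blast
  note LD = noncrossing_partitionD [OF L(1)]
  obtain As where As: "distinct As" "set As = L" "set (partition_word As) \<subseteq> letters n"
      "partition_prod L = word_prod (partition_word As)"
    using partition_listing [OF L(1)] by blast
  let ?W = "ys @ partition_word As @ (i, j) # zs"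
  have W: "set ?W \<subseteq> letters n"
    using assms(1) As(3) zs by auto
  have "word_prod ?W = \<delta>"
    using assms(1) As zs L(2) \<open>word_prod ys \<otimes> word_prod ws \<otimes> word_prod ((i, j) # zs) = \<delta>\<close>
      word_prod_closed [OF zs]
    by (simp add: word_prod_append m_assoc)
  then have eq: "word_prod ?W = word_prod (block_word {..<n})"
    by (simp add: block_prod_word)
  have perm: "word_perm ?W t = rotation n t" if "t < n" for t
    using \<phi>_word [OF W that] \<phi>_word [OF block_word_letters that, of "{..<n}"] eq delta_perm [OF that] by simp
  have length: "length ?W < n"
    using len_word [OF W] len_word [OF block_word_letters, of "{..<n}"] eq n_pos
    by (simp add: block_word_def)
  have sep: "u \<le> i \<and> i < v \<longleftrightarrow> u \<le> j \<and> j < v" if C: "C \<in> L" and uv: "u \<in> C" "v \<in> C" "u < v" for C u v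
  proof -
    let ?P = "\<lambda>u v. u < v \<and> (u \<le> i \<and> i < v \<longleftrightarrow> u \<le> j \<and> j < v)"
    let ?xs = "sorted_list_of_set C"
    have set: "set ?xs = C" and sorted: "sorted_wrt (<) ?xs"
      using LD(2) [OF C] by simp_all
    \<comment> \<open>For \<open>u < v < w\<close> the interval from \<open>u\<close> to
      \<open>w\<close> is the disjoint union of the half-open intervals from \<open>u\<close> to
      \<open>v\<close> and from \<open>v\<close> to \<open>w\<close>. Hence neighbours in the block
      suffice, and only their chords are letters of the word.\<close>
    have "transp ?P"
      by (rule transpI) (metis le_less_trans less_le_trans less_trans not_le order_le_less)
    moreover have "?P (?xs ! k) (?xs ! Suc k)" if k: "Suc k < length ?xs" for k
    proof -
      have lt: "?xs ! k < ?xs ! Suc k"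
        using sorted k by (simp add: sorted_wrt_nth_less)
      have "(?xs ! k, ?xs ! Suc k) \<in> set (block_word C)"
        using k unfolding block_word_def by (auto simp: in_set_zip nth_tl intro!: exI [of _ k])
      then have "(?xs ! k, ?xs ! Suc k) \<in> set (partition_word As)"
        using C As(2) by (auto simp: partition_word_def)
      then obtain w1 w2 where w12: "partition_word As = w1 @ (?xs ! k, ?xs ! Suc k) # w2"
        by (meson split_list)
      then have "?W = (ys @ w1) @ (?xs ! k, ?xs ! Suc k) # w2 @ (i, j) # zs"
        by simp
      then show ?thesis
        using rotation_word_chords [of "ys @ w1" "?xs ! k" "?xs ! Suc k" w2 i j zs n] W perm length lt
        by simp
    qed
    ultimately have P: "sorted_wrt ?P ?xs"
      by (simp add: sorted_wrt_iff_nth_Suc_transp)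
    obtain a b where ab: "a < length ?xs" "?xs ! a = u" "b < length ?xs" "?xs ! b = v"
      using uv set by (metis in_set_conv_nth)
    then have "a < b"
      using sorted uv(3) by (metis linorder_neqE_nat not_less_iff_gr_or_eq sorted_wrt_nth_less)
    then show ?thesis
      using sorted_wrt_nth_less [OF P _ ab(3)] ab by auto
  qed
  then have same: "same_sides L i j"
    by (simp add: same_sides_def)
  obtain A B where AB: "A \<in> L" "i \<in> A" "B \<in> L" "j \<in> B"
    using LD(7) [OF ij(1)] LD(7) [OF ij(2)] by auto
  \<comment> \<open>In a common block the chord of \<open>i\<close> and \<open>j\<close> itself
    would contain the smaller one in its half-open interval but not the larger.\<close>
  have "A \<noteq> B"
  proof
    assume "A = B"
    then show False
      using same_sidesD [OF same AB(1), of i j] same_sidesD [OF same AB(1), of j i] AB ij(3) by (auto simp: nat_neq_iff)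
  qed
  have "word_prod (ws @ [w]) = partition_prod L \<otimes> d i j"
    using w ws zs L ij by (simp add: word_prod_append d_closed letters_def)
  also have "\<dots> = partition_prod (merge L A B)"
    by (rule partition_prod_merge [OF L(1) AB(1,3) \<open>A \<noteq> B\<close> AB(2,4) same])
  finally show ?case
    using noncrossing_partition_merge [OF L(1) AB(1,3,2,4) same] by blast
qed

section \<open>The factors of \<open>\<delta>\<close>\<close>

abbreviation P where "P \<equiv> partition_prod ` {L. noncrossing_partition n L}"

lemma P_word:
  assumes "a \<in> P"
  obtains ws where "set ws \<subseteq> letters n" "a = word_prod ws"
  using assms partition_listing by blast

lemma P_divides_delta:
  assumes "a \<in> P"
  obtains ws where "set ws \<subseteq> letters n" "a \<otimes> word_prod ws = \<delta>"
proof -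
  obtain L where L: "noncrossing_partition n L" "a = partition_prod L"
    using assms by blast
  then show thesis
    using refines_divides [OF L(1) noncrossing_partition_top [OF n_pos] refines_top [OF L(1)]]
      partition_prod_top that by auto
qed

text \<open>From right to left, the cofactor given by \<open>refines_divides\<close> is so far only
  a word. It sits inside a factorization of \<open>\<delta>\<close> into words, and so
  \<open>delta_factor\<close> makes it the product of a partition.\<close>

lemma divides_iff_refines:
  assumes L: "noncrossing_partition n L" and M: "noncrossing_partition n M"
  shows "inv (partition_prod L) \<otimes> partition_prod M \<in> P \<longleftrightarrow> refines L M"
proof
  assume "inv (partition_prod L) \<otimes> partition_prod M \<in> P"
  then obtain ws where "set ws \<subseteq> letters n" "inv (partition_prod L) \<otimes> partition_prod M = word_prod ws"
    using P_word by metis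
  then show "refines L M"
    using L M by (intro divides_refines [of L M ws]) (auto simp flip: \<open>_ = word_prod ws\<close>)
next
  assume "refines L M"
  then obtain ws where ws: "set ws \<subseteq> letters n" "partition_prod L \<otimes> word_prod ws = partition_prod M"
    using refines_divides [OF L M] by blast
  obtain ys where ys: "set ys \<subseteq> letters n" "partition_prod L = word_prod ys"
    using P_word [of "partition_prod L"] L by blast
  obtain zs where zs: "set zs \<subseteq> letters n" "partition_prod M \<otimes> word_prod zs = \<delta>"
    using P_divides_delta [of "partition_prod M"] M by blast
  have "word_prod ys \<otimes> word_prod ws \<otimes> word_prod zs = \<delta>"
    using ws ys zs by simp
  then have "word_prod ws \<in> P"
    using delta_factor [OF ys(1) ws(1) zs(1)] by blast
  moreover have "inv (partition_prod L) \<otimes> partition_prod M = word_prod ws"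
    using ws L by (simp flip: ws(2))
  ultimately show "inv (partition_prod L) \<otimes> partition_prod M \<in> P" by simp
qed

lemma garside_factors: "garside_factors G P \<delta> len"
proof unfold_locales
  have "{L. noncrossing_partition n L} \<subseteq> Pow (Pow {..<n})"
    using noncrossing_partitionD(1) by auto
  then show "finite P"
    using finite_subset by auto
  show sub: "P \<subseteq> carrier G"
    by auto
  obtain zs where zs: "set zs \<subseteq> letters n" "\<delta> = word_prod zs"
    using block_prod_word block_word_letters by blast
  have P_mem: "word_prod ws \<in> P" if "set ys \<subseteq> letters n" "set ws \<subseteq> letters n" "set zs \<subseteq> letters n"
    "word_prod ys \<otimes> word_prod ws \<otimes> word_prod zs = \<delta>" for ys ws zs
    using delta_factor [OF that] by blast
  show "\<one> \<in> P"
    using P_mem [of "[]" "[]" zs] zs by simp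
  show "\<delta> \<in> P"
    using noncrossing_partition_top [OF n_pos] partition_prod_top by force
  show "len (x \<otimes> y) = len x + len y" if "x \<in> carrier G" "y \<in> carrier G" for x y
    using that by (rule len_mult)
  show "0 < len a" if "a \<in> P" "a \<noteq> \<one>" for a
  proof -
    obtain ws where "set ws \<subseteq> letters n" "a = word_prod ws"
      using P_word \<open>a \<in> P\<close> by metis
    then show ?thesis
      using len_word \<open>a \<noteq> \<one>\<close> by auto
  qed
  show "inv a \<otimes> \<delta> \<in> P" if "a \<in> P" for a
    using that divides_iff_refines noncrossing_partition_top [OF n_pos] refines_top partition_prod_top
    by (smt (verit) image_iff mem_Collect_eq)
  \<comment> \<open>Since \<open>abc\<close> divides \<open>\<delta>\<close>, both \<open>ab\<close>
    and \<open>bc\<close> are values of consecutive letters in a word for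
    \<open>\<delta>\<close>.\<close>
  show "b \<otimes> c \<in> P" "a \<otimes> b \<in> P"
    if abc: "a \<in> P" "b \<in> P" "c \<in> P" "a \<otimes> b \<otimes> c \<in> P" for a b c
  proof -
    obtain as where as: "set as \<subseteq> letters n" "a = word_prod as"
      using P_word [OF abc(1)] .
    obtain bs where bs: "set bs \<subseteq> letters n" "b = word_prod bs"
      using P_word [OF abc(2)] .
    obtain cs where cs: "set cs \<subseteq> letters n" "c = word_prod cs"
      using P_word [OF abc(3)] .
    obtain zs where zs: "set zs \<subseteq> letters n" "a \<otimes> b \<otimes> c \<otimes> word_prod zs = \<delta>"
      using P_divides_delta [OF abc(4)] .
    show "b \<otimes> c \<in> P"
      using P_mem [of as "bs @ cs" zs] as bs cs zs by (simp add: word_prod_append m_assoc)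
    show "a \<otimes> b \<in> P"
      using P_mem [of "[]" "as @ bs" "cs @ zs"] as bs cs zs by (simp add: word_prod_append m_assoc)
  qed
  fix a b assume "a \<in> P" "b \<in> P"
  then obtain L M where L: "noncrossing_partition n L" "a = partition_prod L"
      and M: "noncrossing_partition n M" "b = partition_prod M"
    by blast
  have LM: "noncrossing_partition n (meet L M)"
    using noncrossing_partition_meet L M by blast
  show "\<exists>g\<in>P. inv g \<otimes> a \<in> P \<and> inv g \<otimes> b \<in> P \<and>
      (\<forall>h\<in>P. inv h \<otimes> a \<in> P \<and> inv h \<otimes> b \<in> P \<longrightarrow> inv h \<otimes> g \<in> P)"
  proof (intro bexI [of _ "partition_prod (meet L M)"] conjI ballI impI)
    show "inv (partition_prod (meet L M)) \<otimes> a \<in> P" "inv (partition_prod (meet L M)) \<otimes> b \<in> P"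
      using divides_iff_refines [OF LM] L M refines_meet by auto
    fix h assume "h \<in> P" "inv h \<otimes> a \<in> P \<and> inv h \<otimes> b \<in> P"
    then show "inv h \<otimes> partition_prod (meet L M) \<in> P"
      using divides_iff_refines L M LM refines_meetI by (smt (verit) image_iff mem_Collect_eq)
  qed (use LM in blast)
qed

end

section \<open>The fundamental group\<close>

lemma loop_homotopyI:
  fixes h :: "real \<times> real \<Rightarrow> 'a"
  assumes "continuous_map (top_of_set ({0..1} \<times> {0..1})) X h"
    and "\<And>t. t \<in> {0..1} \<Longrightarrow> h (0, t) = p t" "\<And>t. t \<in> {0..1} \<Longrightarrow> h (1, t) = q t"
    and "\<And>s. s \<in> {0..1} \<Longrightarrow> h (s, 0) = x" "\<And>s. s \<in> {0..1} \<Longrightarrow> h (s, 1) = x"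
  shows "(p, q) \<in> loop_homotopy X x"
proof -
  have "homotopic_with (\<lambda>r. r 0 = x \<and> r 1 = x) (top_of_set {0..1}) X p q"
    using assms
    by (subst homotopic_with) (auto intro!: exI [of _ h])
  then show ?thesis by (simp add: loop_homotopy_def)
qed

lemma loop_homotopyE:
  assumes "(p, q) \<in> loop_homotopy X x"
  obtains h :: "real \<times> real \<Rightarrow> 'a" where "continuous_map (top_of_set ({0..1} \<times> {0..1})) X h"
    "\<forall>t. h (0, t) = p t" "\<forall>t. h (1, t) = q t" "\<forall>s\<in>{0..1}. h (s, 0) = x \<and> h (s, 1) = x"
  using assms that by (auto simp: loop_homotopy_def homotopic_with_def)

lemma equiv_loop_homotopy: "equiv (loops_at X x) (loop_homotopy X x)"
proof (rule equivI)
  show "loop_homotopy X x \<subseteq> loops_at X x \<times> loops_at X x"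
    by (auto simp: loop_homotopy_def loops_at_def pathin_def
        dest: homotopic_with_imp_continuous_maps homotopic_with_imp_property)
  show "refl_on (loops_at X x) (loop_homotopy X x)"
    by (auto simp: refl_on_def loop_homotopy_def loops_at_def pathin_def homotopic_with_refl)
  show "sym (loop_homotopy X x)"
    by (auto simp: sym_def loop_homotopy_def homotopic_with_sym)
  show "trans (loop_homotopy X x)"
    unfolding trans_def loop_homotopy_def by (blast intro: homotopic_with_trans)
qed

lemma loop_homotopy_loops:
  "(p, q) \<in> loop_homotopy X x \<Longrightarrow> p \<in> loops_at X x \<and> q \<in> loops_at X x"
  using equiv_loop_homotopy [of X x] by (auto simp: equiv_def)

text \<open>This is the source of the explicit homotopies of the group laws and the braid relations:
  two paths in a convex parameter set with common ends are joined by straight lines, and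
  \<open>F\<close> carries the result to \<open>X\<close>. Intervals serve for reparametrization, a
  square and a triangle for the braid relations.\<close>

lemma loop_homotopy_convex:
  fixes S :: "'b::real_normed_vector set"
  assumes S: "convex S" and F: "continuous_map (top_of_set S) X F"
    and p: "continuous_on {0..1} p" "p \<in> {0..1} \<rightarrow> S" and q: "continuous_on {0..1} q" "q \<in> {0..1} \<rightarrow> S"
    and ends: "p 0 = q 0" "p 1 = q 1" "F (p 0) = x" "F (p 1) = x"
  shows "(\<lambda>t. F (p t), \<lambda>t. F (q t)) \<in> loop_homotopy X x"
proof (rule loop_homotopyI)
  define k where "k = (\<lambda>(s, t). (1 - s) *\<^sub>R p t + s *\<^sub>R q t)"
  have "continuous_on ({0..1} \<times> {0..1}) k"
    unfolding k_def case_prod_unfold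
    by (intro continuous_intros continuous_on_compose2 [OF p(1)] continuous_on_compose2 [OF q(1)]) auto
  moreover have "k \<in> {0..1} \<times> {0..1} \<rightarrow> S"
    using p(2) q(2) S by (auto simp: k_def Pi_iff intro!: convexD_alt)
  ultimately have "continuous_map (top_of_set ({0..1} \<times> {0..1})) (top_of_set S) k"
    by (simp add: image_subset_iff_funcset)
  then show "continuous_map (top_of_set ({0..1} \<times> {0..1})) X (F \<circ> k)"
    using F by (rule continuous_map_compose)
  show "(F \<circ> k) (0, t) = F (p t)" "(F \<circ> k) (1, t) = F (q t)" for t
    by (simp_all add: k_def)
  show "(F \<circ> k) (s, 0) = x" "(F \<circ> k) (s, 1) = x" for s
    using ends by (simp_all add: k_def flip: scaleR_add_left)
qed

lemma loop_homotopy_reparametrize: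
  assumes p: "p \<in> loops_at X x"
    and f: "continuous_on {0..1} f" "f \<in> {0..1} \<rightarrow> {0..1}" and g: "continuous_on {0..1} g" "g \<in> {0..1} \<rightarrow> {0..1}"
    and "f 0 = g 0" "f 1 = g 1" "f 0 \<in> {0, 1}" "f 1 \<in> {0, 1}"
  shows "(\<lambda>t. p (f t), \<lambda>t. p (g t)) \<in> loop_homotopy X x"
  using p assms by (intro loop_homotopy_convex [of "{0..1}"]) (auto simp: loops_at_def pathin_def)

lemma continuous_on_cases_half:
  fixes f g :: "real \<Rightarrow> 'a::topological_space"
  assumes "continuous_on {..1/2} f" "continuous_on {1/2..} g" "f (1/2) = g (1/2)"
  shows "continuous_on A (\<lambda>t. if t \<le> 1/2 then f t else g t)"
proof -
  have "continuous_on ({..1/2} \<union> {1/2..}) (\<lambda>t. if t \<le> 1/2 then f t else g t)"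
  proof (intro continuous_on_cases allI impI)
    fix t :: real assume "t \<in> {..1/2} \<and> \<not> t \<le> 1/2 \<or> t \<in> {1/2..} \<and> t \<le> 1/2"
    then have "t = 1/2" by auto
    show "f t = g t" unfolding \<open>t = 1/2\<close> by (rule assms(3))
  qed (use assms in auto)
  then show ?thesis
    by (rule continuous_on_subset) auto
qed

lemma continuous_map_join_square:
  fixes h k :: "real \<times> real \<Rightarrow> 'a"
  assumes h: "continuous_map (top_of_set ({0..1} \<times> {0..1})) X h"
    and k: "continuous_map (top_of_set ({0..1} \<times> {0..1})) X k"
    and eq: "\<And>s. s \<in> {0..1} \<Longrightarrow> h (s, 1) = k (s, 0)"
  shows "continuous_map (top_of_set ({0..1} \<times> {0..1})) X
    (\<lambda>(s, t). if t \<le> 1/2 then h (s, 2 * t) else k (s, 2 * t - 1))"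
proof -
  let ?Q = "{0..1::real} \<times> {0..1::real}"
  have "continuous_map (top_of_set ?Q) X
    (\<lambda>y. if snd y \<le> 1/2 then (h \<circ> (\<lambda>y. (fst y, 2 * snd y))) y
      else (k \<circ> (\<lambda>y. (fst y, 2 * snd y - 1))) y)"
  proof (rule continuous_map_cases_le)
    show "continuous_map (top_of_set ?Q) euclideanreal snd"
      by (simp add: continuous_on_snd)
    show "continuous_map (subtopology (top_of_set ?Q) {y \<in> topspace (top_of_set ?Q). snd y \<le> 1/2}) X
        (h \<circ> (\<lambda>y. (fst y, 2 * snd y)))"
      by (rule continuous_map_compose [OF _ h])
        (auto simp: subtopology_subtopology intro!: continuous_intros)
    show "continuous_map (subtopology (top_of_set ?Q) {y \<in> topspace (top_of_set ?Q). 1/2 \<le> snd y}) X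
        (k \<circ> (\<lambda>y. (fst y, 2 * snd y - 1)))"
      by (rule continuous_map_compose [OF _ k])
        (auto simp: subtopology_subtopology intro!: continuous_intros)
    fix y :: "real \<times> real" assume y: "y \<in> topspace (top_of_set ?Q)" "snd y = 1/2"
    then have "2 * snd y = 1" "fst y \<in> {0..1}" by auto
    then show "(h \<circ> (\<lambda>y. (fst y, 2 * snd y))) y = (k \<circ> (\<lambda>y. (fst y, 2 * snd y - 1))) y"
      using eq [of "fst y"] by (simp only: o_def diff_self)
  qed auto
  then show ?thesis
    by (simp only: case_prod_unfold o_def)
qed

lemma join_loops_homotopy:
  fixes X :: "'a topology"
  assumes "(p, p') \<in> loop_homotopy X x" "(q, q') \<in> loop_homotopy X x"
  shows "(join_loops p q, join_loops p' q') \<in> loop_homotopy X x"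
proof -
  obtain h :: "real \<times> real \<Rightarrow> 'a" where h: "continuous_map (top_of_set ({0..1} \<times> {0..1})) X h"
    "\<forall>t. h (0, t) = p t" "\<forall>t. h (1, t) = p' t" "\<forall>s\<in>{0..1}. h (s, 0) = x \<and> h (s, 1) = x"
    using assms(1) by (rule loop_homotopyE)
  obtain k :: "real \<times> real \<Rightarrow> 'a" where k: "continuous_map (top_of_set ({0..1} \<times> {0..1})) X k"
    "\<forall>t. k (0, t) = q t" "\<forall>t. k (1, t) = q' t" "\<forall>s\<in>{0..1}. k (s, 0) = x \<and> k (s, 1) = x"
    using assms(2) by (rule loop_homotopyE)
  show ?thesis
    by (rule loop_homotopyI [OF continuous_map_join_square [OF h(1) k(1)]])
      (use h k in \<open>auto simp: join_loops_def\<close>)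
qed

lemma join_loops_loop:
  assumes "p \<in> loops_at X x" "q \<in> loops_at X x"
  shows "join_loops p q \<in> loops_at X x"
  using join_loops_homotopy [of p p X x q q] equiv_loop_homotopy [of X x] assms loop_homotopy_loops
  by (metis equivE refl_onD)

lemma const_loop: "x \<in> topspace X \<Longrightarrow> (\<lambda>_. x) \<in> loops_at X x"
  by (simp add: loops_at_def pathin_def)

lemma loop_class_in_carrier:
  "p \<in> loops_at X x \<Longrightarrow> loop_class X x p \<in> carrier (fundamental_group X x)"
  by (auto simp: fundamental_group_def loop_class_def quotient_def)

lemma carrier_loop_class:
  assumes "A \<in> carrier (fundamental_group X x)"
  obtains p where "p \<in> loops_at X x" "A = loop_class X x p"
  using assms by (auto simp: fundamental_group_def loop_class_def quotient_def)

lemma loop_class_eq_iff: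
  "\<lbrakk>p \<in> loops_at X x; q \<in> loops_at X x\<rbrakk> \<Longrightarrow>
     loop_class X x p = loop_class X x q \<longleftrightarrow> (p, q) \<in> loop_homotopy X x"
  unfolding loop_class_def by (rule eq_equiv_class_iff [OF equiv_loop_homotopy])

lemma loop_class_eqI: "(p, q) \<in> loop_homotopy X x \<Longrightarrow> loop_class X x p = loop_class X x q"
  using loop_class_eq_iff loop_homotopy_loops by metis

lemma loop_class_mem: "q \<in> loop_class X x p \<longleftrightarrow> (p, q) \<in> loop_homotopy X x"
  by (simp add: loop_class_def)

lemma loop_class_mult:
  assumes "p \<in> loops_at X x" "q \<in> loops_at X x"
  shows "loop_class X x p \<otimes>\<^bsub>fundamental_group X x\<^esub> loop_class X x q = loop_class X x (join_loops p q)"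
proof -
  have refl: "p \<in> loop_class X x p" "q \<in> loop_class X x q"
    using assms equiv_loop_homotopy [of X x] by (auto simp: loop_class_mem equiv_def refl_on_def)
  moreover have "loop_class X x (join_loops p' q') = loop_class X x (join_loops p q)"
    if "p' \<in> loop_class X x p" "q' \<in> loop_class X x q" for p' q'
    using that loop_class_eqI [OF join_loops_homotopy] by (metis loop_class_mem)
  ultimately have "(\<Union>p'\<in>loop_class X x p. \<Union>q'\<in>loop_class X x q. loop_class X x (join_loops p' q')) =
      loop_class X x (join_loops p q)"
    by fast
  then show ?thesis
    by (simp add: fundamental_group_def)
qed

lemma fundamental_group_one: "\<one>\<^bsub>fundamental_group X x\<^esub> = loop_class X x (\<lambda>_. x)"
  by (simp add: fundamental_group_def)

lemma join_loops_assoc: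
  assumes "p \<in> loops_at X x" "q \<in> loops_at X x" "r \<in> loops_at X x"
  shows "(join_loops (join_loops p q) r, join_loops p (join_loops q r)) \<in> loop_homotopy X x"
proof -
  \<comment> \<open>The piecewise linear map with slopes 2, 1 and 1/2 that takes the breaks 1/4, 1/2
    to 1/2, 3/4; the minimum switches between its first two pieces at
    \<open>t = 1/4\<close>.\<close>
  define f :: "real \<Rightarrow> real" where
    "f t = (if t \<le> 1/2 then min (2 * t) (t + 1/4) else (t + 1) / 2)" for t
  have "(\<lambda>t. join_loops p (join_loops q r) (f t), \<lambda>t. join_loops p (join_loops q r) t) \<in> loop_homotopy X x"
    using assms unfolding f_def
    by (intro loop_homotopy_reparametrize join_loops_loop continuous_on_cases_half continuous_intros) auto
  moreover have "join_loops p (join_loops q r) (f t) = join_loops (join_loops p q) r t" for t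
    by (auto simp: join_loops_def f_def min_def field_simps intro!: arg_cong [of _ _ p] arg_cong [of _ _ q] arg_cong [of _ _ r])
  ultimately show ?thesis by simp
qed

theorem group_fundamental_group:
  assumes x: "x \<in> topspace X"
  shows "group (fundamental_group X x)"
proof (rule groupI)
  let ?G = "fundamental_group X x"
  fix A assume A: "A \<in> carrier ?G"
  obtain p where p: "p \<in> loops_at X x" "A = loop_class X x p"
    using A by (rule carrier_loop_class)
  have ends: "p 0 = x" "p 1 = x"
    using p(1) by (auto simp: loops_at_def)
  have "(\<lambda>t. p (if t \<le> 1/2 then 0 else 2 * t - 1), \<lambda>t. p t) \<in> loop_homotopy X x"
    using p(1) by (intro loop_homotopy_reparametrize continuous_on_cases_half continuous_intros) auto
  moreover have "(\<lambda>t. p (if t \<le> 1/2 then 0 else 2 * t - 1)) = join_loops (\<lambda>_. x) p"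
    by (auto simp: join_loops_def ends)
  ultimately have "(join_loops (\<lambda>_. x) p, p) \<in> loop_homotopy X x"
    by simp
  then have "loop_class X x (join_loops (\<lambda>_. x) p) = loop_class X x p"
    by (rule loop_class_eqI)
  then show "\<one>\<^bsub>?G\<^esub> \<otimes>\<^bsub>?G\<^esub> A = A"
    using p by (simp add: fundamental_group_one loop_class_mult const_loop x)
  define q where "q = (\<lambda>t. p (1 - t))"
  have q: "q \<in> loops_at X x"
  proof -
    have "(\<lambda>t. p (1 - t), \<lambda>t. p (1 - t)) \<in> loop_homotopy X x"
      using p(1) by (intro loop_homotopy_reparametrize continuous_intros) auto
    then show ?thesis
      unfolding q_def by (blast dest: loop_homotopy_loops)
  qed
  \<comment> \<open>Going back along \<open>p\<close> and forth again is \<open>p\<close> composed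
    with a path in \<open>{0..1}\<close> from 1 to 1, which contracts to the constant 1.\<close>
  have "(\<lambda>t. p (if t \<le> 1/2 then 1 - 2 * t else 2 * t - 1), \<lambda>t. p 1) \<in> loop_homotopy X x"
    using p(1) by (intro loop_homotopy_reparametrize continuous_on_cases_half continuous_intros) auto
  moreover have "(\<lambda>t. p (if t \<le> 1/2 then 1 - 2 * t else 2 * t - 1)) = join_loops q p"
    unfolding join_loops_def q_def by (simp only: if_distrib [of p])
  ultimately have "(join_loops q p, \<lambda>t. x) \<in> loop_homotopy X x"
    by (simp add: ends)
  then have "loop_class X x (join_loops q p) = loop_class X x (\<lambda>_. x)"
    by (rule loop_class_eqI)
  then have "loop_class X x q \<otimes>\<^bsub>?G\<^esub> A = \<one>\<^bsub>?G\<^esub>"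
    using p q by (simp add: fundamental_group_one loop_class_mult)
  then show "\<exists>B\<in>carrier ?G. B \<otimes>\<^bsub>?G\<^esub> A = \<one>\<^bsub>?G\<^esub>"
    by (rule bexI) (rule loop_class_in_carrier [OF q])
  fix B assume "B \<in> carrier ?G"
  then obtain q where q: "q \<in> loops_at X x" "B = loop_class X x q"
    by (rule carrier_loop_class)
  then show "A \<otimes>\<^bsub>?G\<^esub> B \<in> carrier ?G"
    using p by (simp add: loop_class_mult join_loops_loop loop_class_in_carrier)
  fix C assume "C \<in> carrier ?G"
  then obtain r where r: "r \<in> loops_at X x" "C = loop_class X x r"
    by (rule carrier_loop_class)
  show "A \<otimes>\<^bsub>?G\<^esub> B \<otimes>\<^bsub>?G\<^esub> C = A \<otimes>\<^bsub>?G\<^esub> (B \<otimes>\<^bsub>?G\<^esub> C)"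
    using p q r loop_class_eqI [OF join_loops_assoc [OF p(1) q(1) r(1)]]
    by (simp add: loop_class_mult join_loops_loop)
qed (simp add: fundamental_group_one const_loop x loop_class_in_carrier)

section \<open>Maps into configuration spaces\<close>

text \<open>Any bijection of \<open>I\<close> with \<open>{..<n}\<close> lifts the family to ordered
  configurations. In the applications \<open>I\<close> is the base configuration, each point being
  the label of the string that starts there.\<close>

lemma continuous_map_configuration_space:
  fixes f :: "'i \<Rightarrow> 'b::topological_space \<Rightarrow> complex"
  assumes I: "finite I" "card I = n"
    and cont: "\<And>i. i \<in> I \<Longrightarrow> continuous_on S (f i)"
    and inj: "\<And>q. q \<in> S \<Longrightarrow> inj_on (\<lambda>i. f i q) I"
  shows "continuous_map (top_of_set S) (configuration_space n) (\<lambda>q. (\<lambda>i. f i q) ` I)"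
proof -
  obtain h where h: "bij_betw h {..<n} I"
    using ex_bij_betw_nat_finite [OF I(1)] I(2) by (auto simp: atLeast0LessThan)
  define F where "F = (\<lambda>q. restrict (\<lambda>k. f (h k) q) {..<n})"
  have "continuous_map (top_of_set S) (product_topology (\<lambda>_. euclidean) {..<n}) F"
    unfolding continuous_map_componentwise F_def
    using cont h by (auto simp: bij_betw_def)
  moreover have "inj_on (F q) {..<n}" if "q \<in> S" for q
  proof -
    have "inj_on ((\<lambda>i. f i q) \<circ> h) {..<n}"
      using inj [OF that] h by (intro comp_inj_on) (auto simp: bij_betw_def)
    then show ?thesis
      by (auto simp: F_def inj_on_def)
  qed
  ultimately have "continuous_map (top_of_set S) (ordered_configuration_space n) F"
    by (auto simp: ordered_configuration_space_def continuous_map_in_subtopology)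
  then have "continuous_map (top_of_set S) (configuration_space n) ((\<lambda>z. z ` {..<n}) \<circ> F)"
    unfolding configuration_space_def
    by (rule continuous_map_compose [OF _ quotient_imp_continuous_map [OF quotient_map_quotient_topology]])
  moreover have "((\<lambda>z. z ` {..<n}) \<circ> F) q = (\<lambda>i. f i q) ` I" for q
  proof -
    have "(\<lambda>i. f i q) ` I = (\<lambda>i. f i q) ` h ` {..<n}"
      using h by (simp add: bij_betw_def)
    then show ?thesis
      by (simp add: F_def image_image)
  qed
  ultimately show ?thesis
    by (simp add: o_def)
qed

lemma continuous_map_ordered_configuration:
  "i < n \<Longrightarrow> continuous_map (ordered_configuration_space n) euclidean (\<lambda>z. z i)"
  unfolding ordered_configuration_space_def
  by (rule continuous_map_from_subtopology) (rule continuous_map_product_projection, simp)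

text \<open>The preimage in the ordered configurations is the union of the open conditions
  \<open>z i \<in> U\<close>. Sets of this kind give both the neighbourhoods and the continuity of
  the sheets in the covering below.\<close>

lemma openin_configuration_meets:
  assumes "open U"
  shows "openin (configuration_space n) {x \<in> topspace (configuration_space n). x \<inter> U \<noteq> {}}"
  unfolding configuration_space_def openin_quotient_topology
proof
  let ?X = "ordered_configuration_space n"
  let ?f = "\<lambda>z::nat \<Rightarrow> complex. z ` {..<n}"
  have "openin ?X (\<Union>i<n. {z \<in> topspace ?X. z i \<in> U})"
    using assms
    by (intro openin_Union) (auto intro!: openin_continuous_map_preimage continuous_map_ordered_configuration)
  moreover have "{z \<in> topspace ?X. ?f z \<in> {x \<in> topspace (quotient_topology ?X ?f). x \<inter> U \<noteq> {}}} =
      (\<Union>i<n. {z \<in> topspace ?X. z i \<in> U})"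
    by auto
  ultimately show "openin ?X {z \<in> topspace ?X. ?f z \<in> {x \<in> topspace (quotient_topology ?X ?f). x \<inter> U \<noteq> {}}}"
    by simp
qed auto

lemma openin_meets:
  assumes "continuous_map (top_of_set S) (configuration_space n) K" "open U"
  shows "openin (top_of_set S) {q \<in> S. K q \<inter> U \<noteq> {}}"
proof -
  have "openin (top_of_set S) {q \<in> topspace (top_of_set S).
      K q \<in> {x \<in> topspace (configuration_space n). x \<inter> U \<noteq> {}}}"
    using assms by (intro openin_continuous_map_preimage [OF assms(1)] openin_configuration_meets)
  moreover have "K q \<in> topspace (configuration_space n)" if "q \<in> S" for q
    using continuous_map_image_subset_topspace [OF assms(1)] that by auto
  ultimately show ?thesis
    by (simp add: Collect_conj_eq Int_absorb1 cong: conj_cong)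
qed

lemma finite_separated:
  fixes x :: "'a::metric_space set"
  assumes "finite x"
  obtains r where "r > 0" "\<forall>z\<in>x. \<forall>w\<in>x. z \<noteq> w \<longrightarrow> ball z r \<inter> ball w r = {}"
proof -
  \<comment> \<open>The extra 1 keeps the minimum meaningful when \<open>x\<close> has at most one
    point.\<close>
  define D where "D = insert 1 ((\<lambda>(z, w). dist z w) ` {(z, w) \<in> x \<times> x. z \<noteq> w})"
  have "finite {(z, w) \<in> x \<times> x. z \<noteq> w}"
    by (rule finite_subset [of _ "x \<times> x"]) (use assms in auto)
  then have D: "finite D" "D \<noteq> {}" "\<And>e. e \<in> D \<Longrightarrow> e > 0"
    by (auto simp: D_def)
  show thesis
  proof
    show "Min D / 2 > 0"
      using D by simp
    show "\<forall>z\<in>x. \<forall>w\<in>x. z \<noteq> w \<longrightarrow> ball z (Min D / 2) \<inter> ball w (Min D / 2) = {}"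
    proof (intro ballI impI)
      fix z w assume "z \<in> x" "w \<in> x" "z \<noteq> w"
      then have "Min D \<le> dist z w"
        using D by (intro Min_le) (auto simp: D_def)
      then show "ball z (Min D / 2) \<inter> ball w (Min D / 2) = {}"
        by (auto simp: disjoint_iff) (smt (verit) dist_commute dist_triangle field_sum_of_halves)
    qed
  qed
qed

section \<open>Lifting to strings\<close>

text \<open>The \<open>n\<close>-fold covering of the configuration space by pointed configurations is pulled back to
  the parameter space \<open>S\<close>, where the library's theory of covering spaces applies.\<close>

lemma configuration_covering_space:
  fixes S :: "'b::real_normed_vector set"
  assumes K: "continuous_map (top_of_set S) (configuration_space n) K" and n: "n > 0"
  shows "covering_space (SIGMA q:S. K q) fst S"
proof
  let ?E = "SIGMA q:S. K q"
  have K_card: "finite (K q)" "card (K q) = n" if "q \<in> S" for q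
    using continuous_map_image_subset_topspace [OF K] that
    by (auto simp: topspace_configuration_space)
  show "continuous_on ?E fst"
    by (intro continuous_intros)
  have "K q \<noteq> {}" if "q \<in> S" for q
    using K_card [OF that] n by auto
  then show "fst ` ?E = S"
    by force
  fix q0 assume q0: "q0 \<in> S"
  obtain r where "r > 0" "\<forall>z\<in>K q0. \<forall>w\<in>K q0. z \<noteq> w \<longrightarrow> ball z r \<inter> ball w r = {}"
    using finite_separated [OF K_card(1) [OF q0]] .
  then have r: "r > 0" "\<And>z w. \<lbrakk>z \<in> K q0; w \<in> K q0; z \<noteq> w\<rbrakk> \<Longrightarrow> ball z r \<inter> ball w r = {}"
    by blast+
  \<comment> \<open>Where \<open>K q\<close> meets all \<open>n\<close> disjoint balls it has
    exactly one point in each, because it has \<open>n\<close> points. These points label the sheets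
    over \<open>T\<close>.\<close>
  define T where "T = (\<Inter>z\<in>K q0. {q \<in> S. K q \<inter> ball z r \<noteq> {}})"
  have T_open: "openin (top_of_set S) T"
    unfolding T_def using K_card [OF q0] n openin_meets [OF K open_ball]
    by (intro openin_INT2) auto
  have TS: "T \<subseteq> S"
    using openin_imp_subset [OF T_open] .
  have q0T: "q0 \<in> T"
    unfolding T_def using q0 r(1) by auto
  have unique: "\<exists>f. bij_betw f (K q0) (K q) \<and> (\<forall>z\<in>K q0. K q \<inter> ball z r = {f z})" if q: "q \<in> T" for q
  proof -
    have "\<exists>w. w \<in> K q \<inter> ball z r" if "z \<in> K q0" for z
      using q that by (auto simp: T_def)
    then obtain f where f: "\<And>z. z \<in> K q0 \<Longrightarrow> f z \<in> K q \<inter> ball z r"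
      by metis
    have inj: "inj_on f (K q0)"
    proof (rule inj_onI)
      fix z w assume "z \<in> K q0" "w \<in> K q0" "f z = f w"
      moreover from this have "f z \<in> ball z r \<inter> ball w r"
        using f [of z] f [of w] by simp
      ultimately show "z = w"
        using r(2) [of z w] by blast
    qed
    moreover have "f ` K q0 \<subseteq> K q"
      using f by auto
    moreover have "card (K q0) = card (K q)" "finite (K q)"
      using K_card q TS q0 by auto
    ultimately have bij: "bij_betw f (K q0) (K q)"
      unfolding bij_betw_def by (metis card_image card_subset_eq)
    moreover have "K q \<inter> ball z r = {f z}" if z: "z \<in> K q0" for z
    proof
      show "K q \<inter> ball z r \<subseteq> {f z}"
      proof
        fix w assume w: "w \<in> K q \<inter> ball z r"
        then obtain z' where z': "z' \<in> K q0" "w = f z'"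
          using bij by (auto simp: bij_betw_def)
        then have "w \<in> ball z r \<inter> ball z' r"
          using f [of z'] w by simp
        then have "z' = z"
          using z' z r(2) [of z z'] by blast
        then show "w \<in> {f z}" using z' by simp
      qed
    qed (use f [OF z] in auto)
    ultimately show ?thesis by blast
  qed
  define V where "V = (\<lambda>z. {(q, w). q \<in> T \<and> w \<in> K q \<and> w \<in> ball z r})"
  show "\<exists>T. q0 \<in> T \<and> openin (top_of_set S) T \<and>
          (\<exists>v. \<Union>v = ?E \<inter> fst -` T \<and> (\<forall>u\<in>v. openin (top_of_set ?E) u) \<and>
               pairwise disjnt v \<and> (\<forall>u\<in>v. \<exists>q. homeomorphism u T fst q))"
  proof (intro exI [of _ T] exI [of _ "V ` K q0"] conjI ballI q0T T_open)
    show "\<Union>(V ` K q0) = ?E \<inter> fst -` T"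
    proof (intro equalityI subsetI)
      fix p assume "p \<in> \<Union>(V ` K q0)"
      then show "p \<in> ?E \<inter> fst -` T"
        using TS by (auto simp: V_def)
    next
      fix p assume p: "p \<in> ?E \<inter> fst -` T"
      obtain q w where qw: "p = (q, w)" "q \<in> T" "w \<in> K q"
        using p by auto
      obtain f where f: "bij_betw f (K q0) (K q)" "\<forall>z\<in>K q0. K q \<inter> ball z r = {f z}"
        using unique [OF qw(2)] by blast
      obtain z where z: "z \<in> K q0" "w = f z"
        using f(1) qw(3) by (auto simp: bij_betw_def)
      then have "w \<in> ball z r"
        using f(2) by blast
      then show "p \<in> \<Union>(V ` K q0)"
        using qw z by (auto simp: V_def)
    qed
    show "openin (top_of_set ?E) u" if u: "u \<in> V ` K q0" for u
    proof -
      obtain z where z: "z \<in> K q0" "u = V z" using u by blast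
      have "u = {p \<in> ?E. fst p \<in> T} \<inter> {p \<in> ?E. snd p \<in> ball z r}"
        using TS z by (auto simp: V_def)
      moreover have "openin (top_of_set ?E) {p \<in> ?E. fst p \<in> T}"
      proof -
        have "continuous_map (top_of_set ?E) (top_of_set S) fst"
          by (auto intro!: continuous_intros)
        from openin_continuous_map_preimage [OF this T_open] show ?thesis by simp
      qed
      moreover have "openin (top_of_set ?E) {p \<in> ?E. snd p \<in> ball z r}"
      proof -
        have "continuous_map (top_of_set ?E) euclidean snd"
          by (auto intro!: continuous_intros)
        from openin_continuous_map_preimage [OF this, of "ball z r"] show ?thesis by simp
      qed
      ultimately show ?thesis by (simp add: openin_Int)
    qed
    show "pairwise disjnt (V ` K q0)"
      unfolding pairwise_def disjnt_iff
    proof (intro ballI impI allI notI)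
      fix u v p assume "u \<in> V ` K q0" "v \<in> V ` K q0" "u \<noteq> v" "p \<in> u \<and> p \<in> v"
      then obtain z z' where z: "z \<in> K q0" "z' \<in> K q0" "u = V z" "v = V z'" "p \<in> V z" "p \<in> V z'"
        by blast
      then have "z \<noteq> z'" "snd p \<in> ball z r" "snd p \<in> ball z' r"
        using \<open>u \<noteq> v\<close> by (auto simp: V_def)
      with z(1,2) show False
        using r(2) [of z z'] by blast
    qed
    show "\<exists>g. homeomorphism u T fst g" if u: "u \<in> V ` K q0" for u
    proof -
      obtain z where z: "z \<in> K q0" "u = V z" using u by blast
      define s where "s = (\<lambda>q. THE w. w \<in> K q \<and> w \<in> ball z r)"
      have s: "K q \<inter> ball z r = {s q}" if q: "q \<in> T" for q
      proof -
        obtain f where "\<forall>z\<in>K q0. K q \<inter> ball z r = {f z}"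
          using unique [OF q] by (elim exE conjE)
        then have fz: "K q \<inter> ball z r = {f z}"
          using z(1) by (rule bspec)
        then have "(w \<in> K q \<and> w \<in> ball z r) = (w = f z)" for w
          by (metis Int_iff singleton_iff)
        then have "s q = f z"
          unfolding s_def by (simp only: the_eq_trivial)
        with fz show ?thesis by (simp only:)
      qed
      \<comment> \<open>\<open>s q \<in> U\<close> means that \<open>K q\<close> meets
        \<open>ball z r \<inter> U\<close>, which is an open condition on \<open>q\<close>.\<close>
      have "continuous_on T s"
        unfolding continuous_openin_preimage_eq
      proof (intro allI impI)
        fix U :: "complex set" assume "open U"
        then have "openin (top_of_set S) (T \<inter> {q \<in> S. K q \<inter> (ball z r \<inter> U) \<noteq> {}})"
          by (intro openin_Int T_open openin_meets [OF K]) auto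
        moreover have "T \<inter> {q \<in> S. K q \<inter> (ball z r \<inter> U) \<noteq> {}} = T \<inter> s -` U"
        proof (rule Set.set_eqI)
          fix q
          have "K q \<inter> (ball z r \<inter> U) \<noteq> {} \<longleftrightarrow> s q \<in> U" if "q \<in> T"
            unfolding Int_assoc [symmetric] s [OF that] by simp
          then show "q \<in> T \<inter> {q \<in> S. K q \<inter> (ball z r \<inter> U) \<noteq> {}} \<longleftrightarrow> q \<in> T \<inter> s -` U"
            using TS by auto
        qed
        ultimately show "openin (top_of_set T) (T \<inter> s -` U)"
          using TS by (metis Int_lower1 openin_subset_trans)
      qed
      moreover have "s q \<in> K q" "s q \<in> ball z r" if "q \<in> T" for q
        using s [OF that] by auto
      moreover have s_eq: "s q = w" if "q \<in> T" "w \<in> K q" "dist z w < r" for q w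
        using s [OF that(1)] that by (metis IntI mem_ball singletonD)
      ultimately have "homeomorphism u T fst (\<lambda>q. (q, s q))"
        unfolding z(2) by (intro homeomorphismI continuous_intros) (auto simp: V_def intro: s_eq)
      then show ?thesis by blast
    qed
  qed
qed

text \<open>A string over \<open>S\<close> is a section of the covering, that is, a lift of the
  identity. It exists because a convex set is simply connected and locally path connected.\<close>

lemma string_exists:
  fixes S :: "'b::real_normed_vector set"
  assumes K: "continuous_map (top_of_set S) (configuration_space n) K" and n: "n > 0"
    and S: "convex S" "q0 \<in> S" "w0 \<in> K q0"
  obtains g where "continuous_on S g" "\<And>q. q \<in> S \<Longrightarrow> g q \<in> K q" "g q0 = w0"
proof -
  obtain g where g: "continuous_on S g" "g \<in> S \<rightarrow> (SIGMA q:S. K q)" "g q0 = (q0, w0)"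
    "\<And>q. q \<in> S \<Longrightarrow> fst (g q) = id q"
  proof (rule covering_space_lift_strong [OF configuration_covering_space [OF K n]])
    show "(q0, w0) \<in> (SIGMA q:S. K q)" "q0 \<in> S" using S by auto
    show "simply_connected S" "locally path_connected S"
      using S(1) by (auto intro: convex_imp_simply_connected convex_imp_locally_path_connected)
    show "continuous_on S id" by (rule continuous_on_id')
  qed auto
  show thesis
  proof
    show "continuous_on S (snd \<circ> g)"
      using g(1) by (intro continuous_on_compose) (auto intro!: continuous_intros)
    show "(snd \<circ> g) q \<in> K q" if "q \<in> S" for q
      using g(2,4) that by (force simp: Pi_iff)
    show "(snd \<circ> g) q0 = w0"
      using g(3) by simp
  qed
qed

lemma string_unique:
  fixes S :: "'b::real_normed_vector set"
  assumes K: "continuous_map (top_of_set S) (configuration_space n) K" and n: "n > 0"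
    and S: "connected S" "q0 \<in> S" "q \<in> S"
    and g: "continuous_on S g" "\<And>q. q \<in> S \<Longrightarrow> g q \<in> K q"
    and h: "continuous_on S h" "\<And>q. q \<in> S \<Longrightarrow> h q \<in> K q" and eq: "g q0 = h q0"
  shows "g q = h q"
proof -
  have "(\<lambda>q. (q, g q)) q = (\<lambda>q. (q, h q)) q"
    by (rule covering_space_lift_unique [OF configuration_covering_space [OF K n], of _ q0 _ S id])
      (use S g h eq in \<open>auto intro!: continuous_intros\<close>)
  then show ?thesis by simp
qed

section \<open>Monodromy\<close>

definition string_end :: "(real \<Rightarrow> complex set) \<Rightarrow> complex \<Rightarrow> complex \<Rightarrow> bool" where
  "string_end p z w \<longleftrightarrow>
     (\<exists>g. continuous_on {0..1} g \<and> (\<forall>t\<in>{0..1}. g t \<in> p t) \<and> g 0 = z \<and> g 1 = w)"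

lemma string_end_join:
  assumes "string_end p z w" "string_end q w v"
  shows "string_end (join_loops p q) z v"
proof -
  obtain g where g: "continuous_on {0..1} g" "\<forall>t\<in>{0..1}. g t \<in> p t" "g 0 = z" "g 1 = w"
    using assms(1) by (auto simp: string_end_def)
  obtain h where h: "continuous_on {0..1} h" "\<forall>t\<in>{0..1}. h t \<in> q t" "h 0 = w" "h 1 = v"
    using assms(2) by (auto simp: string_end_def)
  have "path (g +++ h)"
    using g h by (intro path_join_imp) (auto simp: path_def pathfinish_def pathstart_def)
  then show ?thesis
    unfolding string_end_def using g h
    by (intro exI [of _ "g +++ h"]) (auto simp: path_def joinpaths_def join_loops_def)
qed

context
  fixes n :: nat and x :: "complex set"
  assumes x: "finite x" "card x = n" and n: "n > 0"
begin

lemma loop_continuous: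
  "p \<in> loops_at (configuration_space n) x \<Longrightarrow> continuous_map (top_of_set {0..1}) (configuration_space n) p"
  by (simp add: loops_at_def pathin_def)

lemma string_end_exists:
  assumes p: "p \<in> loops_at (configuration_space n) x" and "z \<in> x"
  shows "\<exists>w. string_end p z w"
proof -
  obtain g where "continuous_on {0..1} g" "\<And>t. t \<in> {0..1} \<Longrightarrow> g t \<in> p t" "g 0 = z"
    using string_exists [OF loop_continuous [OF p] n, of 0 z] assms by (auto simp: loops_at_def)
  then show ?thesis
    unfolding string_end_def by blast
qed

lemma string_end_unique:
  assumes p: "p \<in> loops_at (configuration_space n) x" and "string_end p z w" "string_end p z w'"
  shows "w = w'"
proof -
  obtain g where g: "continuous_on {0..1} g" "\<forall>t\<in>{0..1}. g t \<in> p t" "g 0 = z" "g 1 = w"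
    using assms(2) by (auto simp: string_end_def)
  obtain h where h: "continuous_on {0..1} h" "\<forall>t\<in>{0..1}. h t \<in> p t" "h 0 = z" "h 1 = w'"
    using assms(3) by (auto simp: string_end_def)
  have "g 1 = h 1"
    by (rule string_unique [OF loop_continuous [OF p] n, of 0]) (use g h in auto)
  then show ?thesis using g h by simp
qed

lemma string_end_in:
  assumes p: "p \<in> loops_at (configuration_space n) x" and "string_end p z w"
  shows "w \<in> x"
  using assms by (auto simp: string_end_def loops_at_def)

text \<open>Lift the whole homotopy over the square. Along the two sides on which it is the constant
  configuration \<open>x\<close>, the lift is a string of a constant family, hence constant by
  uniqueness; so the opposite edges have the same start and end.\<close>

lemma string_end_homotopic:
  assumes pq: "(p, q) \<in> loop_homotopy (configuration_space n) x" and p: "string_end p z w"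
  shows "string_end q z w"
proof -
  obtain h :: "real \<times> real \<Rightarrow> complex set"
    where h: "continuous_map (top_of_set ({0..1} \<times> {0..1})) (configuration_space n) h"
    "\<forall>t. h (0, t) = p t" "\<forall>t. h (1, t) = q t" "\<forall>s\<in>{0..1}. h (s, 0) = x \<and> h (s, 1) = x"
    using pq by (rule loop_homotopyE)
  have loops: "p \<in> loops_at (configuration_space n) x" "q \<in> loops_at (configuration_space n) x"
    using loop_homotopy_loops [OF pq] by auto
  have zx: "z \<in> x"
    using p loops by (auto simp: string_end_def loops_at_def)
  have conv: "convex ({0..1} \<times> {0..1} :: (real \<times> real) set)"
    by (intro convex_Times convex_real_interval)
  obtain g where g: "continuous_on ({0..1} \<times> {0..1}) g"
      "\<And>q. q \<in> {0..1} \<times> {0..1} \<Longrightarrow> g q \<in> h q" "g (0, 0) = z"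
    using string_exists [OF h(1) n conv, of "(0, 0)" z] h(2) loops zx by (auto simp: loops_at_def)
  have gx: "g (s, t) \<in> x" if "s \<in> {0..1}" "t \<in> {0, 1}" for s t
    using g(2) [of "(s, t)"] h(4) that by auto
  have side: "g (s, t) = g (0, t)" if "s \<in> {0..1}" "t \<in> {0, 1}" for s t
  proof -
    have "continuous_map (top_of_set {0..1::real}) (configuration_space n) (\<lambda>_. x)"
      using x by (simp add: topspace_configuration_space)
    then show ?thesis
    proof (rule string_unique [OF _ n, of "{0..1}" "\<lambda>_. x" 0 s "\<lambda>s. g (s, t)" "\<lambda>s. g (0, t)"])
      show "continuous_on {0..1} (\<lambda>s. g (s, t))"
        using that by (intro continuous_on_compose2 [OF g(1)] continuous_intros) auto
    qed (use that gx in auto)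
  qed
  have edge: "string_end (\<lambda>t. h (s, t)) (g (s, 0)) (g (s, 1))" if "s \<in> {0..1}" for s
    unfolding string_end_def using that g(2)
    by (intro exI [of _ "\<lambda>t. g (s, t)"] conjI continuous_on_compose2 [OF g(1)] continuous_intros) auto
  have "string_end p z (g (0, 1))"
    using edge [of 0] h(2) g(3) by simp
  then have "g (0, 1) = w"
    using string_end_unique [OF loops(1) _ p] by simp
  then show ?thesis
    using edge [of 1] side [of 1 0] side [of 1 1] h(3) g(3) by simp
qed

definition monodromy :: "(real \<Rightarrow> complex set) set \<Rightarrow> complex \<Rightarrow> complex" where
  "monodromy A z = (THE w. \<exists>p\<in>A. string_end p z w)"

lemma monodromy_eqI:
  assumes "p \<in> loops_at (configuration_space n) x" "string_end p z w"
  shows "monodromy (loop_class (configuration_space n) x p) z = w"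
  unfolding monodromy_def
proof (rule the_equality)
  have "p \<in> loop_class (configuration_space n) x p"
    unfolding loop_class_def using equiv_class_self [OF equiv_loop_homotopy assms(1)] .
  then show "\<exists>p\<in>loop_class (configuration_space n) x p. string_end p z w"
    using assms(2) by blast
  fix v assume "\<exists>q\<in>loop_class (configuration_space n) x p. string_end q z v"
  then obtain q where q: "(p, q) \<in> loop_homotopy (configuration_space n) x" "string_end q z v"
    by (auto simp: loop_class_mem)
  then have "string_end q z w"
    using string_end_homotopic assms(2) by blast
  then show "v = w"
    using string_end_unique [of q z v w] loop_homotopy_loops [OF q(1)] q(2) by simp
qed

lemma monodromy_mult:
  assumes A: "A \<in> carrier (fundamental_group (configuration_space n) x)"
    and B: "B \<in> carrier (fundamental_group (configuration_space n) x)" and z: "z \<in> x"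
  shows "monodromy (A \<otimes>\<^bsub>fundamental_group (configuration_space n) x\<^esub> B) z =
    monodromy B (monodromy A z)"
proof -
  obtain p where p: "p \<in> loops_at (configuration_space n) x" "A = loop_class (configuration_space n) x p"
    using A by (rule carrier_loop_class)
  obtain q where q: "q \<in> loops_at (configuration_space n) x" "B = loop_class (configuration_space n) x q"
    using B by (rule carrier_loop_class)
  obtain w where w: "string_end p z w"
    using string_end_exists [OF p(1) z] by blast
  then obtain v where v: "string_end q w v"
    using string_end_exists [OF q(1)] string_end_in [OF p(1)] by blast
  have "monodromy A z = w" "monodromy B w = v"
    using monodromy_eqI p q w v by auto
  moreover have "monodromy (loop_class (configuration_space n) x (join_loops p q)) z = v"
    using p q w v by (intro monodromy_eqI join_loops_loop string_end_join)
  ultimately show ?thesis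
    using p q by (simp add: loop_class_mult)
qed

lemma configuration_in_topspace: "x \<in> topspace (configuration_space n)"
  using x by (simp add: topspace_configuration_space)

lemma monodromy_one:
  "z \<in> x \<Longrightarrow> monodromy \<one>\<^bsub>fundamental_group (configuration_space n) x\<^esub> z = z"
  unfolding fundamental_group_one
  by (intro monodromy_eqI const_loop configuration_in_topspace)
    (auto simp: string_end_def intro!: exI [of _ "\<lambda>_. z"])

end

section \<open>Half twists\<close>

text \<open>The sum of the segment and a ball, hence a convex neighbourhood in which strings can be
  deformed along straight lines.\<close>

definition tube :: "complex \<Rightarrow> complex \<Rightarrow> real \<Rightarrow> complex set" where
  "tube a b e = (\<Union>s\<in>closed_segment a b. ball s e)"

lemma tubeI: "\<lbrakk>s \<in> closed_segment a b; norm v < e\<rbrakk> \<Longrightarrow> s + v \<in> tube a b e"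
  by (auto simp: tube_def dist_norm intro!: bexI [of _ s])

lemma convex_tube: "convex (tube a b e)"
proof -
  have "tube a b e = (\<Union>s\<in>closed_segment a b. \<Union>v\<in>ball 0 e. {s + v})"
  proof (intro equalityI subsetI)
    fix z assume "z \<in> tube a b e"
    then obtain s where "s \<in> closed_segment a b" "dist s z < e"
      by (auto simp: tube_def)
    then show "z \<in> (\<Union>s\<in>closed_segment a b. \<Union>v\<in>ball 0 e. {s + v})"
      by (intro UN_I [of s] UN_I [of "z - s"]) (auto simp: dist_norm norm_minus_commute)
  qed (auto intro: tubeI)
  then show ?thesis
    using convex_sums [OF convex_closed_segment convex_ball] by simp
qed

lemma segment_subset_tube: "e > 0 \<Longrightarrow> closed_segment a b \<subseteq> tube a b e"
  using tubeI [of _ a b 0 e] by auto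

lemma tube_mono: "e \<le> e' \<Longrightarrow> tube a b e \<subseteq> tube a b e'"
  unfolding tube_def by (intro UN_mono subset_ball order_refl)

lemma tube_sym: "tube a b e = tube b a e"
  by (simp add: tube_def closed_segment_commute)

lemma tube_exists:
  assumes x: "finite x" and ab: "nonobstructing_pair x a b"
  obtains e where "e > 0" "tube a b e \<inter> x = {a, b}"
proof -
  have "\<exists>e>0. \<forall>s\<in>closed_segment a b. \<forall>y\<in>x - {a, b}. e \<le> dist s y"
  proof (rule separate_compact_closed)
    show "closed_segment a b \<inter> (x - {a, b}) = {}"
      using ab by (auto simp: nonobstructing_pair_def)
  qed (use x in \<open>auto intro: finite_imp_closed\<close>)
  then obtain e where e: "e > 0" "\<forall>s\<in>closed_segment a b. \<forall>y\<in>x - {a, b}. e \<le> dist s y"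
    by blast
  have "tube a b e \<inter> x \<subseteq> {a, b}"
  proof
    fix y assume y: "y \<in> tube a b e \<inter> x"
    then obtain s where "s \<in> closed_segment a b" "dist s y < e"
      by (auto simp: tube_def)
    then show "y \<in> {a, b}"
      using e(2) y by force
  qed
  moreover have "{a, b} \<subseteq> tube a b e \<inter> x"
    using ab segment_subset_tube [OF e(1), of a b] by (auto simp: nonobstructing_pair_def)
  ultimately show thesis
    using that e(1) by blast
qed

lemma disjoint_tubes_exist:
  assumes "closed_segment a b \<inter> closed_segment c d = {}"
  obtains e where "e > 0" "tube a b e \<inter> tube c d e = {}"
proof -
  obtain e where e: "e > 0" "\<forall>s\<in>closed_segment a b. \<forall>t\<in>closed_segment c d. e \<le> dist s t"
    using separate_compact_closed [OF _ _ assms] by auto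
  have "tube a b (e / 2) \<inter> tube c d (e / 2) = {}"
  proof (rule ccontr)
    assume "\<not> ?thesis"
    then obtain y s t where "s \<in> closed_segment a b" "dist s y < e / 2" "t \<in> closed_segment c d" "dist t y < e / 2"
      by (auto simp: tube_def)
    then show False
      using e(2) dist_triangle2 [of s t y] by fastforce
  qed
  then show thesis
    using that [of "e / 2"] e(1) by simp
qed

text \<open>The sign condition says that \<open>(f t - g t) / (a - b)\<close> lies in the upper
  half-plane: the difference makes a half turn counterclockwise. Each condition is preserved under
  convex combinations, and the sign condition also keeps the strings apart, so any two such pairs
  are homotopic by straight lines.\<close>

definition twist_strings ::
  "complex \<Rightarrow> complex \<Rightarrow> complex set \<Rightarrow> (real \<Rightarrow> complex) \<Rightarrow> (real \<Rightarrow> complex) \<Rightarrow> bool" where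
  "twist_strings a b U f g \<longleftrightarrow>
     continuous_on {0..1} f \<and> continuous_on {0..1} g \<and> (\<forall>t\<in>{0..1}. f t \<in> U \<and> g t \<in> U) \<and>
     f 0 = a \<and> f 1 = b \<and> g 0 = b \<and> g 1 = a \<and> (\<forall>t\<in>{0<..<1}. Im (cnj (a - b) * (f t - g t)) > 0)"

definition twist_loop ::
  "complex set \<Rightarrow> complex \<Rightarrow> complex \<Rightarrow> (real \<Rightarrow> complex) \<Rightarrow> (real \<Rightarrow> complex) \<Rightarrow> real \<Rightarrow> complex set" where
  "twist_loop x a b f g = (\<lambda>t. (x - {a, b}) \<union> {f t, g t})"

lemma twist_strings_homotopic:
  assumes x: "finite x" and U: "convex U" "U \<inter> x = {a, b}" and "a \<noteq> b"
    and fg: "twist_strings a b U f g" and fg': "twist_strings a b U f' g'"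
  shows "(twist_loop x a b f g, twist_loop x a b f' g') \<in> loop_homotopy (configuration_space (card x)) x"
proof (rule loop_homotopyI)
  define \<alpha> where "\<alpha> = (\<lambda>(s, t). (1 - s) *\<^sub>R f t + s *\<^sub>R f' t)"
  define \<beta> where "\<beta> = (\<lambda>(s, t). (1 - s) *\<^sub>R g t + s *\<^sub>R g' t)"
  define h where "h = (\<lambda>q. (\<lambda>i. if i = a then \<alpha> q else if i = b then \<beta> q else i) ` x)"
  have ab: "a \<in> x" "b \<in> x"
    using U by auto
  have h: "h q = (x - {a, b}) \<union> {\<alpha> q, \<beta> q}" for q
    using ab \<open>a \<noteq> b\<close> by (auto simp: h_def)
  have cont: "continuous_on ({0..1} \<times> {0..1}) \<alpha>" "continuous_on ({0..1} \<times> {0..1}) \<beta>"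
    unfolding \<alpha>_def \<beta>_def case_prod_unfold using fg fg'
    by (auto simp: twist_strings_def intro!: continuous_intros elim!: continuous_on_compose2)
  have inU: "\<alpha> q \<in> U" "\<beta> q \<in> U" if "q \<in> {0..1} \<times> {0..1}" for q
    using that fg fg' by (auto simp: \<alpha>_def \<beta>_def twist_strings_def intro!: convexD_alt [OF U(1)])
  have ne: "\<alpha> q \<noteq> \<beta> q" if q: "q \<in> {0..1} \<times> {0..1}" for q
  proof -
    obtain s t where q: "q = (s, t)" "s \<in> {0..1}" "t \<in> {0..1}"
      using q by auto
    have eq: "\<alpha> q - \<beta> q = (1 - s) *\<^sub>R (f t - g t) + s *\<^sub>R (f' t - g' t)"
      by (simp add: q \<alpha>_def \<beta>_def algebra_simps)
    consider "t = 0" | "t = 1" | "t \<in> {0<..<1}"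
      using q(3) by fastforce
    then show ?thesis
    proof cases
      case 1
      then show ?thesis
        using fg fg' \<open>a \<noteq> b\<close> by (auto simp: \<alpha>_def \<beta>_def twist_strings_def q(1) simp flip: scaleR_add_left)
    next
      case 2
      then show ?thesis
        using fg fg' \<open>a \<noteq> b\<close> by (auto simp: \<alpha>_def \<beta>_def twist_strings_def q(1) simp flip: scaleR_add_left)
    next
      case 3
      let ?m = "\<lambda>z. Im (cnj (a - b) * z)"
      have pos: "?m (f t - g t) > 0" "?m (f' t - g' t) > 0"
        using 3 fg fg' by (auto simp: twist_strings_def)
      have "?m (\<alpha> q - \<beta> q) = (1 - s) * ?m (f t - g t) + s * ?m (f' t - g' t)"
        unfolding eq by (simp add: algebra_simps)
      also have "\<dots> > 0"
        using pos q(2) by (cases "s = 0") (auto intro: add_nonneg_pos)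
      finally show ?thesis by auto
    qed
  qed
  show "continuous_map (top_of_set ({0..1} \<times> {0..1})) (configuration_space (card x)) h"
    unfolding h_def
  proof (rule continuous_map_configuration_space [OF x HOL.refl])
    show "continuous_on ({0..1} \<times> {0..1}) (\<lambda>q. if i = a then \<alpha> q else if i = b then \<beta> q else i)" for i
      using cont by (cases "i = a"; cases "i = b"; simp)
    show "inj_on (\<lambda>i. if i = a then \<alpha> q else if i = b then \<beta> q else i) x" if q: "q \<in> {0..1} \<times> {0..1}" for q
    proof (rule inj_onI)
      have out: "\<alpha> q \<noteq> i" "\<beta> q \<noteq> i" if "i \<in> x" "i \<noteq> a" "i \<noteq> b" for i
        using inU [OF q] U(2) that by auto
      fix i j assume "i \<in> x" "j \<in> x"
        "(if i = a then \<alpha> q else if i = b then \<beta> q else i) = (if j = a then \<alpha> q else if j = b then \<beta> q else j)"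
      then show "i = j"
        using ne [OF q] out [of i] out [of j] by (auto split: if_splits)
    qed
  qed
  show "h (0, t) = twist_loop x a b f g t" "h (1, t) = twist_loop x a b f' g' t" for t
    by (simp_all add: h \<alpha>_def \<beta>_def twist_loop_def)
  show "h (s, 0) = x" "h (s, 1) = x" for s
    using fg fg' ab by (auto simp: h \<alpha>_def \<beta>_def twist_strings_def simp flip: scaleR_add_left)
qed

lemma half_ellipse_strings:
  assumes "z \<noteq> z'" "0 < e" "e * norm (z - z') < \<epsilon>"
  shows "twist_strings z z' (tube z z' \<epsilon>) (half_ellipse z z' e) (half_ellipse z' z e)"
proof -
  have cont: "continuous_on {0..1} (half_ellipse u v e)" for u v
    unfolding half_ellipse_def by (intro continuous_intros)
  have mem: "half_ellipse u v e t \<in> tube u v \<epsilon>"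
    if "t \<in> {0..1}" "e * norm (u - v) < \<epsilon>" for u v t
    unfolding half_ellipse_def
  proof (rule tubeI)
    have "(u + v) / 2 + (u - v) / 2 * of_real (cos (pi * t)) =
        (1 - (1 - cos (pi * t)) / 2) *\<^sub>R u + ((1 - cos (pi * t)) / 2) *\<^sub>R v"
      by (simp add: scaleR_conv_of_real algebra_simps add_divide_distrib diff_divide_distrib)
    then show "(u + v) / 2 + (u - v) / 2 * of_real (cos (pi * t)) \<in> closed_segment u v"
      unfolding in_segment by (intro exI [of _ "(1 - cos (pi * t)) / 2"]) (auto simp: cos_ge_minus_one)
    have "norm (\<i> * of_real e * ((u - v) / 2) * of_real (sin (pi * t))) =
        e * norm (u - v) * (\<bar>sin (pi * t)\<bar> / 2)"
      using \<open>0 < e\<close> by (simp add: norm_mult norm_divide)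
    also have "\<dots> \<le> e * norm (u - v) * 1"
    proof (rule mult_left_mono)
      show "\<bar>sin (pi * t)\<bar> / 2 \<le> 1"
        using abs_sin_le_one [of "pi * t"] by linarith
    qed (use \<open>0 < e\<close> in auto)
    finally show "norm (\<i> * of_real e * ((u - v) / 2) * of_real (sin (pi * t))) < \<epsilon>"
      using that(2) by simp
  qed
  have "Im (cnj (z - z') * (half_ellipse z z' e t - half_ellipse z' z e t)) > 0" if t: "t \<in> {0<..<1}" for t
  proof -
    have "half_ellipse z z' e t - half_ellipse z' z e t =
        (z - z') * (of_real (cos (pi * t)) + \<i> * of_real (e * sin (pi * t)))"
      by (simp add: half_ellipse_def field_simps)
    then have "cnj (z - z') * (half_ellipse z z' e t - half_ellipse z' z e t) =
        of_real ((norm (z - z'))\<^sup>2) * (of_real (cos (pi * t)) + \<i> * of_real (e * sin (pi * t)))"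
      by (metis complex_norm_square mult.assoc mult.commute of_real_power)
    moreover have "sin (pi * t) > 0"
      using t by (intro sin_gt_zero) auto
    ultimately show ?thesis
      using assms by simp
  qed
  moreover have "half_ellipse u v e 0 = u" "half_ellipse u v e 1 = v" for u v
    by (simp_all add: half_ellipse_def field_simps)
  ultimately show ?thesis
    unfolding twist_strings_def using cont mem [of _ z z'] mem [of _ z' z] assms
    by (auto simp: norm_minus_commute tube_sym [of z' z])
qed

lemma half_twist_eq: "half_twist x z z' e = twist_loop x z z' (half_ellipse z z' e) (half_ellipse z' z e)"
  by (simp add: half_twist_def twist_loop_def)

text \<open>Ellipses with \<open>e < \<epsilon> / norm (a - b)\<close> stay in the same tube as
  \<open>f\<close> and \<open>g\<close>, so all of them give one class. The filter
  \<open>at_right 0\<close> is nontrivial, which makes the described class unique; from here on any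
  strings in the tube may replace the ellipses.\<close>

lemma pair_braid_eq:
  assumes x: "finite x" and ab: "nonobstructing_pair x a b"
    and \<epsilon>: "\<epsilon> > 0" "tube a b \<epsilon> \<inter> x = {a, b}" and fg: "twist_strings a b (tube a b \<epsilon>) f g"
  shows "pair_braid x a b = loop_class (configuration_space (card x)) x (twist_loop x a b f g)"
proof -
  let ?C = "loop_class (configuration_space (card x)) x"
  have "a \<noteq> b" using ab by (simp add: nonobstructing_pair_def)
  define e0 where "e0 = \<epsilon> / norm (a - b)"
  have "e0 > 0" using \<epsilon> \<open>a \<noteq> b\<close> by (simp add: e0_def)
  have eq: "?C (half_twist x a b e) = ?C (twist_loop x a b f g)" if "0 < e" "e < e0" for e
  proof -
    have "e * norm (a - b) < \<epsilon>"
      using that \<open>a \<noteq> b\<close> by (simp add: e0_def pos_less_divide_eq)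
    then show ?thesis
      unfolding half_twist_eq
      using twist_strings_homotopic [OF x convex_tube \<epsilon>(2) \<open>a \<noteq> b\<close> half_ellipse_strings fg] that \<open>a \<noteq> b\<close>
      by (intro loop_class_eqI) auto
  qed
  then have ev: "\<forall>\<^sub>F e in at_right 0. ?C (half_twist x a b e) = ?C (twist_loop x a b f g)"
    using \<open>e0 > 0\<close> by (auto simp: eventually_at_right_field)
  show ?thesis
    unfolding pair_braid_def
  proof (rule the_equality, rule ev)
    fix c assume "\<forall>\<^sub>F e in at_right 0. ?C (half_twist x a b e) = c"
    with ev have "\<forall>\<^sub>F e::real in at_right 0. c = ?C (twist_loop x a b f g)"
      by eventually_elim simp
    then show "c = ?C (twist_loop x a b f g)"
      by (simp add: trivial_limit_at_right_real)
  qed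
qed

lemma pair_braid_sym: "pair_braid x a b = pair_braid x b a"
  by (simp add: pair_braid_def half_twist_def insert_commute)

lemma twist_loop_in_loops:
  assumes "finite x" "nonobstructing_pair x a b" "tube a b \<epsilon> \<inter> x = {a, b}" "twist_strings a b (tube a b \<epsilon>) f g"
  shows "twist_loop x a b f g \<in> loops_at (configuration_space (card x)) x"
  using twist_strings_homotopic [OF assms(1) convex_tube assms(3) _ assms(4,4)] assms(2)
  by (auto simp: nonobstructing_pair_def dest: loop_homotopy_loops)

lemma pair_braid_representative:
  assumes x: "finite x" and ab: "nonobstructing_pair x a b"
  obtains \<epsilon> f g where "\<epsilon> > 0" "tube a b \<epsilon> \<inter> x = {a, b}" "twist_strings a b (tube a b \<epsilon>) f g"
    "twist_loop x a b f g \<in> loops_at (configuration_space (card x)) x"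
    "pair_braid x a b = loop_class (configuration_space (card x)) x (twist_loop x a b f g)"
proof -
  obtain \<epsilon> where \<epsilon>: "\<epsilon> > 0" "tube a b \<epsilon> \<inter> x = {a, b}"
    using tube_exists [OF x ab] .
  have ne: "a \<noteq> b" using ab by (simp add: nonobstructing_pair_def)
  define e where "e = \<epsilon> / (2 * norm (a - b))"
  have "e > 0" "e * norm (a - b) < \<epsilon>"
    using \<epsilon>(1) ne by (auto simp: e_def)
  then have "twist_strings a b (tube a b \<epsilon>) (half_ellipse a b e) (half_ellipse b a e)"
    by (intro half_ellipse_strings ne)
  then show thesis
    using that \<epsilon> pair_braid_eq [OF x ab \<epsilon>] twist_loop_in_loops [OF x ab \<epsilon>(2)] by blast
qed

lemma pair_braid_closed:
  assumes "finite x" "nonobstructing_pair x a b"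
  shows "pair_braid x a b \<in> carrier (braid_group x)"
  by (rule pair_braid_representative [OF assms]) (simp add: braid_group_def loop_class_in_carrier)

section \<open>Relations between half twists\<close>

text \<open>The bottom and right sides of the unit square. Composed with a map in which the two
  coordinates drive two motions, it performs the first motion and then the second.\<close>

definition corner_path :: "real \<Rightarrow> real \<times> real" where
  "corner_path t = (if t \<le> 1/2 then (2 * t, 0) else (1, 2 * t - 1))"

lemma continuous_corner_path: "continuous_on A corner_path"
  unfolding corner_path_def by (intro continuous_on_cases_half continuous_intros) auto

text \<open>In disjoint tubes the two twists can run on independent clocks, which gives a map on the
  square. The two orders of the product are the two ways around its boundary from
  \<open>(0, 0)\<close> to \<open>(1, 1)\<close>.\<close>

lemma pair_braids_commute:
  assumes x: "finite x" and ab: "nonobstructing_pair x a b" and cd: "nonobstructing_pair x c d"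
    and disj: "closed_segment a b \<inter> closed_segment c d = {}"
  shows "pair_braid x a b \<otimes>\<^bsub>braid_group x\<^esub> pair_braid x c d =
    pair_braid x c d \<otimes>\<^bsub>braid_group x\<^esub> pair_braid x a b"
proof -
  obtain e1 where e1: "e1 > 0" "tube a b e1 \<inter> x = {a, b}"
    using tube_exists [OF x ab] .
  obtain e2 where e2: "e2 > 0" "tube c d e2 \<inter> x = {c, d}"
    using tube_exists [OF x cd] .
  obtain e3 where e3: "e3 > 0" "tube a b e3 \<inter> tube c d e3 = {}"
    using disjoint_tubes_exist [OF disj] .
  define e where "e = min e1 (min e2 e3)"
  have e: "e > 0" "e \<le> e1" "e \<le> e2" "e \<le> e3"
    using e1 e2 e3 by (auto simp: e_def)
  have mem: "{a, b} \<subseteq> tube a b e" "{c, d} \<subseteq> tube c d e"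
    using segment_subset_tube [OF e(1)] by (auto dest!: subsetD)
  have ne: "a \<noteq> b" "c \<noteq> d" and mx: "a \<in> x" "b \<in> x" "c \<in> x" "d \<in> x"
    using ab cd by (auto simp: nonobstructing_pair_def)
  have T1: "tube a b e \<inter> x = {a, b}"
    using tube_mono [OF e(2), of a b] e1(2) mem(1) mx by auto
  have T2: "tube c d e \<inter> x = {c, d}"
    using tube_mono [OF e(3), of c d] e2(2) mem(2) mx by auto
  have T12: "tube a b e \<inter> tube c d e = {}"
    using tube_mono [OF e(4), of a b] tube_mono [OF e(4), of c d] e3(2) by auto
  have strings: "\<exists>f g. twist_strings u v (tube u v e) f g" if "u \<noteq> v" for u v
  proof -
    have "twist_strings u v (tube u v e) (half_ellipse u v (e / (2 * norm (u - v))))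
        (half_ellipse v u (e / (2 * norm (u - v))))"
      using e(1) that by (intro half_ellipse_strings) auto
    then show ?thesis by blast
  qed
  obtain f g where fg: "twist_strings a b (tube a b e) f g"
    using strings [OF ne(1)] by blast
  obtain f' g' where fg': "twist_strings c d (tube c d e) f' g'"
    using strings [OF ne(2)] by blast
  let ?X = "configuration_space (card x)"
  let ?p = "twist_loop x a b f g" and ?q = "twist_loop x c d f' g'"
  define F where "F = (\<lambda>q::real \<times> real. (\<lambda>i. if i = a then f (fst q) else if i = b then g (fst q)
    else if i = c then f' (snd q) else if i = d then g' (snd q) else i) ` x)"
  have dist: "a \<noteq> c" "a \<noteq> d" "b \<noteq> c" "b \<noteq> d"
    using T12 mem by auto
  have F: "F q = (x - {a, b, c, d}) \<union> {f (fst q), g (fst q), f' (snd q), g' (snd q)}" for q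
    using mx ne dist by (auto simp: F_def)
  have contF: "continuous_map (top_of_set ({0..1} \<times> {0..1})) ?X F"
    unfolding F_def
  proof (rule continuous_map_configuration_space [OF x HOL.refl])
    have "continuous_on ({0..1} \<times> {0..1}) (\<lambda>q. f (fst q))" "continuous_on ({0..1} \<times> {0..1}) (\<lambda>q. g (fst q))"
      "continuous_on ({0..1} \<times> {0..1}) (\<lambda>q. f' (snd q))" "continuous_on ({0..1} \<times> {0..1}) (\<lambda>q. g' (snd q))"
      using fg fg' by (auto simp: twist_strings_def intro!: continuous_intros elim!: continuous_on_compose2)
    then show "continuous_on ({0..1} \<times> {0..1}) (\<lambda>q. if i = a then f (fst q) else if i = b then g (fst q)
      else if i = c then f' (snd q) else if i = d then g' (snd q) else i)" for i
      by (cases "i = a"; cases "i = b"; cases "i = c"; cases "i = d"; simp)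
    fix q :: "real \<times> real" assume q: "q \<in> {0..1} \<times> {0..1}"
    have inT: "f (fst q) \<in> tube a b e" "g (fst q) \<in> tube a b e" "f' (snd q) \<in> tube c d e" "g' (snd q) \<in> tube c d e"
      using q fg fg' by (auto simp: twist_strings_def)
    have fgne: "u t \<noteq> v t" if "twist_strings y z U u v" "y \<noteq> z" "t \<in> {0..1}" for u v y z U t
    proof (cases "t \<in> {0<..<1}")
      case True
      then have "Im (cnj (y - z) * (u t - v t)) > 0"
        using that by (auto simp: twist_strings_def)
      then show ?thesis by auto
    next
      case False
      then have "t = 0 \<or> t = 1" using that(3) by auto
      then show ?thesis using that by (auto simp: twist_strings_def)
    qed
    have "f (fst q) \<noteq> g (fst q)" "f' (snd q) \<noteq> g' (snd q)"
      using fgne [OF fg ne(1)] fgne [OF fg' ne(2)] q by auto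
    moreover have "f (fst q) \<noteq> i \<and> g (fst q) \<noteq> i" if "i \<in> x" "i \<noteq> a" "i \<noteq> b" for i
      using inT T1 that by auto
    moreover have "f' (snd q) \<noteq> i \<and> g' (snd q) \<noteq> i" if "i \<in> x" "i \<noteq> c" "i \<noteq> d" for i
      using inT T2 that by auto
    moreover have "f (fst q) \<noteq> f' (snd q)" "f (fst q) \<noteq> g' (snd q)" "g (fst q) \<noteq> f' (snd q)" "g (fst q) \<noteq> g' (snd q)"
      using inT T12 by auto
    ultimately show "inj_on (\<lambda>i. if i = a then f (fst q) else if i = b then g (fst q)
      else if i = c then f' (snd q) else if i = d then g' (snd q) else i) x"
      unfolding inj_on_def by (auto split: if_splits)
  qed
  have ends: "f 0 = a" "f 1 = b" "g 0 = b" "g 1 = a" "f' 0 = c" "f' 1 = d" "g' 0 = d" "g' 1 = c"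
    using fg fg' by (auto simp: twist_strings_def)
  have sq: "convex ({0..1} \<times> {0..1} :: (real \<times> real) set)"
    by (intro convex_Times convex_real_interval)
  have "(\<lambda>t. F (corner_path t), \<lambda>t. F (prod.swap (corner_path t))) \<in> loop_homotopy ?X x"
  proof (rule loop_homotopy_convex [OF sq contF])
    show "continuous_on {0..1} (\<lambda>t. prod.swap (corner_path t))"
      using continuous_corner_path by (auto simp: prod.swap_def intro!: continuous_intros)
  qed (use continuous_corner_path ends mx in \<open>auto simp: corner_path_def F\<close>)
  moreover have corner: "F (corner_path t) = join_loops ?p ?q t" for t
    using mx dist ends by (auto simp: F corner_path_def join_loops_def twist_loop_def)
  moreover have corner': "F (prod.swap (corner_path t)) = join_loops ?q ?p t" for t
    using mx dist ends by (auto simp: F corner_path_def join_loops_def twist_loop_def)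
  ultimately have "loop_class ?X x (join_loops ?p ?q) = loop_class ?X x (join_loops ?q ?p)"
    unfolding corner corner' by (intro loop_class_eqI)
  then show ?thesis
    using pair_braid_eq [OF x ab e(1) T1 fg] pair_braid_eq [OF x cd e(1) T2 fg']
      twist_loop_in_loops [OF x ab T1 fg] twist_loop_in_loops [OF x cd T2 fg']
    by (simp add: braid_group_def loop_class_mult)
qed

lemma barycentric_unique:
  assumes "Im (cnj (b - a) * (c - a)) \<noteq> 0" "u1 + u2 + u3 = 1" "v1 + v2 + v3 = (1::real)"
    and eq: "u1 *\<^sub>R a + u2 *\<^sub>R b + u3 *\<^sub>R c = v1 *\<^sub>R a + v2 *\<^sub>R b + v3 *\<^sub>R c"
  shows "u1 = v1 \<and> u2 = v2 \<and> u3 = v3"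
proof -
  have u1: "u1 = 1 - u2 - u3" and v1: "v1 = 1 - v2 - v3"
    using assms by auto
  have eq': "(u2 - v2) *\<^sub>R (b - a) + (u3 - v3) *\<^sub>R (c - a) = 0"
    using eq unfolding u1 v1 by (simp add: algebra_simps)
  have "(u3 - v3) * Im (cnj (b - a) * (c - a)) =
      Im (cnj (b - a) * ((u2 - v2) *\<^sub>R (b - a) + (u3 - v3) *\<^sub>R (c - a)))"
    by (simp add: algebra_simps)
  then have u3: "u3 = v3"
    unfolding eq' using assms(1) by simp
  have "(u2 - v2) * Im (cnj (b - a) * (c - a)) =
      - Im (cnj (c - a) * ((u2 - v2) *\<^sub>R (b - a) + (u3 - v3) *\<^sub>R (c - a)))"
    by (simp add: algebra_simps)
  then have "u2 = v2"
    unfolding eq' using assms(1) by simp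
  then show ?thesis using u3 u1 v1 by simp
qed

text \<open>The straight motion from \<open>a\<close> to \<open>b\<close> with a parabolic deviation
  in direction \<open>w\<close>. Being polynomial, such strings extend to the two-parameter family
  needed for the triangle relation.\<close>

definition bulge :: "complex \<Rightarrow> complex \<Rightarrow> complex \<Rightarrow> real \<Rightarrow> complex" where
  "bulge a b w t = (1 - t) *\<^sub>R a + t *\<^sub>R b + (t * (1 - t)) *\<^sub>R w"

lemma bulge_strings:
  assumes "Im (cnj (a - b) * w) > 0" "norm w < e"
  shows "twist_strings a b (tube a b e) (bulge a b w) (bulge b a 0)"
proof -
  have cont: "continuous_on {0..1} (bulge u v z)" for u v z
    unfolding bulge_def by (intro continuous_intros)
  have "e > 0"
    using assms(2) norm_ge_zero [of w] by linarith
  have mem: "bulge u v z t \<in> tube u v e" if t: "t \<in> {0..1}" and "norm z < e" for u v z t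
    unfolding bulge_def
  proof (rule tubeI)
    show "(1 - t) *\<^sub>R u + t *\<^sub>R v \<in> closed_segment u v"
      using t by (auto simp: in_segment)
    have "\<bar>t * (1 - t)\<bar> * norm z \<le> 1 * norm z"
      using t mult_mono [of t 1 "1 - t" 1] by (intro mult_right_mono) auto
    then show "norm ((t * (1 - t)) *\<^sub>R z) < e"
      using \<open>norm z < e\<close> by simp
  qed
  have "Im (cnj (a - b) * (bulge a b w t - bulge b a 0 t)) > 0" if t: "t \<in> {0<..<1}" for t
  proof -
    have "bulge a b w t - bulge b a 0 t = (1 - 2 * t) *\<^sub>R (a - b) + (t * (1 - t)) *\<^sub>R w"
      by (simp add: bulge_def algebra_simps scaleR_2 flip: scaleR_scaleR)
    moreover have "Im (cnj u * (r *\<^sub>R u + s *\<^sub>R w)) = s * Im (cnj u * w)" for u r s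
      by (simp add: algebra_simps)
    ultimately have "Im (cnj (a - b) * (bulge a b w t - bulge b a 0 t)) = (t * (1 - t)) * Im (cnj (a - b) * w)"
      by (simp only:)
    then show ?thesis
      using t assms(1) by (simp add: mult_pos_pos del: mult_eq_0_iff)
  qed
  then show ?thesis
    unfolding twist_strings_def using cont mem [of _ w a b] mem [of _ 0 b a] assms \<open>e > 0\<close>
    by (auto simp: tube_sym [of b a]) (auto simp: bulge_def)
qed

definition rotation_loop :: "complex set \<Rightarrow> complex \<Rightarrow> complex \<Rightarrow> complex \<Rightarrow> real \<Rightarrow> complex set" where
  "rotation_loop x a b c = (\<lambda>t. (x - {a, b, c}) \<union> {bulge a c 0 t, bulge b a 0 t, bulge c b 0 t})"

text \<open>Together with \<open>pair_braids_rotation\<close> this is the triangle relation: both of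
  its sides are the class of one and the same loop.\<close>

lemma rotation_loop_cyclic: "rotation_loop x a b c = rotation_loop x b c a"
  by (auto simp: rotation_loop_def insert_commute)

text \<open>The twist of \<open>a, b\<close> followed by the twist of \<open>b, c\<close> and the rotation of the triangle are two
  paths along the boundary of the domain of one map from the triangle \<open>0 \<le> q \<le> p \<le> 1\<close> to the
  configuration space: \<open>p\<close> measures how far the point at \<open>b\<close> has moved towards \<open>a\<close>, \<open>q\<close> how far
  the point at \<open>c\<close> has moved towards \<open>b\<close>, while the point at \<open>a\<close> moves to \<open>c\<close> inside the
  triangle.\<close>

lemma pair_braids_rotation:
  assumes x: "finite x" and abc: "a \<in> x" "b \<in> x" "c \<in> x" and hull: "convex hull {a, b, c} \<inter> x = {a, b, c}"
    and cw: "Im (cnj (b - a) * (c - a)) < 0"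
    and ab: "nonobstructing_pair x a b" and bc: "nonobstructing_pair x b c"
  shows "pair_braid x a b \<otimes>\<^bsub>braid_group x\<^esub> pair_braid x b c =
    loop_class (configuration_space (card x)) x (rotation_loop x a b c)"
proof -
  obtain e1 where e1: "e1 > 0" "tube a b e1 \<inter> x = {a, b}"
    using tube_exists [OF x ab] .
  obtain e2 where e2: "e2 > 0" "tube b c e2 \<inter> x = {b, c}"
    using tube_exists [OF x bc] .
  have ne: "a \<noteq> b" "b \<noteq> c" "a \<noteq> c"
    using ab bc cw by (auto simp: nonobstructing_pair_def)
  \<comment> \<open>The last two bounds, halved to make the estimates strict, keep the bulged
    strings in the tubes around \<open>ab\<close> and \<open>bc\<close>; the bound 1 keeps the
    coordinate \<open>B\<close> nonnegative.\<close>
  define \<tau> where "\<tau> = min 1 (min (e1 / (2 * norm (c - b))) (e2 / (2 * norm (a - b))))"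
  have "\<tau> > 0" "\<tau> \<le> 1"
    using e1(1) e2(1) ne by (auto simp: \<tau>_def)
  have "\<tau> \<le> e1 / (2 * norm (c - b))" "\<tau> \<le> e2 / (2 * norm (a - b))"
    by (simp_all add: \<tau>_def)
  then have "\<tau> * norm (c - b) \<le> e1 / 2" "\<tau> * norm (a - b) \<le> e2 / 2"
    using ne by (simp_all add: field_simps)
  then have small: "norm (\<tau> *\<^sub>R (c - b)) < e1" "norm (\<tau> *\<^sub>R (a - b)) < e2"
    using e1(1) e2(1) \<open>\<tau> > 0\<close> by simp_all
  have pos1: "Im (cnj (a - b) * (\<tau> *\<^sub>R (c - b))) > 0"
  proof -
    have "Im (cnj (a - b) * (\<tau> *\<^sub>R (c - b))) = \<tau> * - Im (cnj (b - a) * (c - a))"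
      by (simp add: algebra_simps)
    then show ?thesis using cw \<open>\<tau> > 0\<close> by (simp add: mult_pos_neg)
  qed
  have pos2: "Im (cnj (b - c) * (\<tau> *\<^sub>R (a - b))) > 0"
  proof -
    have "Im (cnj (b - c) * (\<tau> *\<^sub>R (a - b))) = \<tau> * - Im (cnj (b - a) * (c - a))"
      by (simp add: algebra_simps)
    then show ?thesis using cw \<open>\<tau> > 0\<close> by (simp add: mult_pos_neg)
  qed
  note T1 = bulge_strings [OF pos1 small(1)] and T2 = bulge_strings [OF pos2 small(2)]
  let ?X = "configuration_space (card x)"
  let ?p = "twist_loop x a b (bulge a b (\<tau> *\<^sub>R (c - b))) (bulge b a 0)"
  let ?q = "twist_loop x b c (bulge b c (\<tau> *\<^sub>R (a - b))) (bulge c b 0)"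
  define D where "D = {(p, q). 0 \<le> q \<and> q \<le> p \<and> p \<le> (1::real)}"
  \<comment> \<open>Barycentric coordinates of the point that starts at \<open>a\<close>: the affine
    motion \<open>(1 - p, p - q, q)\<close> plus a multiple of \<open>\<tau> * (p - q)\<close>. The
    correction vanishes on the diagonal, is the bulge towards \<open>c\<close> on
    \<open>q = 0\<close>, and is the bulge towards \<open>a\<close> on \<open>p = 1\<close>.\<close>
  define A where "A = (\<lambda>(p, q). (1 - p + \<tau> * (p - q) * q))"
  define B where "B = (\<lambda>(p, q). (p - q) * (1 - \<tau> * (q + 1 - p)))"
  define C where "C = (\<lambda>(p, q). q + \<tau> * (p - q) * (1 - p))"
  define \<alpha> where "\<alpha> = (\<lambda>y. A y *\<^sub>R a + B y *\<^sub>R b + C y *\<^sub>R c)"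
  define F where "F = (\<lambda>y::real \<times> real. (\<lambda>i. if i = a then \<alpha> y else if i = b then bulge b a 0 (fst y)
    else if i = c then bulge c b 0 (snd y) else i) ` x)"
  have F: "F y = (x - {a, b, c}) \<union> {\<alpha> y, bulge b a 0 (fst y), bulge c b 0 (snd y)}" for y
    using abc ne by (auto simp: F_def)
  have ABC: "A y + B y + C y = 1" for y
    by (cases y) (simp add: A_def B_def C_def algebra_simps)
  have ABC_nonneg: "A y \<ge> 0" "B y \<ge> 0" "C y \<ge> 0" if y: "y \<in> D" for y
  proof -
    obtain p q where pq: "y = (p, q)" "0 \<le> q" "q \<le> p" "p \<le> 1"
      using y by (auto simp: D_def)
    have "\<tau> * (q + 1 - p) \<le> 1 * 1"
      using pq \<open>\<tau> > 0\<close> \<open>\<tau> \<le> 1\<close> by (intro mult_mono) auto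
    then show "A y \<ge> 0" "B y \<ge> 0" "C y \<ge> 0"
      using pq \<open>\<tau> > 0\<close> by (auto simp: A_def B_def C_def)
  qed
  have in_hull: "u *\<^sub>R a + v *\<^sub>R b + w *\<^sub>R c \<in> convex hull {a, b, c}"
    if "u \<ge> 0" "v \<ge> 0" "w \<ge> 0" "u + v + w = 1" for u v w
    unfolding convex_hull_3 using that by blast
  have bulge_ba: "bulge b a 0 t = t *\<^sub>R a + (1 - t) *\<^sub>R b + 0 *\<^sub>R c" for t
    by (simp add: bulge_def)
  have bulge_cb: "bulge c b 0 t = 0 *\<^sub>R a + t *\<^sub>R b + (1 - t) *\<^sub>R c" for t
    by (simp add: bulge_def)
  have bary: "Im (cnj (b - a) * (c - a)) \<noteq> 0"
    using cw by simp
  have contF: "continuous_map (top_of_set D) ?X F"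
    unfolding F_def
  proof (rule continuous_map_configuration_space [OF x HOL.refl])
    have "continuous_on D \<alpha>" "continuous_on D (\<lambda>y. bulge b a 0 (fst y))" "continuous_on D (\<lambda>y. bulge c b 0 (snd y))"
      unfolding \<alpha>_def A_def B_def C_def bulge_def case_prod_unfold by (intro continuous_intros)+
    then show "continuous_on D (\<lambda>y. if i = a then \<alpha> y else if i = b then bulge b a 0 (fst y)
      else if i = c then bulge c b 0 (snd y) else i)" for i
      by (cases "i = a"; cases "i = b"; cases "i = c"; simp)
    fix y assume y: "y \<in> D"
    obtain p q where pq: "y = (p, q)" "0 \<le> q" "q \<le> p" "p \<le> 1"
      using y by (auto simp: D_def)
    have hulls: "\<alpha> y \<in> convex hull {a, b, c}" "bulge b a 0 p \<in> convex hull {a, b, c}"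
        "bulge c b 0 q \<in> convex hull {a, b, c}"
      unfolding \<alpha>_def bulge_ba bulge_cb using ABC ABC_nonneg [OF y] pq by (intro in_hull; simp)+
    then have out: "\<alpha> y \<noteq> i" "bulge b a 0 p \<noteq> i" "bulge c b 0 q \<noteq> i" if "i \<in> x" "i \<notin> {a, b, c}" for i
      using that hull by blast+
    \<comment> \<open>Comparing coordinates, a collision on the side \<open>ab\<close> forces
      \<open>C y = 0\<close>. This is a sum of nonnegative terms, so each vanishes, which leaves
      \<open>q = 0\<close> and \<open>p\<close> in \<open>{0, 1}\<close>, where the points are
      distinct vertices.\<close>
    have "\<alpha> y \<noteq> bulge b a 0 p"
    proof
      assume "\<alpha> y = bulge b a 0 p"
      then have "A y = p \<and> B y = 1 - p \<and> C y = 0"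
        unfolding \<alpha>_def bulge_ba using ABC [of y] by (intro barycentric_unique [OF bary]) auto
      then have eqs: "A y = p" "q + \<tau> * (p - q) * (1 - p) = 0"
        using pq by (auto simp: C_def)
      have "\<tau> * (p - q) * (1 - p) \<ge> 0"
        using pq \<open>\<tau> > 0\<close> by simp
      then have "q = 0" "\<tau> * (p - q) * (1 - p) = 0"
        using eqs(2) pq by linarith+
      then have "p = 0 \<or> p = 1" using \<open>\<tau> > 0\<close> by auto
      then show False using eqs(1) \<open>q = 0\<close> pq by (auto simp: A_def)
    qed
    moreover have "\<alpha> y \<noteq> bulge c b 0 q"
    proof
      assume "\<alpha> y = bulge c b 0 q"
      then have "A y = 0 \<and> B y = q \<and> C y = 1 - q"
        unfolding \<alpha>_def bulge_cb using ABC [of y] by (intro barycentric_unique [OF bary]) auto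
      then have eqs: "C y = 1 - q" "1 - p + \<tau> * (p - q) * q = 0"
        using pq by (auto simp: A_def)
      have "\<tau> * (p - q) * q \<ge> 0"
        using pq \<open>\<tau> > 0\<close> by simp
      then have "p = 1" "\<tau> * (p - q) * q = 0"
        using eqs(2) pq by linarith+
      then have "q = 0 \<or> q = 1" using \<open>\<tau> > 0\<close> by auto
      then show False using eqs(1) \<open>p = 1\<close> pq by (auto simp: C_def)
    qed
    moreover have "bulge b a 0 p \<noteq> bulge c b 0 q"
    proof
      assume "bulge b a 0 p = bulge c b 0 q"
      then have "p = 0 \<and> 1 - p = q \<and> 0 = 1 - q"
        unfolding bulge_ba bulge_cb by (intro barycentric_unique [OF bary]) auto
      then show False using pq by auto
    qed
    ultimately show "inj_on (\<lambda>i. if i = a then \<alpha> y else if i = b then bulge b a 0 (fst y)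
      else if i = c then bulge c b 0 (snd y) else i) x"
      unfolding inj_on_def pq(1) fst_conv snd_conv using out unfolding pq(1) by (auto split: if_splits)
  qed
  have convD: "convex D"
  proof -
    have "D = {y. 0 \<le> snd y} \<inter> {y. snd y - fst y \<le> 0} \<inter> {y. fst y \<le> 1}"
      by (auto simp: D_def)
    moreover have "{y :: real \<times> real. 0 \<le> snd y} = {y. (0, -1) \<bullet> y \<le> 0}"
      "{y :: real \<times> real. snd y - fst y \<le> 0} = {y. (-1, 1) \<bullet> y \<le> 0}"
      "{y :: real \<times> real. fst y \<le> 1} = {y. (1, 0) \<bullet> y \<le> 1}"
      by (auto simp: inner_prod_def)
    ultimately show ?thesis
      by (simp add: convex_Int convex_halfspace_le)
  qed
  have diag: "F (t, t) = rotation_loop x a b c t" for t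
  proof -
    have "\<alpha> (t, t) = bulge a c 0 t"
      by (simp add: \<alpha>_def A_def B_def C_def bulge_def)
    then show ?thesis
      by (simp add: F rotation_loop_def)
  qed
  have corner: "F (corner_path t) = join_loops ?p ?q t" for t
  proof (cases "t \<le> 1/2")
    case True
    have "\<alpha> (p, 0) = bulge a b (\<tau> *\<^sub>R (c - b)) p" for p
      by (simp add: \<alpha>_def A_def B_def C_def bulge_def algebra_simps)
    then show ?thesis
      using True abc ne by (auto simp: corner_path_def join_loops_def F twist_loop_def bulge_def [of c b])
  next
    case False
    have "\<alpha> (1, q) = bulge b c (\<tau> *\<^sub>R (a - b)) q" for q
      by (simp add: \<alpha>_def A_def B_def C_def bulge_def algebra_simps)
    then show ?thesis
      using False abc ne by (auto simp: corner_path_def join_loops_def F twist_loop_def bulge_def [of b a])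
  qed
  have "(\<lambda>t. F (corner_path t), \<lambda>t. F (t, t)) \<in> loop_homotopy ?X x"
  proof (rule loop_homotopy_convex [OF convD contF])
    show "continuous_on {0..1} (\<lambda>t::real. (t, t))"
      by (intro continuous_intros)
    show "F (corner_path 0) = x" "F (corner_path 1) = x"
      using abc by (auto simp: corner join_loops_def twist_loop_def bulge_def)
  qed (use continuous_corner_path in \<open>auto simp: corner_path_def D_def\<close>)
  then have "loop_class ?X x (join_loops ?p ?q) = loop_class ?X x (rotation_loop x a b c)"
    unfolding corner diag by (rule loop_class_eqI)
  then show ?thesis
    using pair_braid_eq [OF x ab e1 T1] pair_braid_eq [OF x bc e2 T2]
      twist_loop_in_loops [OF x ab e1(2) T1] twist_loop_in_loops [OF x bc e2(2) T2]
    by (simp add: braid_group_def loop_class_mult)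
qed

section \<open>The length homomorphism\<close>

text \<open>The length of a braid is the winding number of its discriminant around \<open>0\<close>.\<close>

definition discriminant :: "complex set \<Rightarrow> complex" where
  "discriminant x = (\<Prod>u\<in>x. \<Prod>v\<in>x - {u}. u - v)"

lemma discriminant_nonzero: "finite x \<Longrightarrow> discriminant x \<noteq> 0"
  by (auto simp: discriminant_def)

text \<open>Every pair occurs in both orders, so a new point contributes
  \<open>(u - v) * (v - u)\<close> for each old point \<open>v\<close>. The squares are what makes a
  half turn of a difference count as a full turn.\<close>

lemma discriminant_insert:
  assumes "finite x" "u \<notin> x"
  shows "discriminant (insert u x) = discriminant x * (\<Prod>v\<in>x. - ((u - v)\<^sup>2))"
proof -
  have "discriminant (insert u x) = (\<Prod>v\<in>x. u - v) * (\<Prod>w\<in>x. \<Prod>v\<in>insert u x - {w}. w - v)"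
    using assms by (simp add: discriminant_def)
  also have "(\<Prod>w\<in>x. \<Prod>v\<in>insert u x - {w}. w - v) = (\<Prod>w\<in>x. (w - u) * (\<Prod>v\<in>x - {w}. w - v))"
  proof (rule prod.cong [OF HOL.refl])
    fix w assume "w \<in> x"
    then have "insert u x - {w} = insert u (x - {w})"
      using assms by auto
    then show "(\<Prod>v\<in>insert u x - {w}. w - v) = (w - u) * (\<Prod>v\<in>x - {w}. w - v)"
      using assms by simp
  qed
  also have "\<dots> = (\<Prod>w\<in>x. w - u) * discriminant x"
    by (simp add: prod.distrib discriminant_def)
  finally have "discriminant (insert u x) = discriminant x * ((\<Prod>v\<in>x. u - v) * (\<Prod>v\<in>x. v - u))"
    by (simp add: mult_ac)
  also have "(\<Prod>v\<in>x. u - v) * (\<Prod>v\<in>x. v - u) = (\<Prod>v\<in>x. - ((u - v)\<^sup>2))"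
    by (simp add: prod.distrib [symmetric] power2_eq_square algebra_simps)
  finally show ?thesis .
qed

lemma continuous_map_complex_prod:
  fixes f :: "'i \<Rightarrow> 'a \<Rightarrow> complex"
  shows "(\<And>i. i \<in> I \<Longrightarrow> continuous_map X euclidean (f i)) \<Longrightarrow>
    continuous_map X euclidean (\<lambda>x. \<Prod>i\<in>I. f i x)"
  by (simp add: continuous_map_atin tendsto_prod)

lemma continuous_map_discriminant: "continuous_map (configuration_space n) euclidean discriminant"
proof -
  let ?X = "ordered_configuration_space n"
  have "continuous_map ?X euclidean (\<lambda>z. \<Prod>i\<in>{..<n}. \<Prod>j\<in>{..<n} - {i}. z i - z j)"
    by (intro continuous_map_complex_prod continuous_map_diff continuous_map_ordered_configuration) auto
  moreover have "(\<Prod>i\<in>{..<n}. \<Prod>j\<in>{..<n} - {i}. z i - z j) = (discriminant \<circ> (\<lambda>z. z ` {..<n})) z"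
    if "z \<in> topspace ?X" for z
  proof -
    have inj: "inj_on z {..<n}"
      using that by (simp add: ordered_configuration_space_def)
    have "(\<Prod>v\<in>z ` {..<n} - {z i}. z i - v) = (\<Prod>j\<in>{..<n} - {i}. z i - z j)" if "i < n" for i
    proof -
      have "z ` {..<n} - {z i} = z ` ({..<n} - {i})"
        using inj that by (auto simp: inj_on_def)
      then show ?thesis
        by (simp add: prod.reindex [OF inj_on_subset [OF inj]])
    qed
    then show ?thesis
      by (simp add: discriminant_def prod.reindex [OF inj])
  qed
  ultimately have "continuous_map ?X euclidean (discriminant \<circ> (\<lambda>z. z ` {..<n}))"
    by (rule continuous_map_eq)
  then show ?thesis
    unfolding configuration_space_def
    by (rule continuous_compose_quotient_map [OF quotient_map_quotient_topology])
qed

section \<open>Continuous logarithms of the discriminant\<close>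

lemma continuous_log_unique:
  fixes g h :: "'a::topological_space \<Rightarrow> complex"
  assumes "connected S" "continuous_on S g" "continuous_on S h"
    and "\<And>q. q \<in> S \<Longrightarrow> exp (g q) = exp (h q)" and "a \<in> S" "b \<in> S"
  shows "g b - g a = h b - h a"
proof -
  \<comment> \<open>The difference of two logarithms takes values in the integral multiples of
    \<open>2 * pi * \<i>\<close>, which are at distance at least \<open>2 * pi\<close> from each
    other, so it is constant on a connected set.\<close>
  have "(\<lambda>q. g q - h q) constant_on S"
  proof (rule continuous_discrete_range_constant [OF assms(1)])
    show "continuous_on S (\<lambda>q. g q - h q)"
      using assms by (intro continuous_intros)
    fix q assume q: "q \<in> S"
    have "2 * pi \<le> norm ((g p - h p) - (g q - h q))" if p: "p \<in> S" "g p - h p \<noteq> g q - h q" for p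
    proof -
      obtain k where k: "g p = h p + complex_of_real (of_int (2 * k) * pi) * \<i>"
        using assms(4) [OF p(1)] by (auto simp: exp_eq)
      obtain l where l: "g q = h q + complex_of_real (of_int (2 * l) * pi) * \<i>"
        using assms(4) [OF q] by (auto simp: exp_eq)
      have "k \<noteq> l" using p(2) k l by auto
      have abs: "\<bar>2 * r * pi\<bar> = 2 * pi * \<bar>r\<bar>" for r :: real
        by (simp add: abs_mult)
      have "(g p - h p) - (g q - h q) = complex_of_real (2 * of_int (k - l) * pi) * \<i>"
        using k l by (simp add: algebra_simps)
      then have "norm ((g p - h p) - (g q - h q)) = \<bar>2 * of_int (k - l) * pi\<bar>"
        by (simp only: norm_mult norm_of_real norm_ii mult_1_right)
      then have "norm ((g p - h p) - (g q - h q)) = 2 * pi * \<bar>of_int (k - l)\<bar>"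
        by (simp only: abs)
      moreover have "(1::real) \<le> \<bar>of_int (k - l)\<bar>"
        using \<open>k \<noteq> l\<close> by linarith
      ultimately show ?thesis
        using mult_left_mono [of 1 "\<bar>of_int (k - l)\<bar> :: real" "2 * pi"] by simp
    qed
    then show "\<exists>e>0. \<forall>y. y \<in> S \<and> g y - h y \<noteq> g q - h q \<longrightarrow> e \<le> norm (g y - h y - (g q - h q))"
      by (intro exI [of _ "2 * pi"]) auto
  qed
  then obtain c where "\<And>q. q \<in> S \<Longrightarrow> g q - h q = c"
    by (auto simp: constant_on_def)
  then have "g b - h b = g a - h a"
    using assms by simp
  then show ?thesis by (simp add: algebra_simps)
qed

definition turns :: "(real \<Rightarrow> complex set) \<Rightarrow> int \<Rightarrow> bool" where
  "turns p k \<longleftrightarrow> (\<exists>g. continuous_on {0..1} g \<and> (\<forall>t\<in>{0..1}. exp (g t) = discriminant (p t)) \<and>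
     g 1 = g 0 + complex_of_real (of_int (2 * k) * pi) * \<i>)"

lemma discriminant_log_exists:
  fixes S :: "'b::real_normed_vector set"
  assumes K: "continuous_map (top_of_set S) (configuration_space n) K" and S: "convex S"
  obtains g where "continuous_on S g" "\<forall>q\<in>S. exp (g q) = discriminant (K q)"
proof -
  have "continuous_map (top_of_set S) euclidean (discriminant \<circ> K)"
    using K continuous_map_discriminant by (rule continuous_map_compose)
  then have "continuous_on S (discriminant \<circ> K)"
    by simp
  moreover have "(discriminant \<circ> K) q \<noteq> 0" if "q \<in> S" for q
    using continuous_map_image_subset_topspace [OF K] that discriminant_nonzero
    by (auto simp: topspace_configuration_space)
  ultimately obtain g where "continuous_on S g" "\<And>q. q \<in> S \<Longrightarrow> (discriminant \<circ> K) q = exp (g q)"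
    using continuous_logarithm_on_contractible [OF _ convex_imp_contractible [OF S]] by blast
  then show thesis
    using that by simp
qed

lemma turns_unique:
  assumes "turns p k" "turns p l"
  shows "k = l"
proof -
  obtain g where g: "continuous_on {0..1} g" "\<forall>t\<in>{0..1}. exp (g t) = discriminant (p t)"
      "g 1 = g 0 + complex_of_real (of_int (2 * k) * pi) * \<i>"
    using assms(1) by (auto simp: turns_def)
  obtain h where h: "continuous_on {0..1} h" "\<forall>t\<in>{0..1}. exp (h t) = discriminant (p t)"
      "h 1 = h 0 + complex_of_real (of_int (2 * l) * pi) * \<i>"
    using assms(2) by (auto simp: turns_def)
  have "g 1 - g 0 = h 1 - h 0"
    by (rule continuous_log_unique [of "{0..1::real}"]) (use g h in auto)
  then show ?thesis
    using g(3) h(3) by (simp flip: of_real_mult)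
qed

context
  fixes n :: nat and x :: "complex set"
  assumes x: "finite x" "card x = n"
begin

lemma turns_exists:
  assumes p: "p \<in> loops_at (configuration_space n) x"
  shows "\<exists>k. turns p k"
proof -
  have "continuous_map (top_of_set {0..1}) (configuration_space n) p"
    using p by (simp add: loops_at_def pathin_def)
  then obtain g where g: "continuous_on {0..1} g" "\<forall>t\<in>{0..1}. exp (g t) = discriminant (p t)"
    using discriminant_log_exists [OF _ convex_real_interval(5)] by blast
  then have "exp (g 1) = exp (g 0)"
    using p by (auto simp: loops_at_def)
  then obtain k where "g 1 = g 0 + complex_of_real (of_int (2 * k) * pi) * \<i>"
    by (auto simp: exp_eq)
  then show ?thesis
    unfolding turns_def using g by blast
qed

text \<open>A logarithm exists over the whole square. On the two sides where the configuration stays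
  at \<open>x\<close> it is constant, so its increments along the other two edges agree.\<close>

lemma turns_homotopic:
  assumes pq: "(p, q) \<in> loop_homotopy (configuration_space n) x" and p: "turns p k"
  shows "turns q k"
proof -
  obtain h :: "real \<times> real \<Rightarrow> complex set"
    where h: "continuous_map (top_of_set ({0..1} \<times> {0..1})) (configuration_space n) h"
    "\<forall>t. h (0, t) = p t" "\<forall>t. h (1, t) = q t" "\<forall>s\<in>{0..1}. h (s, 0) = x \<and> h (s, 1) = x"
    using pq by (rule loop_homotopyE)
  have conv: "convex ({0..1} \<times> {0..1} :: (real \<times> real) set)"
    by (intro convex_Times convex_real_interval)
  obtain g where g: "continuous_on ({0..1} \<times> {0..1}) g"
      "\<forall>q\<in>{0..1} \<times> {0..1}. exp (g q) = discriminant (h q)"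
    using discriminant_log_exists [OF h(1) conv] by blast
  have side: "g (1, t) = g (0, t)" if "t \<in> {0, 1}" for t
  proof -
    have "g (1, t) - g (0, t) = g (0, t) - g (0, t)"
      by (rule continuous_log_unique [of "{0..1::real}" "\<lambda>s. g (s, t)" "\<lambda>s. g (0, t)"])
        (use that g(2) h(4) in \<open>auto intro!: continuous_on_compose2 [OF g(1)] continuous_intros\<close>)
    then show ?thesis by simp
  qed
  have edge: "continuous_on {0..1} (\<lambda>t. g (s, t))" if "s \<in> {0..1}" for s
    using that by (intro continuous_on_compose2 [OF g(1)] continuous_intros) auto
  obtain f where f: "continuous_on {0..1} f" "\<forall>t\<in>{0..1}. exp (f t) = discriminant (p t)"
      "f 1 = f 0 + complex_of_real (of_int (2 * k) * pi) * \<i>"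
    using p by (auto simp: turns_def)
  have "g (0, 1) - g (0, 0) = f 1 - f 0"
    by (rule continuous_log_unique [of "{0..1::real}" "\<lambda>t. g (0, t)" f])
      (use edge f g(2) h(2) in auto)
  then have "g (1, 1) = g (1, 0) + complex_of_real (of_int (2 * k) * pi) * \<i>"
    using f(3) side [of 0] side [of 1] by (simp add: algebra_simps)
  then show ?thesis
    unfolding turns_def using edge [of 1] g(2) h(3)
    by (intro exI [of _ "\<lambda>t. g (1, t)"]) auto
qed

lemma turns_join:
  assumes "p \<in> loops_at (configuration_space n) x" "q \<in> loops_at (configuration_space n) x"
    and "turns p k" "turns q l"
  shows "turns (join_loops p q) (k + l)"
proof -
  obtain g where g: "continuous_on {0..1} g" "\<forall>t\<in>{0..1}. exp (g t) = discriminant (p t)"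
      "g 1 = g 0 + complex_of_real (of_int (2 * k) * pi) * \<i>"
    using assms(3) by (auto simp: turns_def)
  obtain h where h: "continuous_on {0..1} h" "\<forall>t\<in>{0..1}. exp (h t) = discriminant (q t)"
      "h 1 = h 0 + complex_of_real (of_int (2 * l) * pi) * \<i>"
    using assms(4) by (auto simp: turns_def)
  \<comment> \<open>The logarithms of the two loops need not match at the joint, but there they have
    the same exponential, so a constant shift of the second one makes them match.\<close>
  define h' where "h' = (\<lambda>t. h t + (g 1 - h 0))"
  have "exp (g 1) = exp (h 0)"
    using g(2) h(2) assms(1,2) by (auto simp: loops_at_def)
  then have "exp (h' t) = exp (h t)" for t
    by (simp add: h'_def exp_add exp_diff)
  moreover have "path (g +++ h')"
    using g h by (intro path_join_imp)
      (auto simp: path_def pathfinish_def pathstart_def h'_def intro!: continuous_intros)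
  ultimately show ?thesis
    unfolding turns_def using g h
    by (intro exI [of _ "g +++ h'"])
      (auto simp: path_def joinpaths_def join_loops_def h'_def algebra_simps)
qed

definition braid_length :: "(real \<Rightarrow> complex set) set \<Rightarrow> int" where
  "braid_length A = (THE k. \<exists>p\<in>A. turns p k)"

lemma braid_length_eqI:
  assumes "p \<in> loops_at (configuration_space n) x" "turns p k"
  shows "braid_length (loop_class (configuration_space n) x p) = k"
  unfolding braid_length_def
proof (rule the_equality)
  have "p \<in> loop_class (configuration_space n) x p"
    unfolding loop_class_def using equiv_class_self [OF equiv_loop_homotopy assms(1)] .
  then show "\<exists>p\<in>loop_class (configuration_space n) x p. turns p k"
    using assms(2) by blast
  fix l assume "\<exists>q\<in>loop_class (configuration_space n) x p. turns q l"
  then obtain q where q: "(p, q) \<in> loop_homotopy (configuration_space n) x" "turns q l"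
    by (auto simp: loop_class_mem)
  then have "turns q k"
    using turns_homotopic assms(2) by blast
  then show "l = k"
    using turns_unique q(2) by blast
qed

lemma braid_length_mult:
  assumes A: "A \<in> carrier (fundamental_group (configuration_space n) x)"
    and B: "B \<in> carrier (fundamental_group (configuration_space n) x)"
  shows "braid_length (A \<otimes>\<^bsub>fundamental_group (configuration_space n) x\<^esub> B) =
    braid_length A + braid_length B"
proof -
  obtain p where p: "p \<in> loops_at (configuration_space n) x" "A = loop_class (configuration_space n) x p"
    using A by (rule carrier_loop_class)
  obtain q where q: "q \<in> loops_at (configuration_space n) x" "B = loop_class (configuration_space n) x q"
    using B by (rule carrier_loop_class)
  obtain k l where kl: "turns p k" "turns q l"
    using turns_exists p q by blast
  have "braid_length A = k" "braid_length B = l"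
    using braid_length_eqI p q kl by auto
  moreover have "braid_length (loop_class (configuration_space n) x (join_loops p q)) = k + l"
    using p q kl by (intro braid_length_eqI join_loops_loop turns_join)
  ultimately show ?thesis
    using p q by (simp add: loop_class_mult)
qed

end

text \<open>Only the difference of the two moving points contributes: it makes half a turn, and it occurs
  squared. The contribution of any other point \<open>r\<close> has the logarithm \<open>2 l(f) + 2 l(g)\<close> for a branch
  \<open>l\<close> of \<open>log (z - r)\<close> on the convex set \<open>U\<close>, and this sum takes the same value at both ends.\<close>

lemma turns_twist_loop:
  assumes x: "finite x" and U: "convex U" "U \<inter> x = {a, b}" and ne: "a \<noteq> b"
    and fg: "twist_strings a b U f g"
  shows "turns (twist_loop x a b f g) 1"
proof -
  define R where "R = x - {a, b}"
  have R: "finite R" "\<And>r. r \<in> R \<Longrightarrow> r \<notin> U"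
    using x U by (auto simp: R_def)
  have fgU: "f t \<in> U" "g t \<in> U" if "t \<in> {0..1}" for t
    using fg that by (auto simp: twist_strings_def)
  have ends: "f 0 = a" "f 1 = b" "g 0 = b" "g 1 = a"
    using fg by (auto simp: twist_strings_def)
  have cont: "continuous_on {0..1} f" "continuous_on {0..1} g"
    using fg by (auto simp: twist_strings_def)
  have "\<exists>l. continuous_on U l \<and> (\<forall>z\<in>U. exp (l z) = z - r)" if "r \<in> R" for r
  proof -
    have "continuous_on U (\<lambda>z. z - r)"
      by (intro continuous_intros)
    moreover have "\<And>z. z \<in> U \<Longrightarrow> z - r \<noteq> 0"
      using R(2) [OF that] by auto
    ultimately obtain l where "continuous_on U l" "\<And>z. z \<in> U \<Longrightarrow> z - r = exp (l z)"
      using continuous_logarithm_on_contractible [OF _ convex_imp_contractible [OF U(1)]] by blast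
    then show ?thesis by auto
  qed
  then obtain l where l: "\<And>r. r \<in> R \<Longrightarrow> continuous_on U (l r)" "\<And>r z. r \<in> R \<Longrightarrow> z \<in> U \<Longrightarrow> exp (l r z) = z - r"
    by metis
  \<comment> \<open>The normalization makes the difference run from \<open>- \<i>\<close> to
    \<open>\<i>\<close> through the right half-plane, where \<open>Ln\<close> is continuous. It
    contributes \<open>pi * \<i>\<close>, and \<open>2 * pi * \<i>\<close> after squaring: one
    turn.\<close>
  define \<xi> where "\<xi> = (\<lambda>t. (f t - g t) / (\<i> * (a - b)))"
  have \<xi>_ends: "\<xi> 0 = - \<i>" "\<xi> 1 = \<i>"
    using ends ne by (simp_all add: \<xi>_def field_simps)
  have \<xi>_slit: "\<xi> t \<notin> \<real>\<^sub>\<le>\<^sub>0" "\<xi> t \<noteq> 0" if t: "t \<in> {0..1}" for t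
  proof -
    consider "t = 0" | "t = 1" | "t \<in> {0<..<1}"
      using t by fastforce
    then have "\<xi> t \<notin> \<real>\<^sub>\<le>\<^sub>0 \<and> \<xi> t \<noteq> 0"
    proof cases
      case 3
      then have pos: "Im (cnj (a - b) * (f t - g t)) > 0"
        using fg by (auto simp: twist_strings_def)
      have "\<xi> t = - \<i> * (cnj (a - b) * (f t - g t)) / of_real ((norm (a - b))\<^sup>2)"
      proof -
        have "X / (\<i> * u) = - \<i> * (cnj u * X) / of_real ((norm u)\<^sup>2)" if "u \<noteq> 0" for X u
          unfolding complex_norm_square using that by (simp add: field_simps)
        then show ?thesis
          unfolding \<xi>_def using ne right_minus_eq by metis
      qed
      moreover have "Re (- \<i> * w / of_real r) = Im w / r" for w r
        by (simp add: Re_divide_of_real)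
      ultimately have "Re (\<xi> t) = Im (cnj (a - b) * (f t - g t)) / (norm (a - b))\<^sup>2"
        by (simp only:)
      then have "Re (\<xi> t) > 0"
        using pos ne by simp
      then show ?thesis
        by (auto simp: complex_nonpos_Reals_iff)
    qed (auto simp: \<xi>_ends complex_nonpos_Reals_iff)
    then show "\<xi> t \<notin> \<real>\<^sub>\<le>\<^sub>0" "\<xi> t \<noteq> 0" by auto
  qed
  \<comment> \<open>A logarithm of the constant part: the sign, the discriminant of the fixed points
    and the factor removed in \<open>\<xi>\<close>.\<close>
  define c where "c = Ln (- (discriminant R * (\<i> * (a - b))\<^sup>2))"
  have "- (discriminant R * (\<i> * (a - b))\<^sup>2) \<noteq> 0"
    using discriminant_nonzero [OF R(1)] ne by simp
  then have c: "exp c = - (discriminant R * (\<i> * (a - b))\<^sup>2)"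
    by (simp add: c_def)
  define q where "q = (\<lambda>t. c + 2 * Ln (\<xi> t) + (\<Sum>r\<in>R. 2 * l r (f t) + 2 * l r (g t)))"
  have "continuous_on {0..1} q"
    unfolding q_def
  proof (intro continuous_intros)
    show "continuous_on {0..1} \<xi>"
      unfolding \<xi>_def using cont ne by (intro continuous_intros) auto
    show "continuous_on {0..1} (\<lambda>t. l r (f t))" "continuous_on {0..1} (\<lambda>t. l r (g t))" if "r \<in> R" for r
      using fgU by (auto intro!: continuous_on_compose2 [OF l(1) [OF that]] cont)
  qed (use \<xi>_slit in auto)
  moreover have "exp (q t) = discriminant (twist_loop x a b f g t)" if t: "t \<in> {0..1}" for t
  proof -
    have neq: "f t \<noteq> g t"
      using \<xi>_slit(2) [OF t] by (auto simp: \<xi>_def)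
    have notin: "f t \<notin> R" "g t \<notin> R"
      using R(2) fgU [OF t] by auto
    have "twist_loop x a b f g t = insert (f t) (insert (g t) R)"
      by (auto simp: twist_loop_def R_def)
    then have "discriminant (twist_loop x a b f g t) =
        discriminant R * (\<Prod>v\<in>R. - ((g t - v)\<^sup>2)) * (- ((f t - g t)\<^sup>2) * (\<Prod>v\<in>R. - ((f t - v)\<^sup>2)))"
      using R(1) notin neq by (simp add: discriminant_insert)
    also have "\<dots> = - discriminant R * (f t - g t)\<^sup>2 * (\<Prod>v\<in>R. (f t - v)\<^sup>2 * (g t - v)\<^sup>2)"
      by (simp add: prod.distrib mult_ac flip: prod.distrib)
    also have "(\<Prod>v\<in>R. (f t - v)\<^sup>2 * (g t - v)\<^sup>2) = (\<Prod>r\<in>R. exp (2 * l r (f t) + 2 * l r (g t)))"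
    proof (rule prod.cong [OF HOL.refl])
      fix r assume r: "r \<in> R"
      show "(f t - r)\<^sup>2 * (g t - r)\<^sup>2 = exp (2 * l r (f t) + 2 * l r (g t))"
        using l(2) [OF r fgU(1) [OF t]] l(2) [OF r fgU(2) [OF t]] by (simp add: exp_add exp_double)
    qed
    also have "- discriminant R * (f t - g t)\<^sup>2 = exp (c + 2 * Ln (\<xi> t))"
    proof -
      have "exp (c + 2 * Ln (\<xi> t)) = - (discriminant R * (\<i> * (a - b))\<^sup>2) * (\<xi> t)\<^sup>2"
        using c \<xi>_slit(2) [OF t] by (simp add: exp_add exp_double)
      also have "\<dots> = - discriminant R * (\<i> * (a - b) * \<xi> t)\<^sup>2"
        by (simp add: power_mult_distrib)
      also have "\<i> * (a - b) * \<xi> t = f t - g t"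
        using ne by (simp add: \<xi>_def)
      finally show ?thesis
        by (rule HOL.sym)
    qed
    finally show ?thesis
      by (simp add: q_def exp_add exp_sum [OF R(1)])
  qed
  moreover have "q 1 = q 0 + complex_of_real (of_int (2 * 1) * pi) * \<i>"
    by (simp add: q_def ends \<xi>_ends Ln_minus_ii Ln_ii algebra_simps)
  ultimately show ?thesis
    unfolding turns_def by blast
qed

section \<open>Invariants of half twists\<close>

context
  fixes x :: "complex set"
  assumes x: "finite x" "x \<noteq> {}"
begin

lemma braid_length_pair_braid:
  assumes ab: "nonobstructing_pair x a b"
  shows "braid_length (pair_braid x a b) = 1"
proof (rule pair_braid_representative [OF x(1) ab])
  fix \<epsilon> f g
  assume *: "tube a b \<epsilon> \<inter> x = {a, b}" "twist_strings a b (tube a b \<epsilon>) f g"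
    "twist_loop x a b f g \<in> loops_at (configuration_space (card x)) x"
    "pair_braid x a b = loop_class (configuration_space (card x)) x (twist_loop x a b f g)"
  have "a \<noteq> b" using ab by (simp add: nonobstructing_pair_def)
  then show ?thesis
    unfolding *(4) using x(1) by (intro braid_length_eqI *(3) turns_twist_loop [OF x(1) convex_tube *(1)] *(2)) auto
qed

lemma monodromy_pair_braid:
  assumes ab: "nonobstructing_pair x a b" and z: "z \<in> x"
  shows "monodromy (pair_braid x a b) z = (if z = a then b else if z = b then a else z)"
proof (rule pair_braid_representative [OF x(1) ab])
  fix \<epsilon> f g
  assume *: "twist_strings a b (tube a b \<epsilon>) f g"
    "twist_loop x a b f g \<in> loops_at (configuration_space (card x)) x"
    "pair_braid x a b = loop_class (configuration_space (card x)) x (twist_loop x a b f g)"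
  have n: "card x > 0" using x by (simp add: card_gt_0_iff)
  have "string_end (twist_loop x a b f g) z (if z = a then b else if z = b then a else z)"
    unfolding string_end_def twist_loop_def
    using *(1) z by (intro exI [of _ "if z = a then f else if z = b then g else (\<lambda>_. z)"])
      (auto simp: twist_strings_def)
  then show ?thesis
    unfolding *(3) by (intro monodromy_eqI [OF x(1) HOL.refl n *(2)])
qed

end

section \<open>Roots of unity\<close>

text \<open>Twice the signed area of the triangle; negative values mean clockwise order.\<close>

definition orient :: "complex \<Rightarrow> complex \<Rightarrow> complex \<Rightarrow> real" where
  "orient a b c = Im (cnj (b - a) * (c - a))"

lemma orient_rotate: "orient b c a = orient a b c"
  by (simp add: orient_def algebra_simps)

lemma orient_swap: "orient a c b = - orient a b c"
  by (simp add: orient_def algebra_simps)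

lemma orient_degenerate [simp]: "orient a b a = 0" "orient a b b = 0"
  by (simp_all add: orient_def algebra_simps)

text \<open>The sum-to-product formulas turn the determinant into a product of sines, so its sign
  can be read off factor by factor.\<close>

lemma orient_cis:
  "orient (cis \<alpha>) (cis \<beta>) (cis \<gamma>) = 4 * sin ((\<beta> - \<alpha>) / 2) * sin ((\<gamma> - \<alpha>) / 2) * sin ((\<gamma> - \<beta>) / 2)"
proof -
  define u v s t where "u = (\<beta> - \<alpha>) / 2" "v = (\<gamma> - \<alpha>) / 2" "s = (\<beta> + \<alpha>) / 2" "t = (\<gamma> + \<alpha>) / 2"
  have neg: "(\<alpha> - \<beta>) / 2 = - u" "(\<alpha> - \<gamma>) / 2 = - v"
    by (simp_all add: u_v_s_t_def minus_divide_left)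
  have d: "sin \<beta> - sin \<alpha> = 2 * sin u * cos s" "sin \<gamma> - sin \<alpha> = 2 * sin v * cos t"
    "cos \<beta> - cos \<alpha> = 2 * sin s * - sin u" "cos \<gamma> - cos \<alpha> = 2 * sin t * - sin v"
    using sin_diff_sin [of \<beta> \<alpha>] sin_diff_sin [of \<gamma> \<alpha>] cos_diff_cos [of \<beta> \<alpha>] cos_diff_cos [of \<gamma> \<alpha>]
    unfolding neg sin_minus u_v_s_t_def [symmetric] .
  have "orient (cis \<alpha>) (cis \<beta>) (cis \<gamma>) =
      (cos \<beta> - cos \<alpha>) * (sin \<gamma> - sin \<alpha>) - (sin \<beta> - sin \<alpha>) * (cos \<gamma> - cos \<alpha>)"
    by (simp add: orient_def algebra_simps)
  also have "\<dots> = 2 * sin s * - sin u * (2 * sin v * cos t) - 2 * sin u * cos s * (2 * sin t * - sin v)"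
    unfolding d ..
  also have "\<dots> = 4 * sin u * sin v * sin (t - s)"
    by (simp add: sin_diff algebra_simps)
  also have "t - s = (\<gamma> - \<beta>) / 2"
    by (simp add: u_v_s_t_def diff_divide_distrib add_divide_distrib)
  finally show ?thesis
    by (simp add: u_v_s_t_def)
qed

text \<open>The numbering is clockwise, so that increasing lists of indices give clockwise numberings.\<close>

definition vertex :: "nat \<Rightarrow> nat \<Rightarrow> complex" where
  "vertex n k = cis (- (2 * pi * real k / real n))"

lemma norm_vertex [simp]: "norm (vertex n k) = 1"
  by (simp add: vertex_def)

lemma bij_betw_vertex:
  assumes "n > 0"
  shows "bij_betw (vertex n) {..<n} (roots_of_unity n)"
proof -
  have "bij_betw cnj {z. z ^ n = 1} {z. z ^ n = 1}"
    by (rule bij_betw_byWitness [of _ cnj]) (auto simp flip: complex_cnj_power)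
  from bij_betw_trans [OF Complex.bij_betw_roots_unity [OF assms] this] show ?thesis
    by (simp add: roots_of_unity_def vertex_def [abs_def] o_def cis_cnj)
qed

text \<open>Each of the three half differences of angles lies strictly between \<open>- pi\<close>
  and 0, so all three sines are negative.\<close>

lemma orient_vertex_less:
  assumes "i < j" "j < k" "k < n"
  shows "orient (vertex n i) (vertex n j) (vertex n k) < 0"
proof -
  have neg: "sin ((- (2 * pi * real q / real n) - - (2 * pi * real p / real n)) / 2) < 0"
    if "p < q" "q < n" for p q
  proof -
    have eq: "(- (2 * pi * real q / real n) - - (2 * pi * real p / real n)) / 2 = - (pi * ((real q - real p) / real n))"
      using that by (simp add: field_simps)
    have "0 < (real q - real p) / real n" "(real q - real p) / real n < 1"
      using that by (simp_all add: field_simps)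
    moreover have "sin (pi * x) > 0" if "0 < x" "x < 1" for x
      using that by (intro sin_gt_zero) auto
    ultimately have "sin (pi * ((real q - real p) / real n)) > 0"
      by blast
    then show ?thesis
      unfolding eq sin_minus by simp
  qed
  show ?thesis
    unfolding vertex_def orient_cis
    using neg [of i j] neg [of i k] neg [of j k] assms by (simp add: mult_pos_neg mult_neg_neg)
qed

lemma orient_vertex:
  assumes "i < n" "j < n" "k < n" "cyc3 i j k"
  shows "orient (vertex n i) (vertex n j) (vertex n k) < 0"
proof -
  consider "i < j" "j < k" | "j < k" "k < i" | "k < i" "i < j"
    using assms(4) by (auto simp: cyc3_def)
  then show ?thesis
  proof cases
    case 1
    then show ?thesis using assms by (intro orient_vertex_less)
  next
    case 2
    then have "orient (vertex n j) (vertex n k) (vertex n i) < 0"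
      using assms by (intro orient_vertex_less)
    then show ?thesis by (simp only: orient_rotate)
  next
    case 3
    then have "orient (vertex n k) (vertex n i) (vertex n j) < 0"
      using assms by (intro orient_vertex_less)
    then show ?thesis by (metis orient_rotate)
  qed
qed

lemma cyc3_iff_orient:
  assumes "i < n" "j < n" "k < n" "i \<noteq> j" "j \<noteq> k" "i \<noteq> k"
  shows "cyc3 i j k \<longleftrightarrow> orient (vertex n i) (vertex n j) (vertex n k) < 0"
proof -
  have "cyc3 i j k \<or> cyc3 i k j"
    using assms by (auto simp: cyc3_def)
  then show ?thesis
    using orient_vertex [of i n j k] orient_vertex [of i n k j] assms
      orient_swap [of "vertex n i" "vertex n k" "vertex n j"] by auto
qed

section \<open>Convex hulls of sets of roots of unity\<close>

lemma convex_hull_unit_circle: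
  fixes p :: complex
  assumes "\<And>z. z \<in> A \<Longrightarrow> norm z = 1" "p \<in> convex hull A" "norm p = 1"
  shows "p \<in> A"
proof (rule ccontr)
  assume "p \<notin> A"
  \<comment> \<open>The circle is strictly convex: all its points other than \<open>p\<close> lie
    strictly on one side of the tangent at \<open>p\<close>.\<close>
  have "A \<subseteq> {z. p \<bullet> z < 1}"
  proof
    fix z assume "z \<in> A"
    then have pos: "0 < (norm (p - z))\<^sup>2" and "norm z = 1"
      using \<open>p \<notin> A\<close> assms(1) by auto
    then have "p \<bullet> z = (2 - (norm (p - z))\<^sup>2) / 2"
      using assms(3) dot_norm_neg [of p z] by simp
    moreover have "a < 1" if "a = (2 - N) / 2" "0 < N" for a N :: real
      using that by simp
    ultimately show "z \<in> {z. p \<bullet> z < 1}"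
      using pos by blast
  qed
  then have "convex hull A \<subseteq> {z. p \<bullet> z < 1}"
    by (intro hull_minimal convex_halfspace_lt)
  then show False
    using assms(2,3) dot_square_norm [of p] by auto
qed

lemma orient_halfplane: "orient a b p = (\<i> * (b - a)) \<bullet> p - (\<i> * (b - a)) \<bullet> a"
  by (simp add: orient_def inner_complex_def algebra_simps)

lemma convex_orient: "convex {p. orient a b p \<ge> 0}" "convex {p. orient a b p < 0}"
  using convex_halfspace_ge [of "(\<i> * (b - a)) \<bullet> a" "\<i> * (b - a)"]
    convex_halfspace_lt [of "\<i> * (b - a)" "(\<i> * (b - a)) \<bullet> a"]
  by (simp_all add: orient_halfplane algebra_simps)

context
  fixes n :: nat
  assumes n: "n \<ge> 1"
begin

private abbreviation e where "e \<equiv> vertex n"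

lemma inj_vertex: "inj_on e {..<n}"
  using bij_betw_vertex [of n] n by (simp add: bij_betw_def)

lemma vertex_eq_iff: "\<lbrakk>i < n; j < n\<rbrakk> \<Longrightarrow> e i = e j \<longleftrightarrow> i = j"
  using inj_vertex by (auto simp: inj_on_def)

lemma image_vertex: "e ` {..<n} = roots_of_unity n"
  using bij_betw_vertex [of n] n by (simp add: bij_betw_def)

lemma finite_roots: "finite (roots_of_unity n)" and card_roots: "card (roots_of_unity n) = n"
  using image_vertex inj_vertex by (metis finite_imageI finite_lessThan, metis card_image card_lessThan)

lemma hull_roots:
  assumes "A \<subseteq> {..<n}"
  shows "convex hull (e ` A) \<inter> roots_of_unity n = e ` A"
proof
  show "convex hull (e ` A) \<inter> roots_of_unity n \<subseteq> e ` A"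
  proof
    fix p assume p: "p \<in> convex hull (e ` A) \<inter> roots_of_unity n"
    then have "norm p = 1"
      unfolding image_vertex [symmetric] by auto
    moreover have "norm z = 1" if "z \<in> e ` A" for z
      using that by auto
    ultimately show "p \<in> e ` A"
      using p convex_hull_unit_circle [of "e ` A" p] by blast
  qed
  show "e ` A \<subseteq> convex hull (e ` A) \<inter> roots_of_unity n"
    using hull_subset [of "e ` A" convex] assms image_vertex by blast
qed

text \<open>The line through the vertices \<open>b1\<close> and \<open>b2\<close> separates: the
  remaining vertices of \<open>B\<close> lie on the arc between these two, those of \<open>A\<close>
  strictly on the other side. If \<open>b1 = b2\<close> there is no line, and the single vertex is
  not in the hull of \<open>A\<close> because it lies on the circle.\<close>

lemma disjoint_hulls_interval:
  assumes A: "A \<subseteq> {..<n}" and B: "B \<subseteq> {b1..b2}" "b1 \<in> B" "b2 \<in> B" "b2 < n" and disj: "A \<inter> {b1..b2} = {}"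
  shows "convex hull (e ` A) \<inter> convex hull (e ` B) = {}"
proof (cases "b1 = b2")
  case True
  then have B1: "B = {b1}" using B by auto
  have "e b1 \<notin> convex hull (e ` A)"
  proof
    assume "e b1 \<in> convex hull (e ` A)"
    moreover have "e b1 \<in> roots_of_unity n"
      unfolding image_vertex [symmetric] using B(4) True by simp
    ultimately have "e b1 \<in> e ` A"
      using hull_roots [OF A] by blast
    then obtain a where "a \<in> A" "e b1 = e a" by blast
    then have "b1 \<in> A"
      using A B(4) True vertex_eq_iff [of b1 a] by auto
    then show False using disj True by auto
  qed
  then show ?thesis using B1 by simp
next
  case False
  then have "b1 < b2" using B by fastforce
  have "e ` A \<subseteq> {p. orient (e b1) (e b2) p < 0}"
  proof
    fix p assume "p \<in> e ` A"
    then obtain a where a: "a \<in> A" "p = e a" by blast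
    then have "a < b1 \<or> b2 < a" "a < n"
      using disj A by auto
    then have "cyc3 b1 b2 a"
      using \<open>b1 < b2\<close> by (auto simp: cyc3_def)
    then show "p \<in> {p. orient (e b1) (e b2) p < 0}"
      using orient_vertex [of b1 n b2 a] a \<open>a < n\<close> \<open>b1 < b2\<close> B(4) by auto
  qed
  then have 1: "convex hull (e ` A) \<subseteq> {p. orient (e b1) (e b2) p < 0}"
    by (intro hull_minimal convex_orient)
  have "e ` B \<subseteq> {p. orient (e b1) (e b2) p \<ge> 0}"
  proof
    fix p assume "p \<in> e ` B"
    then obtain b where b: "b \<in> B" "p = e b" by blast
    then consider "b = b1" | "b = b2" | "b1 < b" "b < b2"
      using B(1) by fastforce
    then show "p \<in> {p. orient (e b1) (e b2) p \<ge> 0}"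
    proof cases
      case 3
      then have "orient (e b1) (e b) (e b2) < 0"
        using orient_vertex_less B(4) by blast
      then show ?thesis
        using b orient_swap [of "e b1" "e b2" "e b"] by simp
    qed (use b in auto)
  qed
  then have 2: "convex hull (e ` B) \<subseteq> {p. orient (e b1) (e b2) p \<ge> 0}"
    by (intro hull_minimal convex_orient)
  show ?thesis using 1 2 by fastforce
qed

text \<open>If the minimum of \<open>A\<close> is outside the range of \<open>B\<close>, then so is
  all of \<open>A\<close>, since the sets do not cross. Otherwise the minimum of \<open>B\<close>
  lies below that of \<open>A\<close>, and the roles are exchanged.\<close>

lemma disjoint_hulls:
  assumes A: "A \<subseteq> {..<n}" "A \<noteq> {}" and B: "B \<subseteq> {..<n}" "B \<noteq> {}" and disj: "A \<inter> B = {}"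
    and nc: "noncrossing A B"
  shows "convex hull (e ` A) \<inter> convex hull (e ` B) = {}"
proof -
  have *: "convex hull (e ` A) \<inter> convex hull (e ` B) = {}"
    if A: "A \<subseteq> {..<n}" "A \<noteq> {}" and B: "B \<subseteq> {..<n}" "B \<noteq> {}" and disj: "A \<inter> B = {}"
      and nc: "noncrossing A B" and out: "\<not> (Min B < Min A \<and> Min A < Max B)" for A B
  proof (rule disjoint_hulls_interval [of _ _ "Min B" "Max B"])
    have fin: "finite A" "finite B"
      using A B finite_subset by blast+
    have mm: "Min B \<in> B" "Max B \<in> B" "Min A \<in> A"
      using fin A B by auto
    show "B \<subseteq> {Min B..Max B}" "Min B \<in> B" "Max B \<in> B" "Max B < n"
      using fin mm B(1) by auto
    have "a \<notin> {Min B..Max B}" if a: "a \<in> A" for a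
    proof
      assume "a \<in> {Min B..Max B}"
      moreover have "a \<noteq> Min B" "a \<noteq> Max B"
        using a mm disj by auto
      ultimately have "Min B < a \<and> a < Max B" by auto
      then have "Min B < Min A \<and> Min A < Max B"
        using nc a mm unfolding noncrossing_def by blast
      then show False using out by simp
    qed
    then show "A \<inter> {Min B..Max B} = {}" by blast
  qed (use A in auto)
  show ?thesis
  proof (cases "Min B < Min A \<and> Min A < Max B")
    case False
    then show ?thesis using * [OF A B disj nc] by blast
  next
    case True
    then have "convex hull (e ` B) \<inter> convex hull (e ` A) = {}"
      using disj by (intro * A B noncrossing_sym [OF nc disj]) auto
    then show ?thesis by blast
  qed
qed

text \<open>Four points in the plane satisfy an affine relation whose coefficients are the signed
  areas of the triangles formed by the other three. In cyclic order the signs make it an equality of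
  two positive combinations, one on each diagonal; dividing by the total weight gives the common
  point.\<close>

lemma crossing_chords_meet:
  assumes "i < n" "j < n" "k < n" "l < n" and c: "cyc3 i j k" "cyc3 j k l" "cyc3 i k l" "cyc3 i j l"
  shows "closed_segment (e i) (e k) \<inter> closed_segment (e j) (e l) \<noteq> {}"
proof -
  define a b c d where "a = e i" "b = e j" "c = e k" "d = e l"
  note defs = this
  define A B C D where "A = - orient b c d" "B = - orient a c d" "C = - orient a b d" "D = - orient a b c"
  have pos: "A > 0" "B > 0" "C > 0" "D > 0"
    using assms orient_vertex by (auto simp: A_B_C_D_def defs)
  have sum: "A + C = B + D"
    by (simp add: A_B_C_D_def orient_def algebra_simps)
  have comb: "A *\<^sub>R a + C *\<^sub>R c = B *\<^sub>R b + D *\<^sub>R d"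
    by (simp add: complex_eq_iff A_B_C_D_def orient_def algebra_simps)
  define s where "s = A + C"
  have s: "s > 0" "s = A + C" "s = B + D"
    using pos sum by (auto simp: s_def)
  have seg: "(1 / s) *\<^sub>R (X *\<^sub>R p + Y *\<^sub>R q) \<in> closed_segment p q" if "X > 0" "Y > 0" "s = X + Y" for X Y p q
  proof -
    have "(1 / s) *\<^sub>R (X *\<^sub>R p + Y *\<^sub>R q) = (1 - Y / s) *\<^sub>R p + (Y / s) *\<^sub>R q"
      using that s(1) by (simp add: scaleR_add_right diff_divide_eq_iff divide_simps)
    moreover have "0 \<le> Y / s" "Y / s \<le> 1"
      using that s(1) by auto
    ultimately show ?thesis
      unfolding in_segment by blast
  qed
  have "(1 / s) *\<^sub>R (A *\<^sub>R a + C *\<^sub>R c) \<in> closed_segment a c" "(1 / s) *\<^sub>R (A *\<^sub>R a + C *\<^sub>R c) \<in> closed_segment b d"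
    using seg [of A C a c] seg [of B D b d] pos s comb by auto
  then show ?thesis
    unfolding defs by blast
qed

lemma noncrossing_if_disjoint_hulls:
  assumes A: "A \<subseteq> {..<n}" and B: "B \<subseteq> {..<n}"
    and hulls: "convex hull (e ` A) \<inter> convex hull (e ` B) = {}"
  shows "noncrossing A B"
proof -
  have disj: "A \<inter> B = {}"
  proof (rule ccontr)
    assume "A \<inter> B \<noteq> {}"
    then obtain k where "k \<in> A" "k \<in> B" by blast
    then have "e k \<in> convex hull (e ` A)" "e k \<in> convex hull (e ` B)"
      by (auto intro: hull_inc)
    then show False using hulls by blast
  qed
  have seg: "closed_segment (e i) (e j) \<subseteq> convex hull (e ` S)" if "i \<in> S" "j \<in> S" for i j S
    using that by (intro closed_segment_subset convex_convex_hull) (auto intro: hull_inc)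
  have imp: "c < a' \<and> a' < c'" if m: "c \<in> B" "c' \<in> B" "a \<in> A" "a' \<in> A" "c < a" "a < c'" for a a' c c'
  proof (rule ccontr)
    assume "\<not> ?thesis"
    moreover have "a' \<noteq> c" "a' \<noteq> c'"
      using m disj by auto
    ultimately have "a' < c \<or> c' < a'" by linarith
    then have "cyc3 c a c'" "cyc3 a c' a'" "cyc3 c c' a'" "cyc3 c a a'"
      using m(5,6) by (auto simp: cyc3_def)
    moreover have "c < n" "a < n" "c' < n" "a' < n"
      using m A B by auto
    ultimately have "closed_segment (e c) (e c') \<inter> closed_segment (e a) (e a') \<noteq> {}"
      by (intro crossing_chords_meet)
    then show False
      using seg [OF m(1,2)] seg [OF m(3,4)] hulls by blast
  qed
  then show ?thesis
    unfolding noncrossing_def by blast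
qed

text \<open>With three or more vertices the hull is two-dimensional, because a triangle with nonzero
  \<open>orient\<close> is not collinear. All the vertices are extreme, because a point of the
  circle is never in the hull of others.\<close>

lemma convex_subset_roots:
  assumes A: "A \<subseteq> {..<n}" "A \<noteq> {}"
  shows "convex_subset (e ` A)"
proof -
  have fin: "finite A" using A finite_subset by blast
  have card: "card (e ` A) = card A"
    by (rule card_image) (rule inj_on_subset [OF inj_vertex A(1)])
  have "card A \<noteq> 0" using fin A by simp
  consider "card A = 1" | "card A = 2" | "card A \<ge> 3"
    using \<open>card A \<noteq> 0\<close> by linarith
  then show ?thesis
  proof cases
    case 3
    have "\<exists>i\<in>A. \<exists>j\<in>A. \<exists>k\<in>A. i < j \<and> j < k"
    proof -
      let ?xs = "sorted_list_of_set A"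
      have "length ?xs \<ge> 3" "set ?xs = A" "sorted_wrt (<) ?xs"
        using 3 fin by auto
      then have "?xs ! 0 \<in> A" "?xs ! 1 \<in> A" "?xs ! 2 \<in> A" "?xs ! 0 < ?xs ! 1" "?xs ! 1 < ?xs ! 2"
        by (metis nth_mem numeral_3_eq_3 less_le_trans zero_less_Suc,
            metis nth_mem numeral_3_eq_3 less_le_trans Suc_less_eq One_nat_def zero_less_Suc,
            metis nth_mem numeral_3_eq_3 less_le_trans lessI numeral_2_eq_2,
            simp_all add: sorted_wrt_nth_less)
      then show ?thesis by blast
    qed
    then obtain i j k where ijk: "i \<in> A" "j \<in> A" "k \<in> A" "i < j" "j < k" by blast
    then have neg: "orient (e i) (e j) (e k) < 0"
      using A by (intro orient_vertex_less) auto
    have "\<not> collinear (e ` A)"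
    proof
      assume "collinear (e ` A)"
      then obtain u where u: "\<forall>x\<in>e ` A. \<forall>y\<in>e ` A. \<exists>c. x - y = c *\<^sub>R u"
        by (auto simp: collinear_def)
      obtain c1 c2 where "e j - e i = c1 *\<^sub>R u" "e k - e i = c2 *\<^sub>R u"
        using u ijk by blast
      then have "orient (e i) (e j) (e k) = 0"
        unfolding orient_def by (simp add: algebra_simps)
      then show False using neg by simp
    qed
    then have "aff_dim (e ` A) > 1"
      by (simp add: collinear_aff_dim)
    moreover have "aff_dim (e ` A) \<le> 2"
      using aff_dim_le_DIM [of "e ` A"] by simp
    ultimately have dim: "aff_dim (convex hull (e ` A)) = 2"
      by (simp add: aff_dim_convex_hull)
    have "v extreme_point_of (convex hull (e ` A)) \<longleftrightarrow> v \<in> e ` A" for v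
    proof (rule extreme_point_of_convex_hull_convex_independent)
      show "compact (e ` A)"
        using fin by (intro finite_imp_compact finite_imageI)
      fix p assume p: "p \<in> e ` A"
      show "p \<notin> convex hull (e ` A - {p})"
      proof
        assume "p \<in> convex hull (e ` A - {p})"
        then have "p \<in> e ` A - {p}"
          by (rule convex_hull_unit_circle [rotated]) (use p in auto)
        then show False by simp
      qed
    qed
    moreover have "polytope (convex hull (e ` A))"
      using fin by (intro polytope_convex_hull finite_imageI)
    ultimately show ?thesis
      unfolding convex_subset_def using dim
      by (intro disjI2 exI [of _ "convex hull (e ` A)"]) auto
  qed (simp_all add: convex_subset_def card)
qed

lemma nonobstructing_pair_roots:
  assumes "i < n" "j < n" "i \<noteq> j"
  shows "nonobstructing_pair (roots_of_unity n) (e i) (e j)"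
  using hull_roots [of "{i, j}"] assms image_vertex vertex_eq_iff [of i j]
  by (auto simp: nonobstructing_pair_def segment_convex_hull)

end

section \<open>Braids at the roots of unity\<close>

lemma cyclic_listI:
  "(\<And>i j k. \<lbrakk>i < j; j < k; k < length xs\<rbrakk> \<Longrightarrow> cyc3 (xs ! i) (xs ! j) (xs ! k)) \<Longrightarrow> cyclic_list xs"
proof (induction xs)
  case (Cons x xs)
  have "cyclic_list xs"
    using Cons.prems [of "Suc _" "Suc _" "Suc _"] by (intro Cons.IH) auto
  moreover have "sorted_wrt (cyc3 x) xs"
    unfolding sorted_wrt_iff_nth_less using Cons.prems [of 0 "Suc _" "Suc _"] by auto
  ultimately show ?case by simp
qed simp

context
  fixes n :: nat
  assumes n: "n \<ge> 1"
begin

private abbreviation \<mu> where "\<mu> \<equiv> roots_of_unity n"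
private abbreviation Br where "Br \<equiv> braid_group \<mu>"

definition vertex_braid :: "nat \<Rightarrow> nat \<Rightarrow> (real \<Rightarrow> complex set) set" where
  "vertex_braid i j = pair_braid \<mu> (vertex n i) (vertex n j)"

definition index_monodromy :: "(real \<Rightarrow> complex set) set \<Rightarrow> nat \<Rightarrow> nat" where
  "index_monodromy A i = inv_into {..<n} (vertex n) (monodromy A (vertex n i))"

lemma braid_group_roots: "Br = fundamental_group (configuration_space n) \<mu>"
  by (simp add: braid_group_def card_roots [OF n])

lemma monodromy_in_roots:
  assumes A: "A \<in> carrier Br" and z: "z \<in> \<mu>"
  shows "monodromy A z \<in> \<mu>"
proof -
  have n0: "n > 0" using n by simp
  obtain p where p: "p \<in> loops_at (configuration_space n) \<mu>" "A = loop_class (configuration_space n) \<mu> p"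
    using A unfolding braid_group_roots by (rule carrier_loop_class)
  obtain w where w: "string_end p z w"
    using string_end_exists [OF finite_roots [OF n] card_roots [OF n] n0 p(1) z] by blast
  then show ?thesis
    using monodromy_eqI [OF finite_roots [OF n] card_roots [OF n] n0 p(1) w]
      string_end_in [OF finite_roots [OF n] card_roots [OF n] n0 p(1) w] p(2) by simp
qed

lemma vertex_in_roots: "i < n \<Longrightarrow> vertex n i \<in> \<mu>"
  using image_vertex [OF n] by blast

lemma vertex_index_monodromy:
  assumes "A \<in> carrier Br" "i < n"
  shows "vertex n (index_monodromy A i) = monodromy A (vertex n i)"
  unfolding index_monodromy_def
  using monodromy_in_roots [OF assms(1) vertex_in_roots [OF assms(2)]] image_vertex [OF n]
  by (intro f_inv_into_f) simp

lemma index_vertex: "i < n \<Longrightarrow> inv_into {..<n} (vertex n) (vertex n i) = i"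
  using inj_vertex [OF n] by (simp add: inv_into_f_f)

lemma dual_braid_roots: "dual_braid Br n vertex_braid index_monodromy braid_length"
proof -
  have n0: "n > 0" using n by simp
  note fin = finite_roots [OF n] and card = card_roots [OF n]
  have ne: "\<mu> \<noteq> {}" using card n0 by auto
  have top: "\<mu> \<in> topspace (configuration_space n)"
    by (rule configuration_in_topspace [OF fin card n0])
  interpret group Br
    unfolding braid_group_roots by (rule group_fundamental_group [OF top])
  have nop: "nonobstructing_pair \<mu> (vertex n i) (vertex n j)" if "i < n" "j < n" "i \<noteq> j" for i j
    using nonobstructing_pair_roots [OF n that] .
  show ?thesis
  proof (unfold_locales, goal_cases)
    case 1
    show ?case by (rule n)
  next
    case (2 i j)
    then show ?case
      unfolding vertex_braid_def by (intro pair_braid_closed fin nop)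
  next
    case (3 i j)
    show ?case
      unfolding vertex_braid_def by (rule pair_braid_sym)
  next
    case (4 i j k)
    then have ne: "i \<noteq> j" "j \<noteq> k" "i \<noteq> k"
      by (auto simp: cyc3_def)
    have cyc: "cyc3 j k i"
      using 4 by (auto simp: cyc3_def)
    \<comment> \<open>It is used for \<open>(i, j, k)\<close> and for \<open>(j, k, i)\<close>: both
      sides of the triangle relation become rotations of the same triangle.\<close>
    have rot: "pair_braid \<mu> (vertex n i) (vertex n j) \<otimes>\<^bsub>Br\<^esub> pair_braid \<mu> (vertex n j) (vertex n k) =
        loop_class (configuration_space (card \<mu>)) \<mu> (rotation_loop \<mu> (vertex n i) (vertex n j) (vertex n k))"
      if "i < n" "j < n" "k < n" "i \<noteq> j" "j \<noteq> k" "cyc3 i j k" for i j k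
    proof (rule pair_braids_rotation [OF fin])
      show "convex hull {vertex n i, vertex n j, vertex n k} \<inter> \<mu> = {vertex n i, vertex n j, vertex n k}"
        using hull_roots [OF n, of "{i, j, k}"] that by simp
      show "Im (cnj (vertex n j - vertex n i) * (vertex n k - vertex n i)) < 0"
        using orient_vertex [of i n j k] that by (simp add: orient_def)
    qed (use that vertex_in_roots nop in auto)
    show ?case
      unfolding vertex_braid_def rot [OF 4(1,2,3) ne(1,2) 4(4)] rot [OF 4(2,3,1) ne(2) ne(3) [symmetric] cyc]
      by (subst rotation_loop_cyclic) (rule HOL.refl)
  next
    case (5 i j k l)
    have "convex hull (vertex n ` {i, j}) \<inter> convex hull (vertex n ` {k, l}) = {}"
      using 5 by (intro disjoint_hulls [OF n]) auto
    then show ?case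
      unfolding vertex_braid_def using 5 by (intro pair_braids_commute fin nop) (simp_all add: segment_convex_hull)
  next
    case (6 A B v)
    have "monodromy (A \<otimes>\<^bsub>Br\<^esub> B) (vertex n v) = monodromy B (monodromy A (vertex n v))"
      using 6 monodromy_mult [OF fin card n0, of A B "vertex n v"] vertex_in_roots
      by (simp add: braid_group_roots)
    then show ?case
      using 6 by (simp add: index_monodromy_def [of "A \<otimes>\<^bsub>Br\<^esub> B"] index_monodromy_def [of B] vertex_index_monodromy)
  next
    case (7 v)
    then show ?case
      using monodromy_one [OF fin card n0 vertex_in_roots [OF 7]] index_vertex
      by (simp add: index_monodromy_def braid_group_roots)
  next
    case (8 i j v)
    then show ?case
      using monodromy_pair_braid [OF fin ne nop [OF 8(1-3)] vertex_in_roots [OF 8(4)]]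
        vertex_eq_iff [OF n, of v i] vertex_eq_iff [OF n, of v j]
      by (simp add: index_monodromy_def vertex_braid_def swap_def index_vertex)
  next
    case (9 A B)
    then show ?case
      using braid_length_mult [OF fin card] by (simp add: braid_group_roots)
  next
    case (10 i j)
    then show ?case
      unfolding vertex_braid_def by (intro braid_length_pair_braid [OF fin ne] nop)
  qed
qed

interpretation dual: dual_braid Br n vertex_braid index_monodromy braid_length
  by (rule dual_braid_roots)

section \<open>Translation of parts and partitions into indices\<close>

lemma clockwise_numbering_sorted:
  assumes A: "A \<subseteq> {..<n}"
  shows "clockwise_numbering (vertex n ` A) (map (vertex n) (sorted_list_of_set A))"
proof -
  let ?xs = "sorted_list_of_set A"
  have fin: "finite A" using A finite_subset by blast
  have "orient (vertex n (?xs ! i)) (vertex n (?xs ! j)) (vertex n (?xs ! k)) < 0"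
    if "i < j" "j < k" "k < length ?xs" for i j k
  proof (rule orient_vertex_less)
    have "sorted_wrt (<) ?xs" by simp
    then show "?xs ! i < ?xs ! j" "?xs ! j < ?xs ! k"
      using that by (simp_all add: sorted_wrt_nth_less)
    show "?xs ! k < n"
      using nth_mem [OF that(3)] A fin by auto
  qed
  moreover have "inj_on (vertex n) A"
    by (rule inj_on_subset [OF inj_vertex [OF n] A])
  ultimately show ?thesis
    using fin by (simp add: clockwise_numbering_def distinct_map orient_def)
qed

text \<open>The choice in \<open>part_braid\<close> may return any clockwise numbering. Each one
  corresponds to a cyclic list of indices, over which the path product is always the same.\<close>

lemma clockwise_numbering_indices:
  assumes A: "A \<subseteq> {..<n}" and zs: "clockwise_numbering (vertex n ` A) zs"
  obtains ks where "zs = map (vertex n) ks" "distinct ks" "set ks = A" "cyclic_list ks"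
proof
  define ks where "ks = map (inv_into {..<n} (vertex n)) zs"
  have set: "set zs = vertex n ` A" and dist: "distinct zs"
    using zs by (auto simp: clockwise_numbering_def)
  have "vertex n (inv_into {..<n} (vertex n) z) = z" if "z \<in> set zs" for z
    using that set A by (intro f_inv_into_f) auto
  then show zs_eq: "zs = map (vertex n) ks"
    by (simp add: ks_def map_idI)
  show dk: "distinct ks"
    using dist zs_eq by (simp add: distinct_map)
  have "inv_into {..<n} (vertex n) ` vertex n ` A = A"
    using A inj_vertex [OF n] by (simp add: inv_into_image_cancel)
  then show sk: "set ks = A"
    by (simp add: ks_def set)
  show "cyclic_list ks"
  proof (rule cyclic_listI)
    fix i j k assume ijk: "i < j" "j < k" "k < length ks"
    then have "ks ! i < n" "ks ! j < n" "ks ! k < n"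
      using sk A nth_mem [of i ks] nth_mem [of j ks] nth_mem [of k ks] by auto
    moreover have "ks ! i \<noteq> ks ! j" "ks ! j \<noteq> ks ! k" "ks ! i \<noteq> ks ! k"
      using ijk dk by (simp_all add: nth_eq_iff_index_eq)
    moreover have "orient (vertex n (ks ! i)) (vertex n (ks ! j)) (vertex n (ks ! k)) < 0"
      using zs ijk unfolding clockwise_numbering_def zs_eq by (auto simp: orient_def)
    ultimately show "cyc3 (ks ! i) (ks ! j) (ks ! k)"
      by (simp add: cyc3_iff_orient)
  qed
qed

lemma part_braid_roots:
  assumes A: "A \<subseteq> {..<n}"
  shows "part_braid \<mu> (vertex n ` A) = dual.block_prod A"
proof -
  define zs where "zs = (SOME zs. clockwise_numbering (vertex n ` A) zs)"
  have "clockwise_numbering (vertex n ` A) zs"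
    unfolding zs_def using clockwise_numbering_sorted [OF A] by (rule someI)
  then obtain ks where ks: "zs = map (vertex n) ks" "distinct ks" "set ks = A" "cyclic_list ks"
    using clockwise_numbering_indices [OF A] by blast
  have "map2 (pair_braid \<mu>) zs (tl zs) = map (\<lambda>(i, j). vertex_braid i j) (zip ks (tl ks))"
    unfolding ks(1) map_tl [symmetric] zip_map_map by (simp add: vertex_braid_def case_prod_unfold)
  then have "part_braid \<mu> (vertex n ` A) = dual.path_prod ks"
    unfolding part_braid_def Let_def zs_def [symmetric] dual.path_prod_def dual.word_prod_def by simp
  then show ?thesis
    using dual.path_prod_cyclic [OF ks(4,2)] ks(3) A by simp
qed

lemma partition_braid_roots:
  assumes M: "noncrossing_partition n M"
  shows "partition_braid \<mu> ((`) (vertex n) ` M) = dual.partition_prod M"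
proof -
  let ?L = "(`) (vertex n) ` M"
  note MD = noncrossing_partitionD [OF M]
  have inj: "inj_on ((`) (vertex n)) (Pow {..<n})"
    by (rule inj_on_image_Pow [OF inj_vertex [OF n]])
  have sub: "M \<subseteq> Pow {..<n}" using MD(1) by blast
  define As where "As = (SOME As. distinct As \<and> set As = ?L)"
  have "finite ?L" using MD(6) by simp
  then obtain Cs where "set Cs = ?L" "distinct Cs"
    by (elim exE conjE finite_distinct_list [THEN exE])
  then have "\<exists>As. distinct As \<and> set As = ?L"
    by (intro exI [of _ Cs] conjI)
  then have As: "distinct As" "set As = ?L"
    unfolding As_def by (rule someI2_ex; simp)+
  define Bs where "Bs = map (inv_into (Pow {..<n}) ((`) (vertex n))) As"
  have "vertex n ` inv_into (Pow {..<n}) ((`) (vertex n)) A = A" if "A \<in> set As" for A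
    using that As(2) sub by (intro f_inv_into_f [of _ "(`) (vertex n)"]) auto
  then have eq: "As = map ((`) (vertex n)) Bs"
    by (simp add: Bs_def map_idI)
  have "inv_into (Pow {..<n}) ((`) (vertex n)) ` ?L = M"
    using inj sub by (simp add: inv_into_image_cancel)
  then have set_Bs: "set Bs = M"
    by (simp add: Bs_def As(2))
  moreover have "distinct Bs"
    using As(1) eq by (simp add: distinct_map)
  ultimately have "dual.partition_prod M = list_product Br (map dual.block_prod Bs)"
    using dual.partition_prod_eq [OF M] by blast
  moreover have "map (part_braid \<mu>) As = map dual.block_prod Bs"
    unfolding eq using set_Bs MD(1) part_braid_roots by simp
  ultimately show ?thesis
    unfolding partition_braid_def Let_def As_def [symmetric] by simp
qed

lemma nonobstructing_partition_roots:
  assumes M: "noncrossing_partition n M"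
  shows "nonobstructing_partition \<mu> ((`) (vertex n) ` M)"
  unfolding nonobstructing_partition_def
proof (intro conjI ballI impI)
  note MD = noncrossing_partitionD [OF M]
  have "partition_on (vertex n ` {..<n}) ((`) (vertex n) ` M - {{}})"
    using M by (intro partition_on_inj_image inj_vertex [OF n]) (simp add: noncrossing_partition_def)
  moreover have "{} \<notin> (`) (vertex n) ` M"
    using MD(3) by auto
  ultimately show "partition_on \<mu> ((`) (vertex n) ` M)"
    by (simp add: image_vertex [OF n])
  show "convex_subset A" if "A \<in> (`) (vertex n) ` M" for A
    using that MD(1,3) convex_subset_roots [OF n] by blast
  fix A B assume "A \<in> (`) (vertex n) ` M" "B \<in> (`) (vertex n) ` M" "A \<noteq> B"
  then obtain A' B' where AB: "A' \<in> M" "B' \<in> M" "A = vertex n ` A'" "B = vertex n ` B'" "A' \<noteq> B'"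
    by blast
  then have "A' \<inter> B' = {}"
    using MD(4) [OF AB(1,2)] by blast
  then show "convex hull A \<inter> convex hull B = {}"
    unfolding AB(3,4) using AB MD(1,3,5) by (intro disjoint_hulls [OF n]) auto
qed

lemma nonobstructing_partition_indices:
  assumes L: "nonobstructing_partition \<mu> L"
  obtains M where "noncrossing_partition n M" "L = (`) (vertex n) ` M"
proof
  define f where "f = inv_into {..<n} (vertex n)"
  define M where "M = (`) f ` L"
  have part: "partition_on \<mu> L"
    using L by (simp add: nonobstructing_partition_def)
  have ef: "vertex n ` f ` A = A" if "A \<in> L" for A
  proof -
    have "A \<subseteq> \<mu>" using partition_onD1 [OF part] that by auto
    then have "vertex n (f z) = z" if "z \<in> A" for z
      unfolding f_def using that image_vertex [OF n] by (intro f_inv_into_f) auto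
    then show ?thesis by force
  qed
  then show LM: "L = (`) (vertex n) ` M"
    unfolding M_def image_image by simp
  have inj_f: "inj_on f \<mu>"
    unfolding f_def image_vertex [OF n, symmetric] by (rule inj_on_inv_into) simp
  have fX: "f ` \<mu> = {..<n}"
    unfolding f_def image_vertex [OF n, symmetric] using inj_vertex [OF n]
    by (intro inv_into_image_cancel) auto
  have "partition_on (f ` \<mu>) ((`) f ` L - {{}})"
    by (rule partition_on_inj_image [OF part inj_f])
  moreover have "{} \<notin> M"
    using partition_onD3 [OF part] by (auto simp: M_def)
  ultimately have partM: "partition_on {..<n} M"
    by (simp add: fX M_def)
  show "noncrossing_partition n M"
    unfolding noncrossing_partition_def
  proof (intro conjI ballI impI partM)
    fix A B assume AB: "A \<in> M" "B \<in> M" "A \<noteq> B"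
    have sub: "A \<subseteq> {..<n}" "B \<subseteq> {..<n}"
      using partition_onD1 [OF partM] AB by auto
    have "vertex n ` A \<noteq> vertex n ` B"
      using inj_on_image_eq_iff [OF inj_vertex [OF n] sub] AB(3) by simp
    then have "convex hull (vertex n ` A) \<inter> convex hull (vertex n ` B) = {}"
      using L AB LM unfolding nonobstructing_partition_def by blast
    then show "noncrossing A B"
      by (rule noncrossing_if_disjoint_hulls [OF n sub])
  qed
qed

lemma partition_braids_roots: "partition_braids \<mu> = dual.P"
proof (intro equalityI subsetI)
  fix b assume "b \<in> partition_braids \<mu>"
  then obtain L where L: "nonobstructing_partition \<mu> L" "b = partition_braid \<mu> L"
    by (auto simp: partition_braids_def)
  obtain M where M: "noncrossing_partition n M" "L = (`) (vertex n) ` M"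
    using nonobstructing_partition_indices [OF L(1)] .
  show "b \<in> dual.P"
    unfolding L(2) M(2) partition_braid_roots [OF M(1)] using M(1) by (intro imageI CollectI)
next
  fix b assume "b \<in> dual.P"
  then obtain M where M: "noncrossing_partition n M" "b = dual.partition_prod M"
    by blast
  then show "b \<in> partition_braids \<mu>"
    unfolding partition_braids_def
    using nonobstructing_partition_roots [OF M(1)] partition_braid_roots [OF M(1)] by auto
qed

text \<open>The submonoid has the multiplication of the group, and \<open>restricted_product\<close>
  depends only on this and on \<open>P\<close>; so the computation may take place in the
  group.\<close>

lemma restricted_product_roots: "restricted_product (braid_monoid \<mu>) P = restricted_product Br P"
  by (simp add: restricted_product_def braid_monoid_def fun_eq_iff)

lemma pre_garside_roots:
  "pre_garside (partition_braids \<mu>) (restricted_product (braid_monoid \<mu>) (partition_braids \<mu>))"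
  "\<exists>\<delta>. least_common_multiple (partition_braids \<mu>)
    (right_multiple (partition_braids \<mu>) (restricted_product (braid_monoid \<mu>) (partition_braids \<mu>)))
    (partition_braids \<mu>) \<delta>"
proof -
  interpret factors: garside_factors Br dual.P dual.\<delta> braid_length
    by (rule dual.garside_factors)
  show "pre_garside (partition_braids \<mu>) (restricted_product (braid_monoid \<mu>) (partition_braids \<mu>))"
    unfolding restricted_product_roots partition_braids_roots
    by (rule factors.pre_garside_restricted_product)
  show "\<exists>\<delta>. least_common_multiple (partition_braids \<mu>)
    (right_multiple (partition_braids \<mu>) (restricted_product (braid_monoid \<mu>) (partition_braids \<mu>)))
    (partition_braids \<mu>) \<delta>"
    unfolding restricted_product_roots partition_braids_roots
    using factors.least_common_multiple_delta by blast
qed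

end

theorem theorem3p2:
  fixes n :: nat
  assumes "n \<ge> 1"
  shows "let P = partition_braids (roots_of_unity n);
             m = restricted_product (braid_monoid (roots_of_unity n)) P
         in pre_garside P m \<and>
            (\<exists>\<delta>. least_common_multiple P (right_multiple P m) P \<delta>)"
  unfolding Let_def using pre_garside_roots [OF assms] by (rule conjI)

end
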